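(* Let $\delta<0.01$ be a positive real number, $c_1,c_2$ positive constants, $X$ large, and $\mathcal{B}\subset V(\mathbb{R})$ the box $|b_{ij}|\leq X_{ij}$ ($(i,j)\in\{(1,1),(1,2),(1,3),(1,4),(2,2),(2,4),(3,3),(3,4),(4,4)\}$) where $c_1^{-1}X^{1-2\delta}\leq X_{ij}\leq c_1X^{1+2\delta}$, $X_{14}=c_2X$ and $X_{11} X_{44} = X_{22} X_{33} = X_{12} X_{34} = X_{13} X_{24} = c_2^2 X^2$. Let $m$ be an odd squarefree positive integer with $m \ll X^{1/3}$. Let $B_0 \in V(\mathbb{Z})$ be such that $m \mid q(B_0)$ and $B_0$ is nonzero modulo $p$ for each prime $p\mid m$. Let $N_q(\mathcal{B}; m, B_0)$ be the number of $B\in \mathcal{B}\cap V(\mathbb{Z})$ with $B\equiv B_0\pmod{m}$ and $q(B)=0$. For $r\ge1$ set $$C_q(r) = \frac{1}{r^9} \sum_{\substack{0 \leq a < r \\ \gcd(a, r) = 1}} \sum_{B \bmod{r}} e\Big(\frac{a}{r} q(B)\Big),$$ and define $\mathfrak{S}(q) = \sum_{r \geq 1} C_q(r)$, $\mathfrak{S}(q; p) = \sum_{\ell \geq 0} C_q(p^\ell)$ for primes $p$, and $$\mathfrak{S}_\infty(\mathcal{B};q) = \int_{\mathbb{R}} \int_{\mathcal{B}} e(\theta q(B))\, dB \, d\theta,\qquad e(x) = e^{2\pi ix}.$$ Then $$N_q(\mathcal{B}; m, B_0) = \frac{1}{m^8} \Big(\prod_{p \mid m} \mathfrak{S}(q;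 p)^{-1}\Big) \mathfrak{S}(q)\, \mathfrak{S}_\infty(\mathcal{B}; q) + O\left(\frac{X^{6.85(1 + 2\delta)}}{m^{5.5}} \log X\right),$$ with the implied constant being absolute. Moreover, the series defining $\mathfrak{S}(q)$ and $\mathfrak{S}(q;p)$ converge absolutely and all of $\mathfrak{S}(q)$, $\mathfrak{S}(q;p)$ are positive.
   Context: $V$ is the $9$-dimensional space of symmetric $4\times4$ matrices $B=(b_{ij})$ with $b_{23}=-b_{14}$, with coordinates $b_{11},b_{12},b_{13},b_{14},b_{22},b_{24},b_{33},b_{34},b_{44}$; $dB$ is Lebesgue measure in these coordinates. $q(B) = -b_{11}b_{44} - b_{22}b_{33} - 2b_{12}b_{34} - 2b_{13}b_{24} - 2b_{14}^2$. "$B \bmod r$" ranges over $V(\mathbb{Z}/r\mathbb{Z})$. "$B_0$ nonzero modulo $p$" means not all coordinates of $B_0$ are divisible by $p$. *)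

theory Defs
  imports "HOL-Analysis.Analysis" "HOL-Computational_Algebra.Squarefree"
begin

definition V :: "('a::comm_ring_1 ^ 4 ^ 4) set" where
  "V = {B. transpose B = B \<and> B $ 2 $ 3 = - (B $ 1 $ 4)}"

definition coords :: "(4 \<times> 4) set" where
  "coords = {(1,1), (1,2), (1,3), (1,4), (2,2), (2,4), (3,3), (3,4), (4,4)}"

definition quad_q :: "'a::comm_ring_1 ^ 4 ^ 4 \<Rightarrow> 'a" where
  "quad_q B = - (B$1$1 * B$4$4) - B$2$2 * B$3$3 - 2 * B$1$2 * B$3$4 - 2 * B$1$3 * B$2$4
     - 2 * (B$1$4)\<^sup>2"

definition of_coords :: "(4 \<times> 4 \<Rightarrow> 'a) \<Rightarrow> 'a::comm_ring_1 ^ 4 ^ 4" where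
  "of_coords b = (\<chi> i j.
     if (i, j) \<in> coords then b (i, j)
     else if (j, i) \<in> coords then b (j, i)
     else - b (1, 4))"

text \<open>The measure \<open>dB\<close>: Lebesgue measure in the nine coordinates, transported to a measure on all
  real \<open>4 \<times> 4\<close> matrices that is concentrated on \<open>V\<close>.\<close>

definition lebesgue_V :: "(real ^ 4 ^ 4) measure" where
  "lebesgue_V = distr (Pi\<^sub>M coords (\<lambda>_. lborel)) borel of_coords"

text \<open>Checks that \<open>of_coords\<close> is the coordinate parametrization of \<open>V\<close>, and that it is measurable,
  so that \<open>lebesgue_V\<close> is a genuine push-forward.\<close>


lemma of_coords_in_V: "of_coords b \<in> V"
  unfolding V_def of_coords_def coords_def
  by (auto simp: vec_eq_iff transpose_def forall_4)

lemma of_coords_nth: "(i, j) \<in> coords \<Longrightarrow> of_coords b $ i $ j = b (i, j)"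
  by (simp add: of_coords_def)

lemma of_coords_entries:
  assumes "B \<in> V"
  shows "of_coords (\<lambda>(i, j). B $ i $ j) = B"
proof -
  have "B $ 2 $ 3 = - (B $ 1 $ 4)"
    using assms by (simp add: V_def)
  moreover have "B $ j $ i = B $ i $ j" for i j
  proof -
    have "transpose B $ i $ j = B $ i $ j"
      using assms by (simp add: V_def)
    then show ?thesis
      by (simp add: transpose_def)
  qed
  from this[of 2 1] this[of 3 1] this[of 3 2] this[of 4 1] this[of 4 2] this[of 4 3]
  have "B $ 2 $ 1 = B $ 1 $ 2" "B $ 3 $ 1 = B $ 1 $ 3" "B $ 3 $ 2 = B $ 2 $ 3"
    "B $ 4 $ 1 = B $ 1 $ 4" "B $ 4 $ 2 = B $ 2 $ 4" "B $ 4 $ 3 = B $ 3 $ 4" .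
  ultimately show ?thesis
    by (simp add: vec_eq_iff forall_4 of_coords_def coords_def)
qed

lemma measurable_of_coords:
  "(of_coords :: _ \<Rightarrow> real ^ 4 ^ 4) \<in> measurable (Pi\<^sub>M coords (\<lambda>_. lborel)) borel"
proof -
  have c: "(\<lambda>b. b k) \<in> borel_measurable (Pi\<^sub>M coords (\<lambda>_. lborel :: real measure))"
    if "k \<in> coords" for k
    using measurable_component_singleton[OF that, of "\<lambda>_. lborel :: real measure"] by simp
  have "(1, 4) \<in> coords"
    by (simp add: coords_def)
  then have "(\<lambda>b. of_coords b $ i $ j) \<in> borel_measurable (Pi\<^sub>M coords (\<lambda>_. lborel :: real measure))"
    for i j
    using c[of "(1, 4)"] c[of "(i, j)"] c[of "(j, i)"]
    by (cases "(i, j) \<in> coords"; cases "(j, i) \<in> coords") (simp_all add: of_coords_def)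
  then have "(\<lambda>b. of_coords b \<bullet> (axis i (axis j 1) :: real ^ 4 ^ 4))
      \<in> borel_measurable (Pi\<^sub>M coords (\<lambda>_. lborel))" for i j
    by (simp add: inner_axis)
  then show ?thesis
    by (subst borel_measurable_euclidean_space) (auto simp: Basis_vec_def)
qed

definition coord_box :: "(4 \<Rightarrow> 4 \<Rightarrow> real) \<Rightarrow> (real ^ 4 ^ 4) set" where
  "coord_box Y = {B \<in> V. \<forall>(i, j) \<in> coords. \<bar>B $ i $ j\<bar> \<le> Y i j}"

definition N_q :: "(real ^ 4 ^ 4) set \<Rightarrow> nat \<Rightarrow> int ^ 4 ^ 4 \<Rightarrow> nat" where
  "N_q \<B> m B0 = card {B \<in> V. map_matrix real_of_int B \<in> \<B>
     \<and> (\<forall>(i, j) \<in> coords. int m dvd B $ i $ j - B0 $ i $ j) \<and> quad_q B = 0}"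

definition e_fun :: "real \<Rightarrow> complex" where
  "e_fun x = exp (2 * of_real pi * \<i> * of_real x)"

text \<open>Representatives of the elements of \<open>V(\<int>/r\<int>)\<close>: the nine coordinates are reduced to
  \<open>{0..<r}\<close>; the entries \<open>b\<^sub>2\<^sub>3 = b\<^sub>3\<^sub>2 = -b\<^sub>1\<^sub>4\<close> are determined by them and are not reduced.\<close>

definition V_mod :: "nat \<Rightarrow> (int ^ 4 ^ 4) set" where
  "V_mod r = {B \<in> V. \<forall>(i, j) \<in> coords. B $ i $ j \<in> {0..<int r}}"

definition C_q :: "nat \<Rightarrow> complex" where
  "C_q r = 1 / of_nat r ^ 9 *
     (\<Sum>a \<in> {a. a < r \<and> gcd a r = 1}. \<Sum>B \<in> V_mod r.
        e_fun (real a / real r * real_of_int (quad_q B)))"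

definition sing_series :: complex where
  "sing_series = (\<Sum>r. C_q (Suc r))"

definition sing_series_at :: "nat \<Rightarrow> complex" where
  "sing_series_at p = (\<Sum>l. C_q (p ^ l))"

definition sing_integral :: "(real ^ 4 ^ 4) set \<Rightarrow> complex" where
  "sing_integral \<B> =
     (LINT \<theta>|lborel. set_lebesgue_integral lebesgue_V \<B> (\<lambda>B. e_fun (\<theta> * quad_q B)))"

end

theory Submission
  imports Defs "HOL-Real_Asymp.Real_Asymp"
begin

text \<open>
  The form \<open>q\<close> is a sum of four multiples \<open>kxy\<close> of hyperbolic planes, with \<open>k = -1\<close> or \<open>k = -2\<close>,
  and of \<open>-2z\<^sup>2\<close>. The generating function \<open>S(t) = \<Sum> e(t q(B)/m)\<close> over the points of the box in
  the class of \<open>B\<^sub>0\<close> therefore factors into four bilinear sums and one quadratic sum, and the inner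
  sums of the bilinear ones are geometric. By Dirichlet's theorem every \<open>t\<close> is \<open>a/r + m\<beta>\<close> with
  \<open>r \<le> R\<close> and \<open>\<bar>m\<beta>\<bar> \<le> 1/(rR)\<close>, where \<open>R\<close> exceeds the side lengths by a constant factor. In each
  bilinear sum the \<open>x\<close> with \<open>kx\<close> not divisible by \<open>r\<close> contribute \<open>O(R log R)\<close>, and the remaining
  ones \<open>O(W/(mr) (1 + W\<bar>\<beta>\<bar>)\<^sup>-\<^sup>3\<^sup>/\<^sup>4)\<close> with \<open>W = c\<^sub>2\<^sup>2 X\<^sup>2\<close>, which is replaced by an integral when \<open>r\<close> is
  coprime to \<open>m\<close>. If a prime \<open>p\<close> divides both \<open>r\<close> and \<open>m\<close>, a coordinate of \<open>B\<^sub>0\<close> prime to \<open>p\<close> kills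
  the main term of one of the five factors. Hence only the \<open>r\<close> coprime to \<open>m\<close> survive, and their
  contribution to the singular series is \<open>\<SS>(q)\<close> divided by the Euler factors at the primes dividing \<open>m\<close>.

  The local sums satisfy \<open>\<bar>C\<^sub>q(r)\<bar> \<le> 2/r\<^sup>3\<close>, so the terms with \<open>r \<ge> 2\<close> add up to at most 1/2 while
  \<open>C\<^sub>q(1) = 1\<close>; this gives absolute convergence and positivity.
\<close>

section \<open>Exponential sums over arithmetic progressions\<close>

text \<open>All real t are approximated with the same R; the major arcs are the points with
  denominator at most Q, where Q is about X^0.6. Elsewhere each bilinear factor is at most about
  X^2/(mQ) and the quadratic sum is bounded trivially, which costs X^9/(Q^4 m^5). For m as large as
  X^(1/3) this stays below X^6.85/m^5.5 only if Q is at least about X^0.58. In the other direction,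
  the quadratic sum is compared with an integral along steps mr <= mQ, which must not exceed Z = c2
  X, so Q has to stay below X^(2/3). The largest error comes from the arcs: replacing one factor by
  its main term costs about X^6/m^3, up to a logarithm, and multiplication by m^5.5 makes this X^(6
  + 5/6), just under X^6.85. The quadratic sum is approximated without any use of oscillation, so
  its error grows like r(1 + W|\<beta>|), and the decay of the bilinear factors has to pay for it.
  Dividing the phase by m is possible because m divides q(B) on the residue class; it makes the
  generating function 1-periodic, and the substitution from t back to \<beta> supplies the factor m
  that turns m^-9, from nine coordinates, into m^-8.\<close>

lemma e_fun_eq_cis: "e_fun x = cis (2 * pi * x)"
  by (simp add: e_fun_def cis_conv_exp algebra_simps)

lemma norm_e_fun [simp]: "norm (e_fun x) = 1"
  by (simp add: e_fun_eq_cis)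

lemma e_fun_add: "e_fun (x + y) = e_fun x * e_fun y"
  by (simp add: e_fun_eq_cis cis_mult algebra_simps)

lemma e_fun_0 [simp]: "e_fun 0 = 1"
  by (simp add: e_fun_def)

lemma e_fun_of_int [simp]: "e_fun (of_int n) = 1"
  unfolding e_fun_eq_cis by (metis Ints_of_int cis_multiple_2pi)

lemma e_fun_add_of_int [simp]: "e_fun (x + of_int n) = e_fun x" "e_fun (of_int n + x) = e_fun x"
  by (simp_all add: e_fun_add)

lemma e_fun_cong_int: "x - y \<in> \<int> \<Longrightarrow> e_fun x = e_fun y"
  by (metis Ints_cases add.commute diff_add_cancel e_fun_add_of_int(1))

lemma e_fun_minus: "e_fun (- x) = cnj (e_fun x)"
  by (simp add: e_fun_eq_cis cis_cnj)

lemma continuous_on_e_fun [continuous_intros]: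
  "continuous_on S f \<Longrightarrow> continuous_on S (\<lambda>x. e_fun (f x))"
  unfolding e_fun_def by (intro continuous_intros)

lemma borel_measurable_e_fun [measurable]: "e_fun \<in> borel_measurable borel"
  by (intro borel_measurable_continuous_onI continuous_intros)

lemma e_fun_has_vector_derivative:
  assumes "(f has_real_derivative f') (at x within S)"
  shows "((\<lambda>x. e_fun (f x)) has_vector_derivative
          (2 * of_real pi * \<i> * of_real f' * e_fun (f x))) (at x within S)"
proof -
  have "((\<lambda>x. 2 * of_real pi * \<i> * complex_of_real (f x)) has_vector_derivative
          2 * of_real pi * \<i> * of_real f') (at x within S)"
    using assms by (intro has_vector_derivative_mult_right has_vector_derivative_of_real)
      (simp add: has_real_derivative_iff_has_vector_derivative)
  then show ?thesis
    unfolding e_fun_def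
    using field_vector_diff_chain_within[of "\<lambda>x. 2 * of_real pi * \<i> * complex_of_real (f x)" _ x S exp,
        OF _ has_field_derivative_at_within[OF DERIV_exp]]
    by (auto simp: o_def)
qed

lemma norm_e_fun_diff_le: "norm (e_fun x - e_fun y) \<le> 2 * pi * \<bar>x - y\<bar>"
proof -
  have "norm (e_fun x - e_fun y) \<le> 2 * pi * norm (x - y)"
  proof (rule differentiable_bound[where S = UNIV and f' = "\<lambda>x h. h *\<^sub>R (2 * of_real pi * \<i> * of_real 1 * e_fun x)"])
    show "(e_fun has_derivative (\<lambda>h. h *\<^sub>R (2 * of_real pi * \<i> * of_real 1 * e_fun x))) (at x within UNIV)" for x
      using e_fun_has_vector_derivative[of "\<lambda>x. x" 1 x UNIV]
      by (simp add: has_vector_derivative_def)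
    show "onorm (\<lambda>h. h *\<^sub>R (2 * complex_of_real pi * \<i> * complex_of_real 1 * e_fun x)) \<le> 2 * pi" for x
      by (rule onorm_le) (simp add: norm_mult)
  qed auto
  then show ?thesis by simp
qed

section \<open>Distance to the nearest integer and the size of e(x) - 1\<close>

definition dint :: "real \<Rightarrow> real" where
  "dint x = \<bar>x - of_int (round x)\<bar>"

lemma dint_nonneg [simp]: "0 \<le> dint x"
  by (simp add: dint_def)

lemma dint_le: "dint x \<le> \<bar>x - of_int n\<bar>"
  unfolding dint_def by (metis abs_minus_commute round_diff_minimal)

lemma dint_le_half: "dint x \<le> 1 / 2"
  unfolding dint_def using of_int_round_abs_le[of x] by (simp add: abs_minus_commute)

lemma dint_add_of_int [simp]: "dint (x + of_int n) = dint x"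
proof (rule antisym)
  show "dint (x + of_int n) \<le> dint x"
    using dint_le[of "x + of_int n" "round x + n"] by (simp add: dint_def)
  show "dint x \<le> dint (x + of_int n)"
    using dint_le[of x "round (x + of_int n) - n"] by (simp add: dint_def algebra_simps)
qed

lemma dint_add_le: "dint x \<le> dint (x + y) + \<bar>y\<bar>"
  using dint_le[of x "round (x + y)"] unfolding dint_def by linarith

lemma dint_eq_abs: "\<bar>x\<bar> \<le> 1 / 2 \<Longrightarrow> dint x = \<bar>x\<bar>"
proof (rule antisym)
  show "dint x \<le> \<bar>x\<bar>" using dint_le[of x 0] by simp
  assume *: "\<bar>x\<bar> \<le> 1 / 2"
  show "\<bar>x\<bar> \<le> dint x"
  proof (cases "round x = 0")
    case False
    then have "1 \<le> \<bar>real_of_int (round x)\<bar>" by linarith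
    then show ?thesis using * unfolding dint_def by linarith
  qed (simp add: dint_def)
qed

lemma dint_fraction_ge:
  assumes "\<not> int r dvd n" and r: "r > 0"
  shows "dint (real_of_int n / real r) \<ge> 1 / real r"
proof -
  define k where "k = round (real_of_int n / real r)"
  have "n - int r * k \<noteq> 0" using assms by auto
  then have "1 \<le> \<bar>real_of_int (n - int r * k)\<bar>" by linarith
  moreover have "dint (real_of_int n / real r) = \<bar>real_of_int (n - int r * k)\<bar> / real r"
  proof -
    have "real_of_int n / real r - of_int k = real_of_int (n - int r * k) / real r"
      using r by (simp add: field_simps)
    then show ?thesis using r unfolding dint_def k_def[symmetric] by (simp add: abs_divide)
  qed
  ultimately show ?thesis using r by (simp add: divide_right_mono)
qed

text \<open>Jordan's inequality: sine is concave on [0, pi], so up to pi/2 its graph lies above the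
  chord from the origin to (pi/2, 1).\<close>

lemma sin_ge_two_over_pi:
  assumes "0 \<le> x" "x \<le> pi / 2"
  shows "2 / pi * x \<le> sin x"
proof -
  have "concave_on {0..pi} sin"
    by (rule f''_le0_imp_concave[where f' = cos and f'' = "\<lambda>x. - sin x"])
      (auto intro!: derivative_eq_intros simp: sin_ge_zero)
  then have "(1 - 2 / pi * x) * sin 0 + 2 / pi * x * sin (pi / 2) \<le> sin ((1 - 2 / pi * x) *\<^sub>R 0 + (2 / pi * x) *\<^sub>R (pi / 2))"
    using assms pi_gt_zero
    by (intro concave_onD) (auto simp: field_simps)
  then show ?thesis by simp
qed

text \<open>After reduction modulo 1 to |y| <= 1/2, |e(y) - 1| = 2 |sin(pi y)|, and Jordan's
  inequality makes the sine linear. The bound controls the denominators of all geometric sums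
  below.\<close>

lemma norm_e_fun_minus_1_ge: "4 * dint x \<le> norm (e_fun x - 1)"
proof -
  define y where "y = x - of_int (round x)"
  have y: "dint x = \<bar>y\<bar>" "\<bar>y\<bar> \<le> 1 / 2" "e_fun x = e_fun y"
    using dint_le_half[of x] by (auto simp: dint_def y_def intro!: e_fun_cong_int)
  have "e_fun y - 1 = cis (pi * y) * (2 * \<i> * of_real (sin (pi * y)))"
  proof -
    have "e_fun y - 1 = cis (pi * y) * (cis (pi * y) - cis (- (pi * y)))"
      by (simp add: e_fun_eq_cis cis_mult algebra_simps)
    also have "cis (pi * y) - cis (- (pi * y)) = 2 * \<i> * of_real (sin (pi * y))"
      by (simp add: complex_eq_iff)
    finally show ?thesis .
  qed
  then have "norm (e_fun y - 1) = 2 * \<bar>sin (pi * y)\<bar>"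
    by (simp add: norm_mult)
  moreover have "\<bar>sin (pi * y)\<bar> = sin (pi * \<bar>y\<bar>)"
  proof -
    have "0 \<le> sin (pi * \<bar>y\<bar>)" using y by (intro sin_ge_zero) (auto simp: field_simps intro: order_trans)
    then show ?thesis by (cases "y \<ge> 0") auto
  qed
  moreover have "2 / pi * (pi * \<bar>y\<bar>) \<le> sin (pi * \<bar>y\<bar>)"
    using y by (intro sin_ge_two_over_pi) auto
  ultimately show ?thesis using y by simp
qed

section \<open>Geometric sums over progressions in a symmetric interval\<close>

definition prog :: "real \<Rightarrow> nat \<Rightarrow> int \<Rightarrow> int set" where
  "prog A m x0 = {x. \<bar>real_of_int x\<bar> \<le> A \<and> int m dvd x - x0}"

definition prog_lo :: "real \<Rightarrow> nat \<Rightarrow> int \<Rightarrow> int" where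
  "prog_lo A m x0 = \<lceil>(- A - of_int x0) / of_nat m\<rceil>"

text \<open>One past the last index: with half-open index ranges, differences telescope to the two
  boundary values.\<close>

definition prog_hi :: "real \<Rightarrow> nat \<Rightarrow> int \<Rightarrow> int" where
  "prog_hi A m x0 = \<lfloor>(A - of_int x0) / of_nat m\<rfloor> + 1"

lemma prog_lo_le_hi: "A \<ge> 0 \<Longrightarrow> m > 0 \<Longrightarrow> prog_lo A m x0 \<le> prog_hi A m x0"
proof -
  assume "A \<ge> 0" "m > 0"
  then have "(- A - of_int x0) / of_nat m \<le> (A - of_int x0) / real m"
    by (intro divide_right_mono) auto
  then show ?thesis unfolding prog_lo_def prog_hi_def by linarith
qed

lemma prog_eq_image:
  assumes "m > 0"
  shows "prog A m x0 = (\<lambda>k. x0 + int m * k) ` {prog_lo A m x0..<prog_hi A m x0}"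
proof (intro set_eqI iffI)
  fix x assume x: "x \<in> prog A m x0"
  then obtain k where k: "x = x0 + int m * k"
    by (auto simp: prog_def dvd_def algebra_simps)
  then have *: "\<bar>of_int x0 + real m * of_int k\<bar> \<le> A" using x by (auto simp: prog_def)
  have "(- A - of_int x0) / of_nat m \<le> of_int k" "of_int k \<le> (A - of_int x0) / of_nat m"
    using * assms by (auto simp: field_simps abs_le_iff)
  then have "prog_lo A m x0 \<le> k" "k < prog_hi A m x0"
    unfolding prog_lo_def prog_hi_def by linarith+
  then show "x \<in> (\<lambda>k. x0 + int m * k) ` {prog_lo A m x0..<prog_hi A m x0}"
    using k by auto
next
  fix x assume "x \<in> (\<lambda>k. x0 + int m * k) ` {prog_lo A m x0..<prog_hi A m x0}"
  then obtain k where k: "x = x0 + int m * k" "prog_lo A m x0 \<le> k" "k < prog_hi A m x0"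
    by (elim imageE) (use that in auto)
  then have "(- A - of_int x0) / of_nat m \<le> of_int k" "of_int k \<le> (A - of_int x0) / of_nat m"
    unfolding prog_lo_def prog_hi_def by linarith+
  then have "\<bar>of_int x0 + real m * of_int k\<bar> \<le> A"
    using assms by (auto simp: field_simps abs_le_iff)
  then show "x \<in> prog A m x0" using k by (auto simp: prog_def)
qed

lemma finite_prog [simp]: "m > 0 \<Longrightarrow> finite (prog A m x0)"
  by (simp add: prog_eq_image)

lemma sum_prog:
  assumes "m > 0"
  shows "sum f (prog A m x0) = (\<Sum>k\<in>{prog_lo A m x0..<prog_hi A m x0}. f (x0 + int m * k))"
  using assms by (simp add: prog_eq_image sum.reindex inj_on_def)

lemma card_prog_eq: "m > 0 \<Longrightarrow> card (prog A m x0) = nat (prog_hi A m x0 - prog_lo A m x0)"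
  by (simp add: prog_eq_image card_image inj_on_def)

text \<open>The first point beyond the progression overshoots A by at most one step. With the
  analogous bound at the lower end, boundary values can be moved to A and -A at bounded
  cost.\<close>

lemma prog_hi_bounds:
  assumes "m > 0"
  shows "of_int x0 + of_nat m * of_int (prog_hi A m x0) > A"
    "of_int x0 + of_nat m * of_int (prog_hi A m x0) \<le> A + m"
proof -
  have "(A - of_int x0) / of_nat m < of_int (prog_hi A m x0)"
       "of_int (prog_hi A m x0) \<le> (A - of_int x0) / of_nat m + 1"
    unfolding prog_hi_def by linarith+
  then show "of_int x0 + of_nat m * of_int (prog_hi A m x0) > A"
    "of_int x0 + of_nat m * of_int (prog_hi A m x0) \<le> A + m"
    using assms by (auto simp: field_simps)
qed

lemma prog_lo_bounds:
  assumes "m > 0"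
  shows "of_int x0 + of_nat m * of_int (prog_lo A m x0) \<ge> - A"
    "of_int x0 + of_nat m * of_int (prog_lo A m x0) < - A + m"
proof -
  have "(- A - of_int x0) / of_nat m \<le> of_int (prog_lo A m x0)"
       "of_int (prog_lo A m x0) < (- A - of_int x0) / of_nat m + 1"
    unfolding prog_lo_def by linarith+
  then show "of_int x0 + of_nat m * of_int (prog_lo A m x0) \<ge> - A"
    "of_int x0 + of_nat m * of_int (prog_lo A m x0) < - A + m"
    using assms by (auto simp: field_simps)
qed

lemma card_prog_le:
  assumes "m > 0" "A \<ge> 0"
  shows "real (card (prog A m x0)) \<le> 2 * A / m + 1"
proof -
  have "real m * (of_int (prog_hi A m x0) - of_int (prog_lo A m x0)) \<le> 2 * A + m"
    using prog_hi_bounds(2)[OF assms(1), of x0 A] prog_lo_bounds(1)[OF assms(1), of A x0]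
    by (simp add: algebra_simps)
  then show ?thesis
    using assms prog_lo_le_hi[of A m x0] by (simp add: card_prog_eq field_simps)
qed

lemma sum_int_telescope:
  fixes f :: "int \<Rightarrow> 'a::ab_group_add"
  assumes "a \<le> b"
  shows "(\<Sum>k\<in>{a..<b}. f (k + 1) - f k) = f b - f a"
  using assms
proof (induction b rule: int_ge_induct)
  case (step b)
  then have "{a..<b + 1} = insert b {a..<b}" by auto
  then show ?case using step by simp
qed simp

text \<open>Multiplying by the denominator instead of dividing keeps the identity valid when the
  ratio is 1. The bound that follows keeps the product form for the same reason.\<close>

lemma sum_e_fun_prog:
  assumes "m > 0" "A \<ge> 0"
  shows "(\<Sum>x\<in>prog A m x0. e_fun (\<phi> * of_int x)) * (e_fun (\<phi> * m) - 1)
     = e_fun (\<phi> * (of_int x0 + of_nat m * of_int (prog_hi A m x0)))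
     - e_fun (\<phi> * (of_int x0 + of_nat m * of_int (prog_lo A m x0)))"
proof -
  define f where "f = (\<lambda>k::int. e_fun (\<phi> * (of_int x0 + of_nat m * of_int k)))"
  have "(\<Sum>x\<in>prog A m x0. e_fun (\<phi> * of_int x)) * (e_fun (\<phi> * m) - 1)
     = (\<Sum>k\<in>{prog_lo A m x0..<prog_hi A m x0}. f (k + 1) - f k)"
    unfolding f_def sum_prog[OF assms(1)] sum_distrib_right
    by (rule sum.cong[OF refl], unfold right_diff_distrib mult_1_right e_fun_add[symmetric])
      (auto intro!: arg_cong2[of _ _ _ _ "(-)"] arg_cong[of _ _ e_fun] simp: algebra_simps)
  also have "\<dots> = f (prog_hi A m x0) - f (prog_lo A m x0)"
    by (rule sum_int_telescope[OF prog_lo_le_hi[OF assms(2,1)]])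
  finally show ?thesis by (simp add: f_def)
qed

lemma norm_sum_e_fun_prog_le:
  assumes "m > 0" "A \<ge> 0"
  shows "norm (\<Sum>x\<in>prog A m x0. e_fun (\<phi> * of_int x)) * (2 * dint (\<phi> * m)) \<le> 1"
proof -
  have "norm (\<Sum>x\<in>prog A m x0. e_fun (\<phi> * of_int x)) * (4 * dint (\<phi> * m))
    \<le> norm (\<Sum>x\<in>prog A m x0. e_fun (\<phi> * of_int x)) * norm (e_fun (\<phi> * m) - 1)"
    by (intro mult_left_mono norm_e_fun_minus_1_ge) auto
  also have "\<dots> \<le> 1 + 1"
    unfolding norm_mult[symmetric] sum_e_fun_prog[OF assms]
    by (rule order_trans[OF norm_triangle_ineq4]) simp
  finally show ?thesis by (simp add: mult_ac)
qed

section \<open>Linear phases compared with an integral\<close>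

text \<open>The Fourier transform of the indicator of [-A, A]: sin(2 pi A \<phi>)/(pi \<phi>), with
  value 2A at 0.\<close>

definition seg :: "real \<Rightarrow> real \<Rightarrow> complex" where
  "seg A \<phi> = (LINT t:{-A..A}|lborel. e_fun (\<phi> * t))"

lemma seg_eq:
  assumes "A \<ge> 0" "\<phi> \<noteq> 0"
  shows "seg A \<phi> = (e_fun (\<phi> * A) - e_fun (- \<phi> * A)) / (2 * of_real pi * \<i> * of_real \<phi>)"
proof -
  define F where "F = (\<lambda>t. e_fun (\<phi> * t) / (2 * of_real pi * \<i> * of_real \<phi>))"
  have "seg A \<phi> = F A - F (-A)"
    unfolding seg_def set_lebesgue_integral_def
  proof (rule integral_FTC_Icc)
    fix x
    have "((\<lambda>t. e_fun (\<phi> * t)) has_vector_derivative 2 * of_real pi * \<i> * of_real \<phi> * e_fun (\<phi> * x)) (at x within {-A..A})"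
      by (rule e_fun_has_vector_derivative) (auto intro!: derivative_eq_intros)
    from has_vector_derivative_divide[OF this, of "2 * of_real pi * \<i> * of_real \<phi>"]
    show "(F has_vector_derivative e_fun (\<phi> * x)) (at x within {-A..A})"
      using assms(2) by (simp add: F_def)
  qed (use assms in \<open>auto intro!: continuous_intros\<close>)
  then show ?thesis by (simp add: F_def diff_divide_distrib)
qed

lemma seg_0: "A \<ge> 0 \<Longrightarrow> seg A 0 = of_real (2 * A)"
  by (simp add: seg_def set_integral_complex_of_real[symmetric] set_lebesgue_integral_def scaleR_conv_of_real)

text \<open>For v >= 0 the derivative of the expression at t has norm |e^(it) - 1| <= t, which
  integrates to v^2/2; negative v follows by complex conjugation.\<close>

lemma norm_exp_i_minus_linear: "norm (exp (\<i> * of_real v) - 1 - \<i> * of_real v) \<le> v\<^sup>2 / 2"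
proof -
  have *: "norm (exp (\<i> * of_real v) - 1 - \<i> * of_real v) \<le> v\<^sup>2 / 2" if "v \<ge> 0" for v :: real
  proof -
    define G where "G = (\<lambda>t::real. exp (\<i> * of_real t) - 1 - \<i> * of_real t)"
    have "norm (G v - G 0) \<le> v\<^sup>2 / 2 - 0\<^sup>2 / 2"
    proof (cases "v = 0")
      case False
      show ?thesis
      proof (rule differentiable_bound_general[where f' = "\<lambda>t. \<i> * (exp (\<i> * of_real t) - 1)" and \<phi>' = "\<lambda>t. t"])
        show "0 < v" using that False by simp
        show "continuous_on {0..v} G" unfolding G_def by (intro continuous_intros)
        show "continuous_on {0..v} (\<lambda>t. t\<^sup>2 / 2)" by (intro continuous_intros) auto
        fix t assume t: "0 < t" "t < v"
        have "(G has_field_derivative (\<i> * (exp (\<i> * of_real t) - 1))) (at t)" if "G = (\<lambda>t. exp (\<i> * t) - 1 - \<i> * t)" for G :: "complex \<Rightarrow> complex" and t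
          unfolding that by (auto intro!: derivative_eq_intros simp: algebra_simps)
        from has_vector_derivative_real_field[OF this[OF refl], of t UNIV]
        show "(G has_vector_derivative \<i> * (exp (\<i> * complex_of_real t) - 1)) (at t)"
          by (simp add: G_def)
        show "((\<lambda>t. t\<^sup>2 / 2) has_vector_derivative t) (at t)"
          unfolding has_real_derivative_iff_has_vector_derivative[symmetric]
          by (auto intro!: derivative_eq_intros)
        have "norm (e_fun (t / (2 * pi)) - e_fun 0) \<le> 2 * pi * \<bar>t / (2 * pi) - 0\<bar>"
          by (rule norm_e_fun_diff_le)
        then show "norm (\<i> * (exp (\<i> * complex_of_real t) - 1)) \<le> t"
          unfolding norm_mult using t by (simp add: e_fun_def field_simps)
      qed
    qed simp
    then show ?thesis by (simp add: G_def)
  qed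
  show ?thesis
  proof (cases "v \<ge> 0")
    case False
    have "norm (exp (\<i> * of_real v) - 1 - \<i> * of_real v)
       = norm (cnj (exp (\<i> * of_real v) - 1 - \<i> * of_real v))"
      by (simp only: complex_mod_cnj)
    also have "cnj (exp (\<i> * of_real v) - 1 - \<i> * of_real v) = exp (\<i> * of_real (-v)) - 1 - \<i> * of_real (-v)"
      by (simp add: exp_cnj)
    also have "norm \<dots> \<le> v\<^sup>2 / 2" using *[of "-v"] False by simp
    finally show ?thesis .
  qed (use * in auto)
qed

text \<open>Both sides are evaluated explicitly; the denominators \<open>e(\<phi>s) - 1\<close> and \<open>2\<pi>i\<phi>s\<close> have
  reciprocals differing by a bounded amount as long as \<open>\<bar>\<phi>s\<bar> \<le> 1/2\<close>.\<close>

lemma sum_e_fun_prog_approx: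
  assumes s: "s > 0" and A: "A \<ge> 0" and \<phi>: "\<bar>\<phi> * s\<bar> \<le> 1 / 2"
  shows "norm ((\<Sum>x\<in>prog A s x0. e_fun (\<phi> * of_int x)) - seg A \<phi> / of_nat s) \<le> 4"
proof (cases "\<phi> = 0")
  case True
  have "card (prog A s x0) = (of_int (prog_hi A s x0) - of_int (prog_lo A s x0) :: real)"
    using s A prog_lo_le_hi[of A s x0] by (simp add: card_prog_eq)
  then have "real s * card (prog A s x0) = real s * of_int (prog_hi A s x0) - real s * of_int (prog_lo A s x0)"
    by (simp add: right_diff_distrib)
  then have "\<bar>real s * card (prog A s x0) - 2 * A\<bar> \<le> s * 1"
    using prog_hi_bounds[OF s, where A = A and ?x0.0 = x0] prog_lo_bounds[OF s, where A = A and ?x0.0 = x0] by linarith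
  moreover have "\<bar>real s * card (prog A s x0) - 2 * A\<bar> = s * \<bar>real (card (prog A s x0)) - 2 * A / s\<bar>"
    using s by (simp add: field_simps flip: abs_mult_pos')
  ultimately have "\<bar>real (card (prog A s x0)) - 2 * A / s\<bar> \<le> 1"
    using s by simp
  moreover have "(\<Sum>x\<in>prog A s x0. e_fun (\<phi> * of_int x)) - seg A \<phi> / of_nat s
      = of_real (real (card (prog A s x0)) - 2 * A / s)"
    using True A by (simp add: seg_0)
  ultimately show ?thesis by (metis norm_of_real order_trans real_norm_def one_le_numeral)
next
  case False
  define v where "v = 2 * pi * (\<phi> * s)"
  define q where "q = e_fun (\<phi> * s) - 1"
  define D where "D = \<i> * of_real v"
  define Sg where "Sg = (\<Sum>x\<in>prog A s x0. e_fun (\<phi> * of_int x))"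
  define a where "a = of_int x0 + real s * of_int (prog_lo A s x0)"
  define b where "b = of_int x0 + real s * of_int (prog_hi A s x0)"
  have v0: "v \<noteq> 0" using False s by (simp add: v_def)
  have av: "\<bar>v\<bar> = 2 * pi * \<bar>\<phi> * s\<bar>" by (simp add: v_def abs_mult)
  have q4: "norm q \<ge> 4 * \<bar>\<phi> * s\<bar>"
    using norm_e_fun_minus_1_ge[of "\<phi> * s"] dint_eq_abs[OF \<phi>] by (simp add: q_def)
  then have q0: "q \<noteq> 0" using False s by auto
  have qD: "norm (D - q) \<le> v\<^sup>2 / 2"
    using norm_exp_i_minus_linear[of v]
    by (simp add: q_def D_def v_def e_fun_def norm_minus_commute algebra_simps)
  \<comment> \<open>Both denominators vanish to first order in v and differ to second order. With
    |q| >= 4 |\<phi> s| and |v| = 2 pi |\<phi> s| the quotient is pi/4.\<close>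
  have "norm (1 / q - 1 / D) = norm (D - q) / (norm q * norm D)"
    using q0 v0 by (simp add: D_def field_simps flip: norm_mult norm_divide)
  also have "\<dots> \<le> (v\<^sup>2 / 2) / ((4 * \<bar>\<phi> * s\<bar>) * \<bar>v\<bar>)"
    using q4 qD False s v0 by (intro frac_le mult_mono) (auto simp: D_def norm_mult)
  also have "\<dots> = pi / 4"
    using v0 False s unfolding av power2_eq_square abs_mult_self_eq[of v, symmetric]
    by (simp add: field_simps)
  also have "\<dots> \<le> 1" using pi_less_4 by simp
  finally have inv: "norm (1 / q - 1 / D) \<le> 1" .
  have "Sg * q = e_fun (\<phi> * b) - e_fun (\<phi> * a)"
    unfolding Sg_def q_def a_def b_def by (rule sum_e_fun_prog[OF s A])
  then have Sg: "Sg = (e_fun (\<phi> * b) - e_fun (\<phi> * a)) * (1 / q)"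
    using q0 by (simp add: field_simps)
  have seg: "seg A \<phi> / of_nat s = (e_fun (\<phi> * A) - e_fun (\<phi> * (-A))) / D"
    using seg_eq[OF A False] s by (simp add: D_def v_def mult_ac)
  \<comment> \<open>The first product costs at most 2. Moving an endpoint by at most one step s
    changes its exponential divided by \<open>D\<close> by at most 1, and there are two
    endpoints.\<close>
  have "Sg - seg A \<phi> / of_nat s = (e_fun (\<phi> * b) - e_fun (\<phi> * a)) * (1 / q - 1 / D)
     + ((e_fun (\<phi> * b) - e_fun (\<phi> * A)) / D - (e_fun (\<phi> * a) - e_fun (\<phi> * (-A))) / D)"
    unfolding Sg seg by (simp add: algebra_simps diff_divide_distrib)
  also have "norm \<dots> \<le> 2 * 1 + (1 + 1)"
  proof (intro norm_triangle_mono order_trans[OF norm_triangle_ineq4] add_mono)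
    show "norm ((e_fun (\<phi> * b) - e_fun (\<phi> * a)) * (1 / q - 1 / D)) \<le> 2 * 1"
      unfolding norm_mult
      by (intro mult_mono inv order_trans[OF norm_triangle_ineq4]) auto
    have *: "norm ((e_fun (\<phi> * u) - e_fun (\<phi> * w)) / D) \<le> 1" if "\<bar>u - w\<bar> \<le> s" for u w :: real
    proof -
      have "norm (e_fun (\<phi> * u) - e_fun (\<phi> * w)) \<le> 2 * pi * \<bar>\<phi> * u - \<phi> * w\<bar>"
        by (rule norm_e_fun_diff_le)
      also have "\<bar>\<phi> * u - \<phi> * w\<bar> = \<bar>\<phi>\<bar> * \<bar>u - w\<bar>" by (simp add: abs_mult flip: right_diff_distrib)
      also have "2 * pi * \<dots> \<le> 2 * pi * (\<bar>\<phi>\<bar> * s)" using that by (intro mult_left_mono) auto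
      finally have "norm (e_fun (\<phi> * u) - e_fun (\<phi> * w)) \<le> \<bar>v\<bar>"
        using s by (simp add: av abs_mult)
      then show ?thesis using v0 by (simp add: norm_divide D_def norm_mult)
    qed
    show "norm ((e_fun (\<phi> * b) - e_fun (\<phi> * A)) / D) \<le> 1"
      using prog_hi_bounds[OF s, where A = A and ?x0.0 = x0] by (intro *) (simp add: b_def)
    show "norm ((e_fun (\<phi> * a) - e_fun (\<phi> * (-A))) / D) \<le> 1"
      using prog_lo_bounds[OF s, where A = A and ?x0.0 = x0] by (intro *) (simp add: a_def)
  qed
  finally show ?thesis by (simp add: Sg_def)
qed

lemma bij_betw_affine_mod:
  assumes "r > 0" "coprime u (int r)"
  shows "bij_betw (\<lambda>c. (u * c + v) mod int r) {0..<int r} {0..<int r}"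
proof -
  have inj: "inj_on (\<lambda>c. (u * c + v) mod int r) {0..<int r}"
  proof (rule inj_onI)
    fix c d assume cd: "c \<in> {0..<int r}" "d \<in> {0..<int r}" "(u * c + v) mod int r = (u * d + v) mod int r"
    then have "int r dvd u * (c - d)" by (simp add: mod_eq_dvd_iff algebra_simps)
    then have "int r dvd c - d" using assms(2) by (simp add: coprime_commute coprime_dvd_mult_right_iff)
    then have "c mod int r = d mod int r" by (simp add: mod_eq_dvd_iff)
    then show "c = d" using cd by simp
  qed
  then show ?thesis
    using assms(1) by (intro bij_betw_imageI endo_inj_surj) auto
qed

text \<open>One reindexing for several purposes: with u = 1 it is the shift behind the vanishing of
  sums over nontrivial roots of unity, with a unit u it permutes residue classes.\<close>

lemma sum_periodic_affine:
  fixes f :: "int \<Rightarrow> 'a::comm_monoid_add"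
  assumes "r > 0" "coprime u (int r)" and per: "\<And>x. f (x mod int r) = f x"
  shows "(\<Sum>c\<in>{0..<int r}. f (u * c + v)) = (\<Sum>c\<in>{0..<int r}. f c)"
proof -
  have "(\<Sum>c\<in>{0..<int r}. f (u * c + v)) = (\<Sum>c\<in>{0..<int r}. f ((u * c + v) mod int r))"
    by (simp add: per)
  also have "\<dots> = (\<Sum>c\<in>{0..<int r}. f c)"
    by (rule sum.reindex_bij_betw[OF bij_betw_affine_mod[OF assms(1,2)]])
  finally show ?thesis .
qed

lemma sum_prog_split:
  fixes f :: "int \<Rightarrow> 'a::comm_monoid_add"
  assumes "m > 0" "r > 0"
  shows "sum f (prog A m x0) = (\<Sum>c\<in>{0..<int r}. sum f (prog A (m * r) (x0 + int m * c)))"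
proof -
  have eq: "prog A m x0 = (\<Union>c\<in>{0..<int r}. prog A (m * r) (x0 + int m * c))"
  proof (intro set_eqI iffI)
    fix x assume x: "x \<in> prog A m x0"
    then obtain k where k: "x = x0 + int m * k" by (auto simp: prog_def dvd_def algebra_simps)
    have "int (m * r) dvd x - (x0 + int m * (k mod int r))"
      unfolding k by (simp add: right_diff_distrib[symmetric] minus_mod_eq_mult_div)
    then show "x \<in> (\<Union>c\<in>{0..<int r}. prog A (m * r) (x0 + int m * c))"
      using x assms by (auto simp: prog_def intro!: bexI[of _ "k mod int r"])
  next
    fix x assume "x \<in> (\<Union>c\<in>{0..<int r}. prog A (m * r) (x0 + int m * c))"
    then obtain c where c: "\<bar>real_of_int x\<bar> \<le> A" "int (m * r) dvd x - (x0 + int m * c)"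
      by (auto simp: prog_def)
    then have "int m dvd x - (x0 + int m * c)" by (metis dvd_mult_left of_nat_mult)
    then have "int m dvd x - (x0 + int m * c) + int m * c" by (rule dvd_add) simp
    then show "x \<in> prog A m x0" using c by (simp add: prog_def)
  qed
  show ?thesis unfolding eq
  proof (rule sum.UNION_disjoint)
    show "\<forall>i\<in>{0..<int r}. \<forall>j\<in>{0..<int r}. i \<noteq> j \<longrightarrow>
      prog A (m * r) (x0 + int m * i) \<inter> prog A (m * r) (x0 + int m * j) = {}"
    proof (intro ballI impI equals0I)
      fix i j x assume ij: "i \<in> {0..<int r}" "j \<in> {0..<int r}" "i \<noteq> j"
        and "x \<in> prog A (m * r) (x0 + int m * i) \<inter> prog A (m * r) (x0 + int m * j)"
      then have "int (m * r) dvd (x - (x0 + int m * j)) - (x - (x0 + int m * i))"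
        unfolding prog_def Int_iff mem_Collect_eq by (elim conjE) (rule dvd_diff)
      then have "int m * int r dvd int m * (i - j)" by (simp add: algebra_simps)
      then have "int r dvd i - j" using assms(1) by simp
      then have "i mod int r = j mod int r" by (simp add: mod_eq_dvd_iff)
      then show False using ij by simp
    qed
  qed (use assms in auto)
qed

lemma integrable_indicator_Icc:
  fixes f :: "real \<Rightarrow> 'a::{banach, second_countable_topology}"
  assumes "continuous_on {a..b} f"
  shows "integrable lborel (\<lambda>t. indicator {a..b} t *\<^sub>R f t)"
  using borel_integrable_atLeastAtMost'[OF assms] by (simp add: set_integrable_def)

text \<open>The mean value bound for the integrand, with |t| <= A. It serves to make
  \<open>seg A\<close> continuous, hence integrable over intervals.\<close>

lemma seg_lipschitz:
  assumes "A \<ge> 0" shows "norm (seg A \<phi> - seg A \<psi>) \<le> 4 * pi * A\<^sup>2 * \<bar>\<phi> - \<psi>\<bar>"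
proof -
  have "seg A \<phi> - seg A \<psi> = (LINT t:{-A..A}|lborel. e_fun (\<phi> * t) - e_fun (\<psi> * t))"
    unfolding seg_def
    by (intro set_integral_diff(2)[symmetric] borel_integrable_atLeastAtMost') (intro continuous_intros)+
  also have "norm \<dots> \<le> (LINT t:{-A..A}|lborel. 2 * pi * A * \<bar>\<phi> - \<psi>\<bar>)"
    unfolding set_lebesgue_integral_def
  proof (rule Bochner_Integration.integral_norm_bound_integral)
    fix t
    show "norm (indicator {- A..A} t *\<^sub>R (e_fun (\<phi> * t) - e_fun (\<psi> * t)))
       \<le> indicator {- A..A} t *\<^sub>R (2 * pi * A * \<bar>\<phi> - \<psi>\<bar>)"
    proof (cases "t \<in> {-A..A}")
      case True
      have "norm (e_fun (\<phi> * t) - e_fun (\<psi> * t)) \<le> 2 * pi * \<bar>\<phi> * t - \<psi> * t\<bar>"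
        by (rule norm_e_fun_diff_le)
      also have "\<bar>\<phi> * t - \<psi> * t\<bar> = \<bar>t\<bar> * \<bar>\<phi> - \<psi>\<bar>"
        by (simp add: abs_mult mult.commute flip: left_diff_distrib)
      also have "2 * pi * (\<bar>t\<bar> * \<bar>\<phi> - \<psi>\<bar>) \<le> 2 * pi * (A * \<bar>\<phi> - \<psi>\<bar>)"
        using True by (intro mult_left_mono mult_right_mono) auto
      finally show ?thesis using True by (simp add: mult_ac)
    qed simp
  next
    show "integrable lborel (\<lambda>t. indicator {- A..A} t *\<^sub>R (2 * pi * A * \<bar>\<phi> - \<psi>\<bar>))"
      by (intro integrable_indicator_Icc continuous_intros)
    show "integrable lborel (\<lambda>t. indicator {- A..A} t *\<^sub>R (e_fun (\<phi> * t) - e_fun (\<psi> * t)))"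
      by (intro integrable_indicator_Icc continuous_intros)
  qed
  also have "\<dots> = 4 * pi * A\<^sup>2 * \<bar>\<phi> - \<psi>\<bar>"
    using assms by (simp add: set_lebesgue_integral_def power2_eq_square)
  finally show ?thesis .
qed

lemma continuous_on_seg [continuous_intros]:
  assumes "A \<ge> 0" "continuous_on S f"
  shows "continuous_on S (\<lambda>x. seg A (f x))"
proof (rule continuous_on_compose2[OF _ assms(2) subset_UNIV])
  show "continuous_on UNIV (seg A)"
    by (rule lipschitz_on_continuous_on[of "4 * pi * A\<^sup>2"], rule lipschitz_onI)
      (use seg_lipschitz[OF assms(1)] in \<open>auto simp: dist_norm\<close>)
qed

lemma norm_seg_le: "A \<ge> 0 \<Longrightarrow> norm (seg A \<phi>) \<le> 2 * A"
proof -
  assume A: "A \<ge> 0"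
  have "norm (seg A \<phi>) \<le> (LINT t:{-A..A}|lborel. 1)"
    unfolding seg_def set_lebesgue_integral_def
  proof (rule Bochner_Integration.integral_norm_bound_integral)
    show "integrable lborel (\<lambda>t. indicator {- A..A} t *\<^sub>R (1::real))"
      by (intro integrable_indicator_Icc continuous_intros)
    show "integrable lborel (\<lambda>t. indicator {- A..A} t *\<^sub>R e_fun (\<phi> * t))"
      by (intro integrable_indicator_Icc continuous_intros)
  qed (auto simp: indicator_def)
  then show ?thesis using A by (simp add: set_lebesgue_integral_def)
qed

lemma norm_seg_mult_le: "A \<ge> 0 \<Longrightarrow> norm (seg A \<phi>) * (pi * \<bar>\<phi>\<bar>) \<le> 1"
proof (cases "\<phi> = 0")
  case False
  assume A: "A \<ge> 0"
  have "norm (e_fun (\<phi> * A) - e_fun (- \<phi> * A)) \<le> 2"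
    by (rule order_trans[OF norm_triangle_ineq4]) simp
  then show ?thesis unfolding seg_eq[OF A False] using False by (simp add: norm_divide norm_mult)
qed simp

section \<open>Lipschitz functions, quadratic phases and Gauss sums\<close>

text \<open>For an antiderivative g of f, g(x + s) - g(x) differs from s f(x) by at most D s^2, and
  the differences telescope along the progression. At most 2A/s + 1 <= 3A/s terms give 3AD after
  division by s; since |f| <= 1, moving the two ends to A and -A costs at most 1 each. The range up
  to 3A leaves room for the last step, which ends at most at A + s <= 2A.\<close>

lemma sum_prog_integral_approx:
  fixes f :: "real \<Rightarrow> complex"
  assumes s: "s > 0" "real s \<le> A" and D: "D \<ge> 0"
    and lip: "\<And>x y. \<bar>x\<bar> \<le> 3 * A \<Longrightarrow> \<bar>y\<bar> \<le> 3 * A \<Longrightarrow> norm (f x - f y) \<le> D * \<bar>x - y\<bar>"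
    and cont: "continuous_on UNIV f" and f1: "\<And>x. norm (f x) \<le> 1"
  shows "norm ((\<Sum>x\<in>prog A s x0. f (of_int x)) - (LINT t:{-A..A}|lborel. f t) / of_nat s) \<le> 3 * A * D + 2"
proof -
  have A: "A > 0" using s by linarith
  obtain g where g: "\<And>x. x \<in> {-3*A..3*A} \<Longrightarrow> (g has_vector_derivative f x) (at x within {-3*A..3*A})"
    using antiderivative_continuous[OF continuous_on_subset[OF cont subset_UNIV]] by blast
  have gd: "(g has_derivative (\<lambda>h. h *\<^sub>R f x)) (at x within T)" if "x \<in> T" "T \<subseteq> {-3*A..3*A}" for x T
    using g[of x] that unfolding has_vector_derivative_def by (meson has_derivative_subset subsetD)
  have on: "onorm (\<lambda>h::real. h *\<^sub>R (z::complex)) = norm z" for z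
    using onorm_scaleR_left[OF bounded_linear_ident, of z] by (simp add: onorm_id)
  have g1: "norm (g v - g u) \<le> 1 * norm (v - u)" if "u \<in> {-3*A..3*A}" "v \<in> {-3*A..3*A}" for u v
    by (rule differentiable_bound[where f' = "\<lambda>x h. h *\<^sub>R f x" and S = "{-3*A..3*A}"])
      (use that gd f1 on in auto)
  have g2: "norm (g (u + s) - g u - real s *\<^sub>R f u) \<le> D * s * s"
    if u: "u \<in> {-A..A}" for u
  proof -
    have "norm ((\<lambda>t. g t - t *\<^sub>R f u) (u + s) - (\<lambda>t. g t - t *\<^sub>R f u) u) \<le> (D * s) * norm (u + s - u)"
    proof (rule differentiable_bound[where f' = "\<lambda>x h. h *\<^sub>R f x - h *\<^sub>R f u" and S = "{u..u+s}"])
      fix x assume x: "x \<in> {u..u+s}"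
      show "((\<lambda>t. g t - t *\<^sub>R f u) has_derivative (\<lambda>h. h *\<^sub>R f x - h *\<^sub>R f u)) (at x within {u..u+s})"
        using x u s by (intro derivative_intros gd) auto
      have "norm (f x - f u) \<le> D * \<bar>x - u\<bar>" using x u s by (intro lip) auto
      also have "\<dots> \<le> D * s" using x D by (intro mult_left_mono) auto
      finally show "onorm (\<lambda>h. h *\<^sub>R f x - h *\<^sub>R f u) \<le> D * real s"
        by (simp add: on flip: scaleR_diff_right)
    qed (use s in auto)
    then show ?thesis using s by (simp add: algebra_simps)
  qed
  define a where "a = of_int x0 + real s * of_int (prog_lo A s x0)"
  define b where "b = of_int x0 + real s * of_int (prog_hi A s x0)"
  have a: "-A \<le> a" "a \<le> -A + s" using prog_lo_bounds[OF s(1), where A = A and ?x0.0 = x0] by (auto simp: a_def)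
  have b: "A \<le> b" "b \<le> A + s" using prog_hi_bounds[OF s(1), where A = A and ?x0.0 = x0] by (auto simp: b_def)
  have tel: "(\<Sum>x\<in>prog A s x0. g (real_of_int x + real s) - g (of_int x)) = g b - g a"
  proof -
    define h where "h = (\<lambda>k::int. g (of_int x0 + real s * of_int k))"
    have "(\<Sum>x\<in>prog A s x0. g (real_of_int x + real s) - g (of_int x))
      = (\<Sum>k\<in>{prog_lo A s x0..<prog_hi A s x0}. h (k + 1) - h k)"
      unfolding sum_prog[OF s(1)] h_def by (intro sum.cong refl) (simp add: algebra_simps)
    also have "\<dots> = h (prog_hi A s x0) - h (prog_lo A s x0)"
      using A by (intro sum_int_telescope prog_lo_le_hi s) auto
    finally show ?thesis by (simp add: h_def a_def b_def)
  qed
  have int: "(LINT t:{-A..A}|lborel. f t) = g A - g (-A)"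
    unfolding set_lebesgue_integral_def
  proof (rule integral_FTC_Icc)
    fix x assume "-A \<le> x" "x \<le> A"
    then show "(g has_vector_derivative f x) (at x within {-A..A})"
      using gd[of x "{-A..A}"] A by (auto simp: has_vector_derivative_def)
  qed (use A cont in \<open>auto intro: continuous_on_subset\<close>)
  define Sf where "Sf = (\<Sum>x\<in>prog A s x0. f (of_int x))"
  have "norm (g b - g a - real s *\<^sub>R Sf) = norm (\<Sum>x\<in>prog A s x0. g (real_of_int x + real s) - g (of_int x) - real s *\<^sub>R f (of_int x))"
    by (simp add: Sf_def sum_subtractf scaleR_sum_right flip: tel)
  also have "\<dots> \<le> (\<Sum>x\<in>prog A s x0. D * s * s)"
  proof (rule sum_norm_le)
    fix x assume "x \<in> prog A s x0"
    then have "real_of_int x \<in> {-A..A}" by (auto simp: prog_def)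
    from g2[OF this]
    show "norm (g (real_of_int x + real s) - g (real_of_int x) - real s *\<^sub>R f (real_of_int x)) \<le> D * s * s" .
  qed
  also have "\<dots> = real (card (prog A s x0)) * (D * s * s)" by simp
  also have "\<dots> \<le> (2 * A / s + 1) * (D * s * s)"
    using D A s by (intro mult_right_mono card_prog_le) auto
  also have "\<dots> = (2 * A + s) * D * s" using s by (simp add: field_simps)
  also have "\<dots> \<le> 3 * A * D * s" using D s by (intro mult_right_mono) auto
  finally have 1: "norm (g b - g a - real s *\<^sub>R Sf) \<le> 3 * A * D * s" .
  have 2: "norm (g b - g A) \<le> s" "norm (g a - g (-A)) \<le> s"
    using g1[of A b] g1[of "-A" a] a b s A by auto
  have "real s *\<^sub>R Sf - (g A - g (-A)) = (g b - g A) - (g a - g (-A)) - (g b - g a - real s *\<^sub>R Sf)"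
    by (simp add: algebra_simps)
  also have "norm \<dots> \<le> (real s + real s) + 3 * A * D * s"
    using norm_triangle_ineq4[of "(g b - g A) - (g a - g (-A))" "g b - g a - real s *\<^sub>R Sf"]
      norm_triangle_ineq4[of "g b - g A" "g a - g (-A)"] 1 2 by linarith
  finally have 3: "norm (real s *\<^sub>R Sf - (g A - g (-A))) \<le> (3 * A * D + 2) * s"
    by (simp add: algebra_simps)
  have "Sf - (g A - g (-A)) / of_nat s = (real s *\<^sub>R Sf - (g A - g (-A))) / of_nat s"
    using s by (simp add: field_simps scaleR_conv_of_real)
  then have "norm (Sf - (g A - g (-A)) / of_nat s) = norm (real s *\<^sub>R Sf - (g A - g (-A))) / s"
    by (simp add: norm_divide)
  also have "\<dots> \<le> 3 * A * D + 2" using 3 s by (simp add: field_simps)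
  finally show ?thesis by (simp add: Sf_def int)
qed

definition gauss_sum :: "int \<Rightarrow> int \<Rightarrow> nat \<Rightarrow> complex" where
  "gauss_sum l a r = (\<Sum>c\<in>{0..<int r}. e_fun (of_int (l * a * c\<^sup>2) / r))"

definition qseg :: "real \<Rightarrow> real \<Rightarrow> complex" where
  "qseg A \<phi> = (LINT t:{-A..A}|lborel. e_fun (\<phi> * t\<^sup>2))"

text \<open>On [-3A, 3A] the phase has Lipschitz constant 6 |\<phi>| A. No oscillation of the square
  is exploited; this is the source of the factor 1 + W|\<beta>| in \<open>zerr\<close>.\<close>

lemma sum_e_fun_square_prog_approx:
  assumes "s > 0" "real s \<le> A"
  shows "norm ((\<Sum>x\<in>prog A s x0. e_fun (\<phi> * (of_int x)\<^sup>2)) - qseg A \<phi> / of_nat s) \<le> 36 * pi * \<bar>\<phi>\<bar> * A\<^sup>2 + 2"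
proof -
  have "norm (e_fun (\<phi> * x\<^sup>2) - e_fun (\<phi> * y\<^sup>2)) \<le> 12 * pi * \<bar>\<phi>\<bar> * A * \<bar>x - y\<bar>"
    if "\<bar>x\<bar> \<le> 3 * A" "\<bar>y\<bar> \<le> 3 * A" for x y
  proof -
    have "\<bar>\<phi> * x\<^sup>2 - \<phi> * y\<^sup>2\<bar> = \<bar>\<phi>\<bar> * \<bar>x - y\<bar> * \<bar>x + y\<bar>"
      by (simp add: power2_eq_square algebra_simps flip: abs_mult)
    also have "\<dots> \<le> \<bar>\<phi>\<bar> * \<bar>x - y\<bar> * (6 * A)"
      using that by (intro mult_left_mono) auto
    finally have "2 * pi * \<bar>\<phi> * x\<^sup>2 - \<phi> * y\<^sup>2\<bar> \<le> 2 * pi * (\<bar>\<phi>\<bar> * \<bar>x - y\<bar> * (6 * A))"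
      by (intro mult_left_mono) auto
    then show ?thesis using norm_e_fun_diff_le[of "\<phi> * x\<^sup>2" "\<phi> * y\<^sup>2"] by (simp only: mult_ac)
  qed
  then have "norm ((\<Sum>x\<in>prog A s x0. e_fun (\<phi> * (of_int x)\<^sup>2)) - (LINT t:{-A..A}|lborel. e_fun (\<phi> * t\<^sup>2)) / of_nat s)
     \<le> 3 * A * (12 * pi * \<bar>\<phi>\<bar> * A) + 2"
    using assms by (intro sum_prog_integral_approx) (auto intro!: continuous_intros)
  then show ?thesis by (simp add: qseg_def power2_eq_square mult_ac)
qed

text \<open>On a residue class modulo mr the rational part of the phase is constant, because adding
  mrk to z changes l a z^2/(rm) by an integer. Each of the r classes is then a progression with step
  mr <= Z and a slowly varying phase.\<close>

lemma square_sum_approx: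
  fixes l a z0 :: int
  assumes "m > 0" "r > 0" "real (m * r) \<le> Z"
  shows "norm ((\<Sum>z\<in>prog Z m z0. e_fun (of_int l * (of_int a / real (r * m) + \<beta>) * (of_int z)\<^sup>2))
      - (\<Sum>c\<in>{0..<int r}. e_fun (of_int (l * a * (z0 + int m * c)\<^sup>2) / real (r * m)))
        * (qseg Z (of_int l * \<beta>) / of_nat (m * r)))
    \<le> r * (36 * pi * \<bar>of_int l * \<beta>\<bar> * Z\<^sup>2 + 2)"
proof -
  define E where "E = (\<lambda>c. e_fun (of_int (l * a * (z0 + int m * c)\<^sup>2) / real (r * m)))"
  have *: "e_fun (of_int l * (of_int a / real (r * m) + \<beta>) * (of_int z)\<^sup>2) =
     E c * e_fun (of_int l * \<beta> * (of_int z)\<^sup>2)" if "z \<in> prog Z (m * r) (z0 + int m * c)" for c z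
  proof -
    define d where "d = z0 + int m * c"
    from that obtain k where k: "z = d + int (m * r) * k" by (auto simp: prog_def d_def dvd_def algebra_simps)
    have "of_int (l * a * z\<^sup>2) / real (r * m) = of_int (l * a * d\<^sup>2) / real (r * m) + of_int (l * a * (2 * d * k + int (m * r) * k\<^sup>2))"
      using assms(1,2) unfolding k by (simp add: field_simps power2_eq_square)
    then have "E c = e_fun (of_int (l * a * z\<^sup>2) / real (r * m))"
      by (simp only: e_fun_add_of_int E_def d_def)
    then show ?thesis by (simp add: algebra_simps flip: e_fun_add)
  qed
  have "(\<Sum>z\<in>prog Z m z0. e_fun (of_int l * (of_int a / real (r * m) + \<beta>) * (of_int z)\<^sup>2))
     - (\<Sum>c\<in>{0..<int r}. E c) * (qseg Z (of_int l * \<beta>) / of_nat (m * r))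
    = (\<Sum>c\<in>{0..<int r}. E c * ((\<Sum>z\<in>prog Z (m * r) (z0 + int m * c). e_fun (of_int l * \<beta> * (of_int z)\<^sup>2))
       - qseg Z (of_int l * \<beta>) / of_nat (m * r)))"
    by (simp only: sum_prog_split[OF assms(1,2)] right_diff_distrib sum_subtractf sum_distrib_left sum_distrib_right * cong: sum.cong)
  also have "norm \<dots> \<le> (\<Sum>c\<in>{0..<int r}. 36 * pi * \<bar>of_int l * \<beta>\<bar> * Z\<^sup>2 + 2)"
    using assms by (intro sum_norm_le, unfold norm_mult E_def norm_e_fun mult_1_left)
      (intro sum_e_fun_square_prog_approx; simp)
  finally show ?thesis by (simp add: E_def)
qed

lemma norm_square_sum_le:
  assumes "m > 0" "real m \<le> Z"
  shows "norm (\<Sum>z\<in>prog Z m z0. e_fun (\<phi> z)) \<le> 3 * Z / m"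
proof -
  have "norm (\<Sum>z\<in>prog Z m z0. e_fun (\<phi> z)) \<le> (\<Sum>z\<in>prog Z m z0. 1)"
    by (intro sum_norm_le) auto
  also have "\<dots> \<le> 2 * Z / m + 1" using assms card_prog_le[of m Z z0] by simp
  also have "\<dots> \<le> 3 * Z / m" using assms by (simp add: field_simps)
  finally show ?thesis .
qed

text \<open>A numerator divisible by m cancels the m in the denominator, and c -> z0 + mc permutes
  the residues modulo r; no trace of z0 remains.\<close>

lemma gauss_sum_shift:
  assumes "m > 0" "r > 0" "coprime (int m) (int r)"
  shows "(\<Sum>c\<in>{0..<int r}. e_fun (of_int (l * (b * int m) * (z0 + int m * c)\<^sup>2) / real (r * m))) = gauss_sum l b r"
proof -
  define f where "f = (\<lambda>c. e_fun (of_int (l * b * c\<^sup>2) / r))"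
  have per: "f (x mod int r) = f x" for x
  proof -
    have "int r dvd l * b * (x mod int r)\<^sup>2 - l * b * x\<^sup>2"
      by (metis mod_eq_dvd_iff mod_mult_right_eq power_mod)
    then obtain k where "l * b * (x mod int r)\<^sup>2 = l * b * x\<^sup>2 + int r * k"
      by (metis dvd_def add.commute diff_add_cancel)
    then have "of_int (l * b * (x mod int r)\<^sup>2) / real r = of_int (l * b * x\<^sup>2) / real r + of_int k"
      using assms by (simp add: field_simps)
    then show ?thesis unfolding f_def by simp
  qed
  have "(\<Sum>c\<in>{0..<int r}. e_fun (of_int (l * (b * int m) * (z0 + int m * c)\<^sup>2) / real (r * m)))
    = (\<Sum>c\<in>{0..<int r}. f (int m * c + z0))"
    using assms unfolding f_def by (intro sum.cong refl arg_cong[of _ _ e_fun]) (simp add: field_simps)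
  also have "\<dots> = (\<Sum>c\<in>{0..<int r}. f c)"
    by (rule sum_periodic_affine[where f = f, OF assms(2,3) per])
  finally show ?thesis by (simp add: f_def gauss_sum_def)
qed

text \<open>Shifting \<open>c\<close> by \<open>r/p\<close> multiplies every term by the nontrivial \<open>p\<close>-th root of unity
  \<open>e(2laz\<^sub>0/p)\<close>.\<close>

lemma gauss_sum_noncoprime:
  assumes "m > 0" "r > 0" "prime p" "p dvd r" "p dvd m" "\<not> int p dvd 2 * l * a * z0"
  shows "(\<Sum>c\<in>{0..<int r}. e_fun (of_int (l * a * (z0 + int m * c)\<^sup>2) / real (r * m))) = 0"
proof -
  have p: "p > 0" using assms(3) prime_gt_0_nat by blast
  obtain r' where r': "r = p * r'" using assms(4) by auto
  obtain m' where m': "m = p * m'" using assms(5) by auto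
  have pos: "r' > 0" "m' > 0" using assms r' m' by (auto intro!: Nat.gr0I)
  define f where "f = (\<lambda>c. e_fun (of_int (l * a * (z0 + int m * c)\<^sup>2) / real (r * m)))"
  have per': "f (x + int r * k) = f x" for x k
  proof -
    have "of_int (l * a * (z0 + int m * (x + int r * k))\<^sup>2) / real (r * m)
       = of_int (l * a * (z0 + int m * x)\<^sup>2) / real (r * m) + of_int (l * a * (2 * (z0 + int m * x) * k + int m * int r * k\<^sup>2))"
      using assms by (simp add: field_simps power2_eq_square)
    then show ?thesis unfolding f_def by (simp only: e_fun_add_of_int)
  qed
  have per: "f (x mod int r) = f x" for x
    using per'[of "x mod int r" "x div int r"] by simp
  define w where "w = e_fun (of_int (2 * l * a * z0) / p)"
  have sh: "f (1 * x + int r') = w * f x" for x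
  proof -
    have "of_int (l * a * (z0 + int m * (1 * x + int r'))\<^sup>2) / real (r * m)
       = of_int (2 * l * a * z0) / p + of_int (l * a * (z0 + int m * x)\<^sup>2) / real (r * m) + of_int (l * a * (2 * int m' * x + int r' * int m'))"
      using p pos unfolding r' m' by (simp add: field_simps power2_eq_square)
    then show ?thesis unfolding f_def w_def by (simp only: e_fun_add e_fun_of_int mult_1_right)
  qed
  have "w * (\<Sum>c\<in>{0..<int r}. f c) = (\<Sum>c\<in>{0..<int r}. f (1 * c + int r'))"
    by (simp only: sh sum_distrib_left)
  also have "\<dots> = (\<Sum>c\<in>{0..<int r}. f c)"
    by (rule sum_periodic_affine[where f = f, OF assms(2) _ per]) simp
  finally have "(w - 1) * (\<Sum>c\<in>{0..<int r}. f c) = 0" by (simp add: algebra_simps)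
  moreover have "norm (w - 1) > 0"
  proof -
    have "0 < 4 * (1 / real p)" using p by simp
    also have "\<dots> \<le> 4 * dint (of_int (2 * l * a * z0) / p)"
      using assms(6) p by (intro mult_left_mono dint_fraction_ge) auto
    also have "\<dots> \<le> norm (w - 1)" unfolding w_def by (rule norm_e_fun_minus_1_ge)
    finally show ?thesis .
  qed
  ultimately show ?thesis by (auto simp: f_def)
qed

section \<open>Bilinear sums near a rational point\<close>

lemma harm_le_one_plus_ln: "n > 0 \<Longrightarrow> harm n \<le> 1 + ln (real n)"
proof -
  assume n: "n > 0"
  have "harm (Suc (n - 1)) - ln (real (Suc (n - 1))) \<le> harm (Suc 0) - ln (real (Suc 0))"
    using decseq_harm_diff_ln by (rule decseqD) simp
  then show ?thesis using n by (simp add: harm_def)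
qed

text \<open>The integer nearest to c/r is at most 0 or at least 1, so the distance is at least c/r
  or at least (r - c)/r. Adding both reciprocals removes the case distinction from the sum over
  c.\<close>

lemma inverse_dint_le:
  assumes "0 < c" "c < r"
  shows "1 / dint (real c / real r) \<le> real r / real c + real r / real (r - c)"
proof -
  define n where "n = round (real c / real r)"
  define d where "d = dint (real c / real r)"
  have d: "d = \<bar>real c / real r - of_int n\<bar>" by (simp add: d_def dint_def n_def)
  have frac: "0 < real c / r" "real c / r < 1" using assms by auto
  have diff: "real (r - c) / r = 1 - real c / r" using assms by (simp add: of_nat_diff field_simps)
  show ?thesis
  proof (cases "n \<le> 0")
    case True
    then have "of_int n \<le> (0::real)" by simp
    then have "real c / r \<le> d" unfolding d using frac by linarith
    then have "1 / d \<le> 1 / (real c / r)" using frac by (intro divide_left_mono mult_pos_pos) auto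
    then show ?thesis unfolding d_def by simp (meson divide_nonneg_nonneg le_add_same_cancel1 of_nat_0_le_iff order_trans)
  next
    case False
    then have "1 \<le> real_of_int n" by linarith
    then have *: "real (r - c) / r \<le> d" unfolding d diff using frac by linarith
    have e: "0 < real (r - c) / real r" using assms by simp
    then have "d > 0" using * by linarith
    then have "1 / d \<le> 1 / (real (r - c) / r)" using * e by (metis frac_le less_le zero_le_one order_refl)
    then show ?thesis unfolding d_def by simp (meson divide_nonneg_nonneg le_add_same_cancel2 of_nat_0_le_iff order_trans)
  qed
qed

lemma sum_inverse_dint_le:
  assumes "r > 0"
  shows "(\<Sum>c\<in>{0..<int r}. 1 / dint (of_int c / real r)) \<le> 2 * real r * (1 + ln (real r))"
proof -
  have "(\<Sum>c\<in>{0..<int r}. 1 / dint (of_int c / real r)) = (\<Sum>c\<in>{0..<r}. 1 / dint (real c / real r))"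
    by (simp add: image_int_atLeastLessThan[of 0 r, simplified, symmetric] sum.reindex)
  \<comment> \<open>The term for c = 0 is 1/0, which is 0.\<close>
  also have "\<dots> = (\<Sum>c\<in>{1..<r}. 1 / dint (real c / real r))"
    by (intro sum.mono_neutral_right) (auto simp: dint_eq_abs not_less_eq_eq Suc_le_eq)
  also have "\<dots> \<le> (\<Sum>c\<in>{1..<r}. real r / real c + real r / real (r - c))"
    by (intro sum_mono inverse_dint_le) auto
  also have "\<dots> = (\<Sum>c\<in>{1..<r}. real r / real c) + (\<Sum>c\<in>{1..<r}. real r / real (r - c))"
    by (rule sum.distrib)
  also have "(\<Sum>c\<in>{1..<r}. real r / real (r - c)) = (\<Sum>c\<in>{1..<r}. real r / real c)"
    by (rule sum.reindex_bij_witness[of _ "\<lambda>c. r - c" "\<lambda>c. r - c"]) auto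
  also have "(\<Sum>c\<in>{1..<r}. real r / real c) = real r * (\<Sum>c\<in>{1..<r}. inverse (real c))"
    by (simp add: sum_distrib_left field_simps)
  also have "(\<Sum>c\<in>{1..<r}. inverse (real c)) \<le> harm r"
    unfolding harm_def by (intro sum_mono2) auto
  also have "harm r \<le> 1 + ln (real r)" by (rule harm_le_one_plus_ln[OF assms])
  finally show ?thesis using assms by (simp add: mult_left_mono)
qed

text \<open>The summand depends only on w modulo r, each class meets the interval at most 2T/r + 1
  times, and multiplication by a permutes the classes. Multiples of r contribute 1/0 = 0.\<close>

lemma sum_inverse_dint_prog_le:
  assumes "r > 0" "coprime a (int r)" "T \<ge> 0"
  shows "(\<Sum>w\<in>prog T 1 0. 1 / dint (of_int (a * w) / real r)) \<le> (2 * T / r + 1) * (2 * real r * (1 + ln (real r)))"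
proof -
  define f where "f = (\<lambda>c::int. 1 / dint (of_int c / real r))"
  have per': "f (x + int r * k) = f x" for x k
  proof -
    have "of_int (x + int r * k) / real r = of_int x / real r + of_int k"
      using assms by (simp add: field_simps)
    then show ?thesis unfolding f_def by (simp only: dint_add_of_int)
  qed
  have per: "f (x mod int r) = f x" for x
    using per'[of "x mod int r" "x div int r"] by simp
  have fn: "f x \<ge> 0" for x by (simp add: f_def)
  have "(\<Sum>w\<in>prog T 1 0. f (a * w)) = (\<Sum>c\<in>{0..<int r}. \<Sum>w\<in>prog T (1 * r) (0 + int 1 * c). f (a * w))"
    by (rule sum_prog_split) (use assms in auto)
  also have "\<dots> = (\<Sum>c\<in>{0..<int r}. \<Sum>w\<in>prog T (1 * r) (0 + int 1 * c). f (a * c))"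
  proof (intro sum.cong refl)
    fix c w assume "w \<in> prog T (1 * r) (0 + int 1 * c)"
    then obtain k where "w = c + int r * k" by (auto simp: prog_def dvd_def algebra_simps)
    then have "a * w = a * c + int r * (a * k)" by (simp add: algebra_simps)
    then show "f (a * w) = f (a * c)" by (simp only: per')
  qed
  also have "\<dots> = (\<Sum>c\<in>{0..<int r}. real (card (prog T r c)) * f (a * c))" by simp
  also have "\<dots> \<le> (\<Sum>c\<in>{0..<int r}. (2 * T / r + 1) * f (a * c))"
    using assms fn by (intro sum_mono mult_right_mono card_prog_le) auto
  also have "\<dots> = (2 * T / r + 1) * (\<Sum>c\<in>{0..<int r}. f (a * c + 0))" by (simp add: sum_distrib_left)
  also have "(\<Sum>c\<in>{0..<int r}. f (a * c + 0)) = (\<Sum>c\<in>{0..<int r}. f c)"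
    by (rule sum_periodic_affine[where f = f, OF assms(1,2) per])
  also have "\<dots> \<le> 2 * real r * (1 + ln (real r))"
    unfolding f_def by (rule sum_inverse_dint_le[OF assms(1)])
  finally show ?thesis using assms by (simp add: f_def mult_left_mono)
qed

text \<open>With the exponents 1/4 and 3/4 each bilinear sum decays like \<open>u\<^sup>-\<^sup>3\<^sup>/\<^sup>4\<close> in \<open>u = AB\<bar>\<beta>\<bar>\<close>, so
  that both three factors and four factors times \<open>1 + u\<close> remain integrable, without logarithms.\<close>

lemma le_powr_interpolate:
  fixes n N t :: real
  assumes "0 \<le> n" "n \<le> N" "n * t \<le> 1" "t > 0"
  shows "n \<le> N powr (1/4) * t powr (-3/4)"
proof (cases "n = 0")
  case False
  then have n: "n > 0" using assms by simp
  have "n = n powr (1/4) * n powr (3/4)" using n by (simp flip: powr_add)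
  also have "\<dots> \<le> N powr (1/4) * (1 / t) powr (3/4)"
    using assms n by (intro mult_mono powr_mono2) (auto simp: field_simps)
  also have "(1 / t) powr (3/4) = t powr (-3/4)"
    using assms by (simp add: powr_divide powr_minus field_simps)
  finally show ?thesis .
qed (use assms in simp)

text \<open>Induction step: for a = (n + 1)^(1/4) and b = n^(1/4), factoring 1 = a^4 - b^4 gives 1
  <= 4 (a - b) a^3, so the new term a^(-3) is at most 4 (a - b).\<close>

lemma sum_powr_le: "(\<Sum>j\<in>{1..n}. real j powr (-3/4)) \<le> 4 * real n powr (1/4)"
proof (induction n)
  case (Suc n)
  define a where "a = real (Suc n) powr (1/4)"
  define b where "b = real n powr (1/4)"
  have a4: "a ^ 4 = real (Suc n)" unfolding a_def by (simp add: powr_powr flip: powr_numeral)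
  have b4: "b ^ 4 = real n" unfolding b_def by (cases "n = 0") (simp_all add: powr_powr flip: powr_numeral)
  have ab: "0 \<le> b" "b \<le> a" "a > 0" by (auto simp: a_def b_def intro!: powr_mono2)
  have "(a - b) * (a^3 + a^2 * b + a * b^2 + b^3) = a^4 - b^4"
    by (simp add: algebra_simps power2_eq_square power3_eq_cube power4_eq_xxxx)
  also have "\<dots> = 1" using a4 b4 by simp
  finally have "1 = (a - b) * (a^3 + a^2 * b + a * b^2 + b^3)" ..
  also have "\<dots> \<le> (a - b) * (a^3 + a^2 * a + a * a^2 + a^3)"
    using ab by (intro mult_left_mono add_mono power_mono mult_mono) auto
  also have "\<dots> = (a - b) * 4 * a^3" by (simp add: power2_eq_square power3_eq_cube algebra_simps)
  finally have "1 / a^3 \<le> (a - b) * 4" using ab by (simp add: field_simps)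
  moreover have "real (Suc n) powr (-3/4) = 1 / a^3"
    unfolding a_def by (simp add: powr_powr powr_minus field_simps flip: powr_numeral)
  ultimately show ?case using Suc by (simp add: a_def b_def algebra_simps)
qed simp

lemma sum_powr_prog_le:
  assumes "T \<ge> 0"
  shows "(\<Sum>j\<in>prog T 1 0 - {0}. \<bar>of_int j\<bar> powr (-3/4)) \<le> 8 * T powr (1/4)"
proof -
  define n where "n = nat \<lfloor>T\<rfloor>"
  have n: "real n \<le> T" using assms by (simp add: n_def)
  have eq: "prog T 1 0 - {0} \<subseteq> int ` {1..n} \<union> (\<lambda>j. - int j) ` {1..n}"
  proof
    fix j assume j: "j \<in> prog T 1 0 - {0}"
    then have "\<bar>real_of_int j\<bar> \<le> T" "j \<noteq> 0" by (auto simp: prog_def)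
    then have "nat \<bar>j\<bar> \<in> {1..n}" unfolding n_def by (auto simp: le_nat_iff le_floor_iff)
    moreover have "j = int (nat \<bar>j\<bar>) \<or> j = - int (nat \<bar>j\<bar>)" by auto
    ultimately show "j \<in> int ` {1..n} \<union> (\<lambda>j. - int j) ` {1..n}" by blast
  qed
  have "(\<Sum>j\<in>prog T 1 0 - {0}. \<bar>real_of_int j\<bar> powr (-3/4))
     \<le> (\<Sum>j\<in>int ` {1..n} \<union> (\<lambda>j. - int j) ` {1..n}. \<bar>of_int j\<bar> powr (-3/4))"
    by (rule sum_mono2) (use eq in auto)
  also have "\<dots> \<le> (\<Sum>j\<in>int ` {1..n}. \<bar>of_int j\<bar> powr (-3/4)) + (\<Sum>j\<in>(\<lambda>j. - int j) ` {1..n}. \<bar>of_int j\<bar> powr (-3/4))"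
    by (subst sum_Un) (auto intro!: sum_nonneg)
  also have "\<dots> = (\<Sum>j\<in>{1..n}. real j powr (-3/4)) + (\<Sum>j\<in>{1..n}. real j powr (-3/4))"
    by (subst (1 2) sum.reindex) (auto simp: inj_on_def)
  also have "\<dots> \<le> 8 * real n powr (1/4)" using sum_powr_le[of n] by simp
  also have "\<dots> \<le> 8 * T powr (1/4)" using n by (intro mult_left_mono powr_mono2) auto
  finally show ?thesis .
qed

definition wt :: "real \<Rightarrow> real" where
  "wt u = (1 + u) powr (-3/4)"

lemma wt_nonneg [simp]: "0 \<le> wt u" by (simp add: wt_def)

lemma wt_le_1: "u \<ge> 0 \<Longrightarrow> wt u \<le> 1"
  unfolding wt_def using powr_mono2'[of "-3/4" 1 "1 + u"] by simp

text \<open>The trivial bound serves for u <= 1, the decaying one for u > 1. In both ranges 1 + u <=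
  2 max(1, u), and 2^(3/4) <= 2 gives the factor 2.\<close>

lemma wt_interpolate:
  assumes "u \<ge> 0" "x \<le> c" "u > 0 \<Longrightarrow> x \<le> c * u powr (-3/4)" "c \<ge> 0"
  shows "x \<le> 2 * c * wt u"
proof -
  have two: "1 / 2 \<le> (2::real) powr (-3/4)"
  proof -
    have "(2::real) powr (-1) \<le> 2 powr (-3/4)" by (rule powr_mono) auto
    then show ?thesis by (simp add: powr_minus field_simps)
  qed
  show ?thesis
  proof (cases "u \<le> 1")
    case True
    have "1 / 2 \<le> (2::real) powr (-3/4)" by (rule two)
    also have "\<dots> \<le> wt u" unfolding wt_def using True assms(1) by (intro powr_mono2') auto
    finally have "c * 1 \<le> c * (2 * wt u)" using assms(4) by (intro mult_left_mono) auto
    then show ?thesis using assms(2) by simp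
  next
    case False
    have "u powr (-3/4) * (1/2) \<le> u powr (-3/4) * 2 powr (-3/4)" by (intro mult_left_mono two) auto
    also have "\<dots> = (2 * u) powr (-3/4)" using False by (subst powr_mult) auto
    also have "\<dots> \<le> wt u" unfolding wt_def using False by (intro powr_mono2') auto
    finally have "c * u powr (-3/4) \<le> c * (2 * wt u)" using assms(4) by (intro mult_left_mono) auto
    then show ?thesis using assms False by simp
  qed
qed

section \<open>Bilinear sums on a single arc\<close>

definition bil_sum :: "int \<Rightarrow> real \<Rightarrow> real \<Rightarrow> nat \<Rightarrow> int \<Rightarrow> int \<Rightarrow> real \<Rightarrow> complex" where
  "bil_sum k A B m x0 y0 \<theta> = (\<Sum>x\<in>prog A m x0. \<Sum>y\<in>prog B m y0. e_fun (of_int k * \<theta> * of_int x * of_int y))"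

lemma bil_sum_commute: "bil_sum k A B m x0 y0 \<theta> = bil_sum k B A m y0 x0 \<theta>"
  unfolding bil_sum_def by (subst sum.swap) (simp add: mult_ac)

definition bil_int :: "real \<Rightarrow> real \<Rightarrow> real \<Rightarrow> complex" where
  "bil_int A B \<phi> = (LINT x:{-A..A}|lborel. seg B (\<phi> * x))"

text \<open>A point \<open>\<theta> = a/(rm) + \<beta>\<close> as produced by Dirichlet's theorem applied to \<open>m\<theta>\<close>.\<close>

locale rational_arc =
  fixes A B :: real and m r R :: nat and a k :: int and \<beta> \<theta> :: real
  assumes m: "m > 0" and r: "r > 0" "r \<le> R" and co: "coprime a (int r)"
    and AR: "4 * A \<le> R" and BR: "4 * B \<le> R" and mA: "real m \<le> A" and mB: "real m \<le> B"
    and \<beta>: "\<bar>\<beta>\<bar> \<le> 1 / (real r * real R * real m)"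
    and k: "k \<noteq> 0" "\<bar>k\<bar> \<le> 2"
    and \<theta>: "\<theta> = of_int a / real (r * m) + \<beta>"
begin

lemma pos: "A > 0" "B > 0" "R > 0" "1 \<le> A" "1 \<le> B" using m mA mB r by linarith+

lemma swap: "rational_arc B A m r R a k \<beta> \<theta>"
  using rational_arc_axioms unfolding rational_arc_def by simp

lemma phase: "of_int k * \<theta> * of_int x * real m = of_int (k * a * x) / real r + of_int k * \<beta> * real m * of_int x"
  unfolding \<theta> using m r by (simp add: field_simps)

text \<open>This is what 4A <= R and |k| <= 2 are made for: leaving the centre of the arc moves the
  phase by at most half the spacing 1/r, so a fraction over r that is not an integer keeps at least
  half of its distance to the integers.\<close>

lemma small_step: 
  assumes "\<bar>x\<bar> \<le> A" shows "\<bar>of_int k * \<beta> * real m * x\<bar> \<le> 1 / (2 * real r)"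
proof -
  have k2: "\<bar>real_of_int k\<bar> \<le> 2" using k by linarith
  have "\<bar>of_int k * \<beta> * real m * x\<bar> = \<bar>of_int k\<bar> * \<bar>\<beta>\<bar> * real m * \<bar>x\<bar>" by (simp add: abs_mult)
  also have "\<dots> \<le> 2 * (1 / (real r * real R * real m)) * real m * A"
    using assms \<beta> k2 pos by (intro mult_mono) auto
  also have "\<dots> = 2 * A / (real r * real R)" using m by simp
  also have "\<dots> \<le> (real R / 2) / (real r * real R)" using AR pos by (intro divide_right_mono) auto
  also have "\<dots> = 1 / (2 * real r)" using pos by simp
  finally show ?thesis .
qed

definition inner :: "int \<Rightarrow> int \<Rightarrow> complex" where
  "inner y0 x = (\<Sum>y\<in>prog B m y0. e_fun (of_int k * \<theta> * of_int x * of_int y))"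

lemma norm_inner_le: "norm (inner y0 x) * (2 * dint (of_int k * \<theta> * of_int x * real m)) \<le> 1"
  unfolding inner_def using norm_sum_e_fun_prog_le[OF m, of B "of_int k * \<theta> * of_int x" y0] pos by simp

lemma norm_inner_le_card: "norm (inner y0 x) \<le> 3 * B / m"
proof -
  have "norm (inner y0 x) \<le> (\<Sum>y\<in>prog B m y0. 1)"
    unfolding inner_def by (intro sum_norm_le) auto
  also have "\<dots> \<le> 2 * B / m + 1" using card_prog_le[OF m, of B y0] pos by simp
  also have "\<dots> \<le> 3 * B / m" using m mB by (simp add: field_simps)
  finally show ?thesis .
qed

text \<open>Here kax/r is not an integer, so by \<open>small_step\<close> the inner geometric sum is
  at most the reciprocal of its distance to the integers. The substitution w = kx is injective; the
  congruence modulo m is then forgotten and w runs through all integers up to 2A.\<close>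

lemma off_diagonal:
  "(\<Sum>x\<in>{x\<in>prog A m x0. \<not> int r dvd k * x}. norm (inner y0 x)) \<le> 4 * R * (1 + ln R)"
proof -
  define f where "f = (\<lambda>w. 1 / dint (of_int (a * w) / real r))"
  have "norm (inner y0 x) \<le> f (k * x)" if x: "x \<in> prog A m x0" "\<not> int r dvd k * x" for x
  proof -
    define d where "d = dint (of_int (k * a * x) / real r)"
    have "\<not> int r dvd a * (k * x)" using x(2) co by (simp add: coprime_commute coprime_dvd_mult_right_iff)
    then have d: "d \<ge> 1 / r" unfolding d_def using r by (intro dint_fraction_ge) (auto simp: mult_ac)
    have "\<bar>of_int k * \<beta> * real m * of_int x\<bar> \<le> 1 / (2 * real r)"
      using x by (intro small_step) (auto simp: prog_def)
    then have "d / 2 \<le> dint (of_int k * \<theta> * of_int x * real m)"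
      using dint_add_le[of "of_int (k * a * x) / real r" "of_int k * \<beta> * real m * of_int x"] d
      unfolding phase d_def[symmetric] by (simp add: field_simps)
    then have "norm (inner y0 x) * d \<le> norm (inner y0 x) * (2 * dint (of_int k * \<theta> * of_int x * real m))"
      by (intro mult_left_mono) auto
    also have "\<dots> \<le> 1" by (rule norm_inner_le)
    finally have "norm (inner y0 x) * d \<le> 1" .
    moreover have "d > 0" using d r by (meson less_le_trans of_nat_0_less_iff zero_less_divide_1_iff)
    ultimately have "norm (inner y0 x) \<le> 1 / d" by (simp add: field_simps)
    moreover have "a * (k * x) = k * a * x" by (simp only: mult_ac)
    ultimately show ?thesis unfolding f_def d_def by (simp only:)
  qed
  then have "(\<Sum>x\<in>{x\<in>prog A m x0. \<not> int r dvd k * x}. norm (inner y0 x))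
     \<le> (\<Sum>x\<in>{x\<in>prog A m x0. \<not> int r dvd k * x}. f (k * x))" by (intro sum_mono) auto
  also have "\<dots> = sum f ((\<lambda>x. k * x) ` {x\<in>prog A m x0. \<not> int r dvd k * x})"
    using k by (subst sum.reindex) (auto simp: inj_on_def)
  also have "\<dots> \<le> sum f (prog (2 * A) 1 0)"
  proof (rule sum_mono2)
    show "(\<lambda>x. k * x) ` {x\<in>prog A m x0. \<not> int r dvd k * x} \<subseteq> prog (2 * A) 1 0"
    proof clarify
      fix x assume "x \<in> prog A m x0"
      then have "\<bar>real_of_int k\<bar> * \<bar>real_of_int x\<bar> \<le> 2 * A"
        using k by (intro mult_mono) (auto simp: prog_def)
      then show "k * x \<in> prog (2 * A) 1 0" by (simp add: prog_def abs_mult)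
    qed
  qed (auto simp: f_def)
  also have "\<dots> \<le> (2 * (2 * A) / r + 1) * (2 * real r * (1 + ln (real r)))"
    unfolding f_def using r co pos by (intro sum_inverse_dint_prog_le) auto
  also have "\<dots> = (4 * A + r) * (2 * (1 + ln r))" using r by (simp add: field_simps)
  also have "\<dots> \<le> (R + R) * (2 * (1 + ln R))"
    using AR r pos by (intro mult_mono add_mono) auto
  finally show ?thesis by (simp add: mult_ac)
qed

text \<open>For kx = rj the phase step is m r \<beta> j up to an integer and at most 1/2 in size, so
  the inner sum is bounded by 3B/m and, for j nonzero, by 1/(2 m r |\<beta>| |j|). Interpolating and
  summing over 0 < |j| <= 2A/r gives the decaying bound; counting the j gives the trivial
  one.\<close>

lemma diagonal:
  "(\<Sum>x\<in>{x\<in>prog A m x0. int r dvd k * x}. norm (inner y0 x)) \<le> 3 * B / m + 24 * (A * B / (m * r)) * wt (A * B * \<bar>\<beta>\<bar>)"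
proof -
  define D where "D = {x\<in>prog A m x0. int r dvd k * x}"
  define T where "T = 2 * A / r"
  define J where "J = prog T 1 0 - {0}"
  have fin: "finite D" using m by (simp add: D_def)
  have T: "T \<ge> 0" using pos by (simp add: T_def)
  have inj: "inj_on (\<lambda>x. k * x div int r) (D - {0})"
  proof (rule inj_onI)
    fix x y assume "x \<in> D - {0}" "y \<in> D - {0}" "k * x div int r = k * y div int r"
    then have "k * x = k * y" by (auto simp: D_def dest!: dvd_div_eq_iff[THEN iffD1, rotated 2])
    then show "x = y" using k by simp
  qed
  have img: "(\<lambda>x. k * x div int r) ` (D - {0}) \<subseteq> J"
  proof (rule image_subsetI)
    fix x assume "x \<in> D - {0}"
    then have x: "x \<in> D" "x \<noteq> 0" by auto
    then obtain j where j: "k * x = int r * j" by (auto simp: D_def)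
    have "real r * \<bar>real_of_int j\<bar> = \<bar>real_of_int k\<bar> * \<bar>real_of_int x\<bar>"
      by (metis abs_mult abs_of_nat j of_int_mult of_int_of_nat_eq)
    also have "\<dots> \<le> 2 * A" using k x by (intro mult_mono) (auto simp: prog_def D_def)
    finally have "\<bar>real_of_int j\<bar> \<le> T" using r by (simp add: T_def field_simps)
    moreover have "j \<noteq> 0" using j x k by auto
    ultimately show "k * x div int r \<in> J" using j r by (simp add: J_def prog_def)
  qed
  \<comment> \<open>x = 0 shows no decay in \<beta> and is separated; its share 3B/m is later
    absorbed by the error R(1 + log R).\<close>
  have split: "sum (\<lambda>x. norm (inner y0 x)) D \<le> 3 * B / m + sum (\<lambda>x. norm (inner y0 x)) (D - {0})"
  proof (cases "0 \<in> D")
    case True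
    then show ?thesis using norm_inner_le_card[of y0 0] fin by (simp add: sum.remove)
  qed (use pos in \<open>auto simp: m\<close>)
  define c where "c = 12 * (A * B / (m * r))"
  have c0: "c \<ge> 0" using pos by (simp add: c_def)
  have b1: "sum (\<lambda>x. norm (inner y0 x)) (D - {0}) \<le> c"
  proof -
    have "real (card (D - {0})) = real (card ((\<lambda>x. k * x div int r) ` (D - {0})))"
      using inj by (simp add: card_image)
    also have "\<dots> \<le> real (card J)" using img by (intro of_nat_mono card_mono) (auto simp: J_def)
    also have "\<dots> = real (card (prog T 1 0)) - 1"
    proof -
      have "0 \<in> prog T 1 0" using T by (simp add: prog_def)
      then have "card (prog T 1 0) = Suc (card J)" unfolding J_def by (intro card.remove) auto
      then show ?thesis by simp
    qed
    also have "\<dots> \<le> 2 * T" using card_prog_le[of 1 T 0] T by simp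
    finally have cd: "real (card (D - {0})) \<le> 2 * T" .
    have "sum (\<lambda>x. norm (inner y0 x)) (D - {0}) \<le> (\<Sum>x\<in>D - {0}. 3 * B / m)"
      by (intro sum_mono norm_inner_le_card)
    also have "\<dots> = real (card (D - {0})) * (3 * B / m)" by simp
    also have "\<dots> \<le> 2 * T * (3 * B / m)" using cd pos by (intro mult_right_mono) auto
    also have "\<dots> = c" by (simp add: T_def c_def)
    finally show ?thesis .
  qed
  have b2: "sum (\<lambda>x. norm (inner y0 x)) (D - {0}) \<le> c * (A * B * \<bar>\<beta>\<bar>) powr (-3/4)" if \<beta>0: "A * B * \<bar>\<beta>\<bar> > 0"
  proof -
    have b0: "\<bar>\<beta>\<bar> > 0" using \<beta>0 pos by (simp add: zero_less_mult_iff)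
    define y where "y = real m * real r"
    have y: "y > 0" using m r by (simp add: y_def)
    define c2 where "c2 = (3 * B / m) powr (1/4) * (2 * y * \<bar>\<beta>\<bar>) powr (-3/4)"
    have "norm (inner y0 x) \<le> c2 * \<bar>of_int (k * x div int r)\<bar> powr (-3/4)" if x: "x \<in> D - {0}" for x
    proof -
      obtain j where j: "k * x = int r * j" using x by (auto simp: D_def)
      have j': "k * x div int r = j" using j r by simp
      have jn: "j \<noteq> 0" using j x k by auto
      have sm: "\<bar>of_int k * \<beta> * real m * of_int x\<bar> \<le> 1 / (2 * real r)"
        using x by (intro small_step) (auto simp: D_def prog_def)
      also have "\<dots> \<le> 1 / 2" using r by simp
      finally have sm2: "\<bar>of_int k * \<beta> * real m * of_int x\<bar> \<le> 1 / 2" .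
      have "k * a * x = a * j * int r" using j by (metis mult.assoc mult.commute)
      then have "of_int (k * a * x) = of_int (a * j) * real r" by (metis of_int_mult of_int_of_nat_eq)
      then have "of_int (k * a * x) / real r = of_int (a * j)" using r by (metis nonzero_mult_div_cancel_right of_nat_0_less_iff less_numeral_extra(3))
      then have "dint (of_int k * \<theta> * of_int x * real m) = \<bar>of_int k * \<beta> * real m * of_int x\<bar>"
        unfolding phase using dint_add_of_int[of "of_int k * \<beta> * real m * of_int x" "a * j"] sm2
        by (simp only: add.commute dint_eq_abs)
      also have "\<dots> = real m * \<bar>\<beta>\<bar> * \<bar>of_int (k * x)\<bar>" by (simp add: abs_mult)
      also have "\<dots> = y * \<bar>\<beta>\<bar> * \<bar>of_int j\<bar>" unfolding j by (simp add: y_def abs_mult)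
      finally have "norm (inner y0 x) * (2 * y * \<bar>\<beta>\<bar> * \<bar>of_int j\<bar>) \<le> 1"
        using norm_inner_le[of y0 x] by (simp add: mult_ac)
      then have "norm (inner y0 x) \<le> (3 * B / m) powr (1/4) * (2 * y * \<bar>\<beta>\<bar> * \<bar>of_int j\<bar>) powr (-3/4)"
        using y b0 jn by (intro le_powr_interpolate norm_inner_le_card) auto
      also have "(2 * y * \<bar>\<beta>\<bar> * \<bar>of_int j\<bar>) powr (-3/4) = (2 * y * \<bar>\<beta>\<bar>) powr (-3/4) * \<bar>of_int j\<bar> powr (-3/4)"
        using y by (subst powr_mult) auto
      finally show ?thesis unfolding j' c2_def by (simp add: mult_ac)
    qed
    then have "sum (\<lambda>x. norm (inner y0 x)) (D - {0}) \<le> (\<Sum>x\<in>D - {0}. c2 * \<bar>of_int (k * x div int r)\<bar> powr (-3/4))"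
      by (intro sum_mono)
    also have "\<dots> = (\<Sum>j\<in>(\<lambda>x. k * x div int r) ` (D - {0}). c2 * \<bar>of_int j\<bar> powr (-3/4))"
      by (subst sum.reindex[OF inj]) simp
    also have "\<dots> \<le> (\<Sum>j\<in>J. c2 * \<bar>of_int j\<bar> powr (-3/4))"
      using img by (intro sum_mono2) (auto simp: J_def c2_def)
    also have "\<dots> = c2 * (\<Sum>j\<in>J. \<bar>of_int j\<bar> powr (-3/4))" by (simp add: sum_distrib_left)
    also have "\<dots> \<le> c2 * (8 * T powr (1/4))"
      unfolding J_def by (intro mult_left_mono sum_powr_prog_le T) (auto simp: c2_def)
    also have "\<dots> = 8 * ((T * (3 * B / m)) powr (1/4) * (2 * y * \<bar>\<beta>\<bar>) powr (-3/4))"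
      using T pos by (subst powr_mult) (auto simp: c2_def)
    also have "T * (3 * B / m) = 6 * (A * B / y)" by (simp add: T_def y_def)
    \<comment> \<open>6 is raised to 8 because 8^(1/4) = 2^(3/4) cancels the 2^(-3/4) of the other
      power.\<close>
    also have "(6 * (A * B / y)) powr (1/4) \<le> (8 * (A * B / y)) powr (1/4)"
      using pos y by (intro powr_mono2 mult_right_mono) auto
    also have "(8 * (A * B / y)) powr (1/4) = 2 powr (3/4) * (A * B / y) powr (1/4)"
    proof -
      have "(8::real) powr (1/4) = (2 powr 3) powr (1/4)" by simp
      also have "\<dots> = 2 powr (3/4)" unfolding powr_powr by simp
      finally show ?thesis using pos y by (subst powr_mult) auto
    qed
    also have "(2 * y * \<bar>\<beta>\<bar>) powr (-3/4) = 2 powr (-3/4) * y powr (-3/4) * \<bar>\<beta>\<bar> powr (-3/4)"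
      using y by (simp add: powr_mult)
    also have "8 * (2 powr (3/4) * (A * B / y) powr (1/4) * (2 powr (-3/4) * y powr (-3/4) * \<bar>\<beta>\<bar> powr (-3/4)))
        = 8 * ((A * B / y) powr (1/4) * y powr (-3/4) * \<bar>\<beta>\<bar> powr (-3/4))"
      by (simp add: powr_minus field_simps)
    also have "(A * B / y) powr (1/4) * y powr (-3/4) * \<bar>\<beta>\<bar> powr (-3/4) = A * B / y * (A * B * \<bar>\<beta>\<bar>) powr (-3/4)"
    proof -
      define W where "W = A * B"
      have W: "W > 0" using pos by (simp add: W_def)
      have "(W / y) powr (1/4) * y powr (-3/4) = W powr (1/4) / (y powr (1/4) * y powr (3/4))"
        using W y by (simp add: powr_divide powr_minus field_simps)
      also have "y powr (1/4) * y powr (3/4) = y" using y by (simp flip: powr_add)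
      also have "W powr (1/4) = W * W powr (-3/4)" using W powr_add[of W 1 "-3/4"] by simp
      finally have "(W / y) powr (1/4) * y powr (-3/4) = W / y * W powr (-3/4)" by simp
      moreover have "(W * \<bar>\<beta>\<bar>) powr (-3/4) = W powr (-3/4) * \<bar>\<beta>\<bar> powr (-3/4)"
        using W by (subst powr_mult) auto
      ultimately show ?thesis unfolding W_def[symmetric] by simp
    qed
    also have "8 * (A * B / y * (A * B * \<bar>\<beta>\<bar>) powr (-3/4)) \<le> c * (A * B * \<bar>\<beta>\<bar>) powr (-3/4)"
    proof -
      have "8 * (A * B / y) \<le> 12 * (A * B / y)" using pos y by (intro mult_right_mono) auto
      then have "8 * (A * B / y) * (A * B * \<bar>\<beta>\<bar>) powr (-3/4) \<le> 12 * (A * B / y) * (A * B * \<bar>\<beta>\<bar>) powr (-3/4)"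
        by (rule mult_right_mono) auto
      then show ?thesis by (simp add: c_def y_def mult.assoc)
    qed
    finally show ?thesis using y by (simp add: mult_right_mono)
  qed
  have "sum (\<lambda>x. norm (inner y0 x)) (D - {0}) \<le> 2 * c * wt (A * B * \<bar>\<beta>\<bar>)"
    using pos by (intro wt_interpolate b1 b2 c0) auto
  then show ?thesis using split unfolding D_def[symmetric] c_def by simp
qed

lemma norm_bil_sum_split:
  "norm (bil_sum k A B m x0 y0 \<theta>) \<le> (\<Sum>x\<in>{x\<in>prog A m x0. int r dvd k * x}. norm (inner y0 x))
     + (\<Sum>x\<in>{x\<in>prog A m x0. \<not> int r dvd k * x}. norm (inner y0 x))"
proof -
  have "norm (bil_sum k A B m x0 y0 \<theta>) \<le> (\<Sum>x\<in>prog A m x0. norm (inner y0 x))"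
    unfolding bil_sum_def inner_def by (rule norm_sum)
  also have "prog A m x0 = {x\<in>prog A m x0. int r dvd k * x} \<union> {x\<in>prog A m x0. \<not> int r dvd k * x}" by blast
  also have "(\<Sum>x\<in>\<dots>. norm (inner y0 x)) = (\<Sum>x\<in>{x\<in>prog A m x0. int r dvd k * x}. norm (inner y0 x))
     + (\<Sum>x\<in>{x\<in>prog A m x0. \<not> int r dvd k * x}. norm (inner y0 x))"
    using m by (intro sum.union_disjoint) auto
  finally show ?thesis .
qed

text \<open>The 3B/m of the term x = 0 is at most R(1 + log R), so 5 would do; 9 is what
  \<open>bil_sum_approx\<close> needs, and all bilinear estimates share one error term.\<close>

lemma norm_bil_sum_le:
  "norm (bil_sum k A B m x0 y0 \<theta>) \<le> 24 * (A * B / (m * r)) * wt (A * B * \<bar>\<beta>\<bar>) + 9 * R * (1 + ln R)"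
proof -
  have "B / m \<le> B / 1" using m pos by (intro divide_left_mono) auto
  moreover have "real R * 1 \<le> R * (1 + ln R)" using pos by (intro mult_left_mono) auto
  moreover have "3 * B / m = 3 * (B / m)" by simp
  ultimately have "3 * B / m \<le> R * (1 + ln R)" using BR pos by linarith
  moreover have "0 \<le> R * (1 + ln R)" using pos by simp
  ultimately show ?thesis
    using norm_bil_sum_split[of x0 y0] diagonal[of y0 x0] off_diagonal[of y0 x0]
    by (simp add: algebra_simps)
qed

text \<open>If r | kx then p | kx, and since p is odd and |k| <= 2 also p | x, against the
  congruence of x and x0 modulo p. The diagonal is empty.\<close>

lemma norm_bil_sum_noncoprime_le:
  assumes "prime p" "p dvd r" "p dvd m" "odd p" "\<not> int p dvd x0"
  shows "norm (bil_sum k A B m x0 y0 \<theta>) \<le> 9 * R * (1 + ln R)"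
proof -
  have "\<not> int r dvd k * x" if "x \<in> prog A m x0" for x
  proof
    assume "int r dvd k * x"
    moreover have "int p dvd int r" using assms(2) by simp
    ultimately have "int p dvd k * x" by (rule dvd_trans[rotated])
    moreover have "prime (int p)" using assms(1) by simp
    ultimately have "int p dvd k \<or> int p dvd x" by (metis prime_dvd_mult_iff)
    moreover have "\<not> int p dvd k"
    proof
      assume "int p dvd k"
      then have "\<bar>int p\<bar> \<le> \<bar>k\<bar>" by (rule dvd_imp_le_int[OF k(1)])
      moreover have "p \<noteq> 2" using assms(4) by auto
      ultimately show False using k(2) prime_ge_2_nat[OF assms(1)] by linarith
    qed
    moreover have "int p dvd x - x0"
      by (rule dvd_trans[of _ "int m"]) (use that assms(3) in \<open>simp_all add: prog_def\<close>)
    ultimately have "int p dvd x - (x - x0)" by (metis dvd_diff)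
    then show False using assms(5) by simp
  qed
  then have "{x\<in>prog A m x0. int r dvd k * x} = {}" by blast
  then have "(\<Sum>x\<in>{x\<in>prog A m x0. int r dvd k * x}. norm (inner y0 x)) = 0" by (simp only: sum.empty)
  then have "norm (bil_sum k A B m x0 y0 \<theta>) \<le> 4 * R * (1 + ln R)"
    using norm_bil_sum_split[of x0 y0] off_diagonal[of y0 x0] by simp
  also have "\<dots> \<le> 9 * R * (1 + ln R)" using pos by (intro mult_right_mono) auto
  finally show ?thesis .
qed

text \<open>r | kx means r' | x for r' = r/gcd(k, r). Together with the congruence modulo m this is
  a single class modulo mr', on which the phase is k \<beta> x y modulo 1. The sum over x is
  replaced by an integral for each y, then the sum over y for each real x. The factor gcd(k, r)/r is
  1/r', and the two replacements cost 12B + 8A <= 5R.\<close>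

lemma bil_sum_approx:
  assumes cop: "coprime m r" and ab: "a = b * int m"
  shows "norm (bil_sum k A B m x0 y0 (of_int b / r + \<beta>)
     - of_int (gcd k (int r)) / (of_nat m ^ 2 * of_nat r) * bil_int A B (of_int k * \<beta>)) \<le> 9 * R * (1 + ln R)"
proof -
  define D where "D = {x\<in>prog A m x0. int r dvd k * x}"
  define D' where "D' = {x\<in>prog A m x0. \<not> int r dvd k * x}"
  have \<theta>': "of_int b / r + \<beta> = \<theta>" unfolding \<theta> ab using m r by simp
  define d where "d = gcd k (int r)"
  define r' where "r' = r div nat d"
  have d0: "d > 0" using k by (simp add: d_def)
  have dr: "nat d dvd r" using d0 unfolding d_def by (simp add: nat_dvd_iff)
  have rr: "r = nat d * r'" using dr by (simp add: r'_def)
  have r'0: "r' > 0" using rr r by (auto intro!: Nat.gr0I)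
  have ri: "int r = d * int r'" using d0 by (subst rr) simp
  have dvd_iff: "int r dvd k * x \<longleftrightarrow> int r' dvd x" for x
  proof -
    obtain k' where k': "k = d * k'" by (metis d_def dvd_def gcd_dvd1)
    have "gcd (d * k') (d * int r') = d" using d_def k' ri by simp
    then have "coprime k' (int r')" using d0 by (simp add: gcd_mult_distrib_int[symmetric] coprime_iff_gcd_eq_1)
    then show ?thesis unfolding ri k' using d0 by (simp add: mult.assoc coprime_commute coprime_dvd_mult_right_iff)
  qed
  have cop': "coprime (int m) (int r')" using cop rr by (simp add: coprime_mult_right_iff)
  obtain u v where uv: "u * int m + v * int r' = gcd (int m) (int r')"
    using bezout_int by blast
  \<comment> \<open>Since v r' is 1 modulo m, this is congruent to x0 modulo m and to 0 modulo
    r'.\<close>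
  define x1 where "x1 = x0 * v * int r'"
  have D: "D = prog A (m * r') x1"
  proof -
    have "(int m dvd x - x0 \<and> int r' dvd x) \<longleftrightarrow> int (m * r') dvd x - x1" for x
    proof -
      have "v * int r' = 1 - u * int m" using uv cop' by (simp add: coprime_iff_gcd_eq_1)
      then have "x1 = x0 * (1 - u * int m)" by (simp add: x1_def mult.assoc)
      then have "x1 - x0 = int m * (- x0 * u)" by (simp add: algebra_simps)
      then have d1: "int m dvd x1 - x0" by (metis dvd_triv_left)
      have d2: "int r' dvd x1" by (simp add: x1_def)
      have "int m dvd x - x0 \<longleftrightarrow> int m dvd (x - x1) + (x1 - x0)" by simp
      also have "\<dots> \<longleftrightarrow> int m dvd x - x1" using d1 by (rule dvd_add_left_iff)
      finally have 1: "int m dvd x - x0 \<longleftrightarrow> int m dvd x - x1" .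
      have "int r' dvd x \<longleftrightarrow> int r' dvd (x - x1) + x1" by simp
      also have "\<dots> \<longleftrightarrow> int r' dvd x - x1" using d2 by (rule dvd_add_left_iff)
      finally have 2: "int r' dvd x \<longleftrightarrow> int r' dvd x - x1" .
      show ?thesis unfolding 1 2 using divides_mult[OF _ _ cop'] dvd_mult_left dvd_mult_right by (auto simp only: of_nat_mult)
    qed
    then show ?thesis unfolding D_def dvd_iff by (auto simp: prog_def)
  qed
  define s where "s = m * r'"
  have s: "s > 0" using m r'0 by (simp add: s_def)
  have k2: "\<bar>real_of_int k\<bar> \<le> 2" using k by linarith
  define \<psi> where "\<psi> = of_int k * \<beta>"
  have inner_D: "inner y0 x = (\<Sum>y\<in>prog B m y0. e_fun (\<psi> * of_int x * of_int y))" if "x \<in> D" for x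
  proof -
    have "int r dvd k * x" using that by (simp only: D_def mem_Collect_eq)
    then obtain j where j: "k * x = int r * j" by (elim dvdE)
    have "of_int k * \<theta> * of_int x * of_int y = \<psi> * of_int x * of_int y + of_int (b * j * y)" for y
    proof -
      have "of_int k * \<theta> * of_int x * of_int y = \<psi> * of_int x * of_int y + of_int b * of_int (k * x) * of_int y / r"
        unfolding \<theta>'[symmetric] \<psi>_def by (simp add: algebra_simps)
      also have "of_int b * of_int (k * x) * of_int y / r = of_int (b * j * y)" unfolding j using r by simp
      finally show ?thesis .
    qed
    then show ?thesis unfolding inner_def by (simp only: e_fun_add_of_int)
  qed
  define Pd where "Pd = (\<Sum>x\<in>prog A s x1. \<Sum>y\<in>prog B m y0. e_fun (\<psi> * of_int x * of_int y))"
  have split: "bil_sum k A B m x0 y0 \<theta> = Pd + (\<Sum>x\<in>D'. inner y0 x)"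
  proof -
    have "bil_sum k A B m x0 y0 \<theta> = (\<Sum>x\<in>D \<union> D'. inner y0 x)"
      unfolding bil_sum_def inner_def D_def D'_def by (intro sum.cong) auto
    also have "\<dots> = (\<Sum>x\<in>D. inner y0 x) + (\<Sum>x\<in>D'. inner y0 x)"
      using m by (intro sum.union_disjoint) (auto simp: D_def D'_def)
    also have "(\<Sum>x\<in>D. inner y0 x) = Pd"
      unfolding Pd_def s_def D[symmetric] by (intro sum.cong refl inner_D)
    finally show ?thesis .
  qed
  have D'b: "norm (\<Sum>x\<in>D'. inner y0 x) \<le> 4 * R * (1 + ln R)"
    unfolding D'_def by (rule order_trans[OF norm_sum off_diagonal])
  have e1: "norm ((\<Sum>x\<in>prog A s x1. e_fun (\<psi> * of_int y * of_int x)) - seg A (\<psi> * of_int y) / of_nat s) \<le> 4"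
    if y: "y \<in> prog B m y0" for y
  proof (rule sum_e_fun_prog_approx[OF s])
    have "\<bar>\<psi> * of_int y * real s\<bar> = \<bar>of_int k\<bar> * \<bar>\<beta>\<bar> * \<bar>of_int y\<bar> * (real m * real r')" by (simp add: \<psi>_def abs_mult s_def)
    also have "\<dots> \<le> 2 * (1 / (real r * real R * real m)) * B * (real m * real r)"
      using y \<beta> k2 pos rr d0 r by (intro mult_mono) (auto simp: prog_def Suc_le_eq)
    also have "\<dots> = 2 * B / real R" using m r by simp
    also have "\<dots> \<le> 1 / 2" using BR pos by (simp add: field_simps)
    finally show "\<bar>\<psi> * of_int y * real s\<bar> \<le> 1 / 2" .
  qed (use pos in simp)
  have e2: "norm ((\<Sum>y\<in>prog B m y0. e_fun (\<psi> * x * of_int y)) - seg B (\<psi> * x) / of_nat m) \<le> 4"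
    if x: "x \<in> {-A..A}" for x
  proof (rule sum_e_fun_prog_approx[OF m])
    have "\<bar>\<psi> * x * real m\<bar> \<le> 1 / (2 * real r)" using small_step[of x] x by (simp add: \<psi>_def mult_ac abs_le_iff)
    also have "\<dots> \<le> 1 / 2" using r by simp
    finally show "\<bar>\<psi> * x * real m\<bar> \<le> 1 / 2" .
  qed (use pos in simp)
  define I1 where "I1 = (\<Sum>y\<in>prog B m y0. seg A (\<psi> * of_int y))"
  have n1: "norm (Pd - I1 / of_nat s) \<le> 12 * B"
  proof -
    have "Pd - I1 / of_nat s = (\<Sum>y\<in>prog B m y0. (\<Sum>x\<in>prog A s x1. e_fun (\<psi> * of_int y * of_int x)) - seg A (\<psi> * of_int y) / of_nat s)"
      unfolding Pd_def I1_def by (subst sum.swap) (simp add: sum_subtractf sum_divide_distrib mult_ac)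
    also have "norm \<dots> \<le> (\<Sum>y\<in>prog B m y0. 4)" by (intro sum_norm_le e1)
    also have "\<dots> \<le> 4 * (2 * B / m + 1)" using card_prog_le[OF m, of B y0] pos by simp
    also have "\<dots> \<le> 4 * (3 * B / m)" using m mB by (simp add: field_simps)
    also have "\<dots> \<le> 4 * (3 * B / 1)" using m pos by (intro mult_left_mono divide_left_mono) auto
    finally show ?thesis by simp
  qed
  have I1: "I1 = (LINT x:{-A..A}|lborel. (\<Sum>y\<in>prog B m y0. e_fun (\<psi> * x * of_int y)))"
    unfolding I1_def seg_def set_lebesgue_integral_def scaleR_sum_right
    by (subst Bochner_Integration.integral_sum) (auto intro!: integrable_indicator_Icc continuous_intros simp: mult_ac)
  have n2: "norm (I1 - bil_int A B \<psi> / of_nat m) \<le> 8 * A"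
  proof -
    have div: "bil_int A B \<psi> / of_nat m = (LINT x:{-A..A}|lborel. seg B (\<psi> * x) / of_nat m)"
      unfolding bil_int_def by (rule set_integral_divide_zero[symmetric])
    have "I1 - bil_int A B \<psi> / of_nat m = (LINT x:{-A..A}|lborel. (\<Sum>y\<in>prog B m y0. e_fun (\<psi> * x * of_int y)) - seg B (\<psi> * x) / of_nat m)"
      unfolding I1 div set_lebesgue_integral_def scaleR_diff_right
      using pos m by (subst Bochner_Integration.integral_diff) (auto intro!: integrable_indicator_Icc continuous_intros)
    also have "norm \<dots> \<le> (LINT x:{-A..A}|lborel. 4)"
      unfolding set_lebesgue_integral_def
      using pos m e2 by (intro Bochner_Integration.integral_norm_bound_integral integrable_indicator_Icc continuous_intros)
        (auto simp: indicator_def)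
    also have "\<dots> = 8 * A" using pos by (simp add: set_lebesgue_integral_def)
    finally show ?thesis .
  qed
  have main: "of_int d / (of_nat m ^ 2 * of_nat r) * bil_int A B \<psi> = bil_int A B \<psi> / of_nat m / of_nat s"
  proof -
    have "of_nat r = (of_int d :: complex) * of_nat r'" by (metis ri of_int_mult of_int_of_nat_eq)
    then show ?thesis using d0 r'0 m by (simp add: s_def field_simps power2_eq_square)
  qed
  have "bil_sum k A B m x0 y0 \<theta> - of_int d / (of_nat m ^ 2 * of_nat r) * bil_int A B \<psi>
     = (\<Sum>x\<in>D'. inner y0 x) + ((Pd - I1 / of_nat s) + (I1 - bil_int A B \<psi> / of_nat m) / of_nat s)"
    unfolding split main by (simp add: diff_divide_distrib)
  also have "norm \<dots> \<le> 4 * R * (1 + ln R) + (12 * B + 8 * A)"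
  proof -
    have "norm ((I1 - bil_int A B \<psi> / of_nat m) / of_nat s) \<le> norm (I1 - bil_int A B \<psi> / of_nat m) / 1"
      unfolding norm_divide using s by (intro divide_left_mono) auto
    then show ?thesis using n1 n2 D'b by (intro norm_triangle_mono) auto
  qed
  also have "\<dots> \<le> 4 * R * (1 + ln R) + 5 * R" using AR BR by simp
  also have "\<dots> \<le> 4 * R * (1 + ln R) + 5 * R * (1 + ln R)"
    using pos by (intro add_left_mono) (simp add: algebra_simps)
  finally show ?thesis unfolding \<theta>' d_def \<psi>_def by simp
qed

end

section \<open>Decay of the bilinear integral\<close>

text \<open>The continuous counterpart of \<open>diagonal\<close>: the inner integral is at most 2B
  and at most 1/(pi |\<phi> x|), and the interpolated power |x|^(-3/4) is integrable at 0.\<close>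

lemma norm_bil_int_le:
  assumes "A > 0" "B > 0"
  shows "norm (bil_int A B \<phi>) \<le> 32 * (A * B) * wt (A * B * \<bar>\<phi>\<bar>)"
proof -
  have J: "bil_int A B \<phi> = integral {-A..A} (\<lambda>x. seg B (\<phi> * x))"
    unfolding bil_int_def set_lebesgue_integral_def
    using assms by (intro set_borel_integral_eq_integral(2)[unfolded set_lebesgue_integral_def set_integrable_def])
      (auto intro!: integrable_indicator_Icc continuous_intros)
  have io: "(\<lambda>x. seg B (\<phi> * x)) integrable_on {-A..A}"
    using assms by (intro integrable_continuous_real continuous_intros) auto
  define c where "c = 16 * (A * B)"
  have b1: "norm (bil_int A B \<phi>) \<le> c"
  proof -
    have "norm (bil_int A B \<phi>) \<le> integral {-A..A} (\<lambda>x. 2 * B)"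
      unfolding J using assms io by (intro Henstock_Kurzweil_Integration.integral_norm_bound_integral norm_seg_le) auto
    also have "\<dots> = 4 * (A * B)" using assms by simp
    also have "\<dots> \<le> c" unfolding c_def using assms by (intro mult_right_mono) auto
    finally show ?thesis .
  qed
  have b2: "norm (bil_int A B \<phi>) \<le> c * (A * B * \<bar>\<phi>\<bar>) powr (-3/4)" if "A * B * \<bar>\<phi>\<bar> > 0"
  proof -
    have \<phi>: "\<bar>\<phi>\<bar> > 0" using that assms by (simp add: zero_less_mult_iff)
    have h1: "((\<lambda>x. \<bar>x\<bar> powr (-3/4)) has_integral (A powr (1/4) / (1/4))) {0..A}"
      using has_integral_powr_from_0[of "-3/4" A] assms
      by (rule_tac has_integral_eq[of _ "\<lambda>x. x powr (-3/4)"]) auto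
    have h2: "((\<lambda>x. \<bar>x\<bar> powr (-3/4)) has_integral (A powr (1/4) / (1/4))) {-A..0}"
      using has_integral_reflect_real[of "\<lambda>x. \<bar>x\<bar> powr (-3/4)" _ A 0] h1 by simp
    have h: "((\<lambda>x. \<bar>x\<bar> powr (-3/4)) has_integral (8 * A powr (1/4))) {-A..A}"
      using has_integral_combine[OF _ _ h2 h1] assms by simp
    define c2 where "c2 = (2 * B) powr (1/4) * \<bar>\<phi>\<bar> powr (-3/4)"
    \<comment> \<open>\<open>0 powr (-3/4)\<close> is 0, so the power bound fails at x = 0; the
      value there is replaced by 2B, which does not change the integral.\<close>
    have pt: "norm (seg B (\<phi> * x)) \<le> (if x = 0 then 2 * B else c2 * \<bar>x\<bar> powr (-3/4))" for x
    proof (cases "x = 0")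
      case False
      have "norm (seg B (\<phi> * x)) * \<bar>\<phi> * x\<bar> \<le> norm (seg B (\<phi> * x)) * (pi * \<bar>\<phi> * x\<bar>)"
        using pi_ge_two mult_right_mono[of 1 pi "\<bar>\<phi> * x\<bar>"] by (intro mult_left_mono) auto
      also have "\<dots> \<le> 1" using assms by (intro norm_seg_mult_le) auto
      finally have "norm (seg B (\<phi> * x)) \<le> (2 * B) powr (1/4) * \<bar>\<phi> * x\<bar> powr (-3/4)"
        using assms False \<phi> by (intro le_powr_interpolate norm_seg_le) auto
      then show ?thesis using False by (simp add: c2_def abs_mult powr_mult mult_ac)
    qed (use assms norm_seg_le[of B 0] in auto)
    have h': "((\<lambda>x. if x = 0 then 2 * B else c2 * \<bar>x\<bar> powr (-3/4)) has_integral (c2 * (8 * A powr (1/4)))) {-A..A}"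
      by (rule has_integral_spike[OF _ _ has_integral_mult_right[OF h, of c2], of "{0}"]) auto
    have "norm (bil_int A B \<phi>) \<le> integral {-A..A} (\<lambda>x. if x = 0 then 2 * B else c2 * \<bar>x\<bar> powr (-3/4))"
      unfolding J using h' io pt by (intro Henstock_Kurzweil_Integration.integral_norm_bound_integral) (auto simp: integrable_on_def)
    also have "\<dots> = c2 * (8 * A powr (1/4))" by (rule integral_unique[OF h'])
    also have "\<dots> = 8 * (A * (2 * B)) powr (1/4) * \<bar>\<phi>\<bar> powr (-3/4)"
      using assms unfolding c2_def by (subst powr_mult[of A]) auto
    \<comment> \<open>2 is raised to 16, whose fourth root is 2.\<close>
    also have "(A * (2 * B)) powr (1/4) \<le> (16 * (A * B)) powr (1/4)" using assms by (intro powr_mono2) auto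
    also have "(16 * (A * B)) powr (1/4) = 2 * (A * B) powr (1/4)"
    proof -
      have "(16::real) powr (1/4) = (2 powr 4) powr (1/4)" by simp
      also have "\<dots> = 2" unfolding powr_powr by simp
      finally show ?thesis using assms by (subst powr_mult) auto
    qed
    also have "(A * B) powr (1/4) = A * B * (A * B) powr (-3/4)"
      using assms powr_add[of "A * B" 1 "-3/4"] by simp
    finally have "norm (bil_int A B \<phi>) \<le> 8 * (2 * (A * B * (A * B) powr (-3/4))) * \<bar>\<phi>\<bar> powr (-3/4)"
      by (simp add: mult_right_mono)
    also have "\<dots> = c * ((A * B) powr (-3/4) * \<bar>\<phi>\<bar> powr (-3/4))" by (simp add: c_def)
    also have "(A * B) powr (-3/4) * \<bar>\<phi>\<bar> powr (-3/4) = (A * B * \<bar>\<phi>\<bar>) powr (-3/4)"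
      using assms by (subst (2) powr_mult) auto
    finally show ?thesis .
  qed
  have "norm (bil_int A B \<phi>) \<le> 2 * c * wt (A * B * \<bar>\<phi>\<bar>)"
    using assms by (intro wt_interpolate b1 b2) (auto simp: c_def)
  then show ?thesis by (simp add: c_def)
qed

section \<open>The singular series\<close>

lemma ball_coords:
  "(\<forall>(i, j)\<in>coords. P i j) \<longleftrightarrow> P 1 1 \<and> P 1 2 \<and> P 1 3 \<and> P 1 4 \<and> P 2 2 \<and> P 2 4 \<and> P 3 3 \<and> P 3 4 \<and> P 4 4"
  by (simp add: coords_def)

text \<open>The pairing of the coordinates is that of q. With arbitrary coordinate sets the lemma
  serves both the complete sums modulo r and the lattice points of the box. The nesting of the
  tuples is the one that repeated products of sums produce.\<close>

lemma sum_V_box: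
  fixes S :: "4 \<Rightarrow> 4 \<Rightarrow> int set" and f1 :: "int \<Rightarrow> int \<Rightarrow> 'a::comm_semiring_1"
  shows "(\<Sum>B\<in>{B\<in>V. \<forall>(i, j)\<in>coords. B $ i $ j \<in> S i j}.
      f1 (B$1$1) (B$4$4) * f2 (B$2$2) (B$3$3) * f3 (B$1$2) (B$3$4) * f4 (B$1$3) (B$2$4) * g (B$1$4))
    = (\<Sum>x\<in>S 1 1. \<Sum>y\<in>S 4 4. f1 x y) * (\<Sum>x\<in>S 2 2. \<Sum>y\<in>S 3 3. f2 x y)
      * (\<Sum>x\<in>S 1 2. \<Sum>y\<in>S 3 4. f3 x y) * (\<Sum>x\<in>S 1 3. \<Sum>y\<in>S 2 4. f4 x y) * (\<Sum>z\<in>S 1 4. g z)"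
proof -
  define mk :: "((((int \<times> int) \<times> int \<times> int) \<times> int \<times> int) \<times> int \<times> int) \<times> int \<Rightarrow> int ^ 4 ^ 4" where
    "mk = (\<lambda>(((((a, b), c, d), e, f), g, h), z). of_coords (\<lambda>p.
       if p = (1,1) then a else if p = (4,4) then b else if p = (2,2) then c else if p = (3,3) then d
       else if p = (1,2) then e else if p = (3,4) then f else if p = (1,3) then g else if p = (2,4) then h else z))"
  define T where "T = ((((S 1 1 \<times> S 4 4) \<times> (S 2 2 \<times> S 3 3)) \<times> (S 1 2 \<times> S 3 4)) \<times> (S 1 3 \<times> S 2 4)) \<times> S 1 4"
  have "(\<Sum>x\<in>S 1 1. \<Sum>y\<in>S 4 4. f1 x y) * (\<Sum>x\<in>S 2 2. \<Sum>y\<in>S 3 3. f2 x y)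
      * (\<Sum>x\<in>S 1 2. \<Sum>y\<in>S 3 4. f3 x y) * (\<Sum>x\<in>S 1 3. \<Sum>y\<in>S 2 4. f4 x y) * (\<Sum>z\<in>S 1 4. g z)
    = (\<Sum>(((((a, b), c, d), e, f), u, h), z)\<in>T. f1 a b * f2 c d * f3 e f * f4 u h * g z)"
    unfolding T_def by (simp add: sum_product sum.cartesian_product case_prod_unfold)
  also have "\<dots> = (\<Sum>B\<in>{B\<in>V. \<forall>(i, j)\<in>coords. B $ i $ j \<in> S i j}.
      f1 (B$1$1) (B$4$4) * f2 (B$2$2) (B$3$3) * f3 (B$1$2) (B$3$4) * f4 (B$1$3) (B$2$4) * g (B$1$4))"
  proof (rule sum.reindex_bij_witness[where j = mk and i = "\<lambda>B. (((((B$1$1, B$4$4), B$2$2, B$3$3), B$1$2, B$3$4), B$1$3, B$2$4), B$1$4)"], goal_cases)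
    case (3 B)
    then have B: "B \<in> V" by simp
    have "mk (((((B$1$1, B$4$4), B$2$2, B$3$3), B$1$2, B$3$4), B$1$3, B$2$4), B$1$4) = of_coords (\<lambda>(i, j). B $ i $ j)"
      unfolding mk_def of_coords_def coords_def by (simp add: vec_eq_iff forall_4)
    then show ?case using of_coords_entries[OF B] by simp
  next
    case (4 B)
    then show ?case by (simp add: T_def ball_coords)
  next
    case (2 x)
    have "mk x \<in> V" by (simp add: mk_def of_coords_in_V split: prod.split)
    moreover have "\<forall>(i, j)\<in>coords. mk x $ i $ j \<in> S i j"
      using 2 by (auto simp: mk_def T_def ball_coords of_coords_def coords_def)
    ultimately show ?case by simp
  qed (auto simp: mk_def T_def of_coords_def coords_def)
  finally show ?thesis ..
qed

section \<open>Evaluation of the local sums\<close>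

lemma sum_e_fun_multiples:
  assumes "r > 0"
  shows "(\<Sum>y\<in>{0..<int r}. e_fun (of_int (n * y) / r)) = (if int r dvd n then of_nat r else 0)"
proof (cases "int r dvd n")
  case True
  then obtain k where k: "n = int r * k" by blast
  then have "of_int (n * y) / real r = of_int (k * y)" for y using assms by simp
  then show ?thesis using True by (simp only: e_fun_of_int) simp
next
  case False
  define f where "f = (\<lambda>y. e_fun (of_int (n * y) / r))"
  define w where "w = e_fun (of_int n / r)"
  have per: "f (x mod int r) = f x" for x
  proof -
    have "n * x = n * (x mod int r) + int r * (n * (x div int r))"
      by (simp add: algebra_simps flip: distrib_left)
    then have "of_int (n * x) / real r = of_int (n * (x mod int r)) / real r + of_int (n * (x div int r))"
      using assms by (simp add: field_simps)
    then show ?thesis unfolding f_def by (simp only: e_fun_add_of_int)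
  qed
  have "w * (\<Sum>y\<in>{0..<int r}. f y) = (\<Sum>y\<in>{0..<int r}. f (1 * y + 1))"
    by (simp add: sum_distrib_left f_def w_def algebra_simps add_divide_distrib flip: e_fun_add)
  also have "\<dots> = (\<Sum>y\<in>{0..<int r}. f y)"
    by (rule sum_periodic_affine[where f = f, OF assms _ per]) simp
  finally have "(w - 1) * (\<Sum>y\<in>{0..<int r}. f y) = 0" by (simp add: algebra_simps)
  moreover have "norm (w - 1) > 0"
  proof -
    have "0 < 4 * (1 / real r)" using assms by simp
    also have "\<dots> \<le> 4 * dint (of_int n / r)"
      using False assms by (intro mult_left_mono dint_fraction_ge) auto
    also have "\<dots> \<le> norm (w - 1)" unfolding w_def by (rule norm_e_fun_minus_1_ge)
    finally show ?thesis .
  qed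
  ultimately show ?thesis using False by (auto simp: f_def)
qed

lemma card_multiples_mod:
  assumes "r > 0" "k \<noteq> 0"
  shows "int (card {x\<in>{0..<int r}. int r dvd k * x}) = gcd k (int r)"
proof -
  define d where "d = gcd k (int r)"
  have d0: "d > 0" using assms by (simp add: d_def)
  obtain k' where k': "k = d * k'" by (metis d_def dvd_def gcd_dvd1)
  obtain r' where r': "int r = d * r'" by (metis d_def dvd_def gcd_dvd2)
  have r'0: "r' > 0" using r' assms(1) d0 by (metis of_nat_0_less_iff zero_less_mult_pos)
  have "gcd (d * k') (d * r') = d" using d_def k' r' by simp
  then have co: "coprime r' k'" using d0 by (simp add: gcd_mult_distrib_int[symmetric] coprime_iff_gcd_eq_1 gcd.commute)
  have "{x\<in>{0..<int r}. int r dvd k * x} = (\<lambda>y. r' * y) ` {0..<d}"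
  proof (intro set_eqI iffI)
    fix x assume x: "x \<in> {x\<in>{0..<int r}. int r dvd k * x}"
    then have "r' dvd x" unfolding r' k' using d0 co by (simp add: mult.assoc coprime_dvd_mult_right_iff)
    then obtain y where y: "x = r' * y" by blast
    have "y \<in> {0..<d}" using x r'0 d0 unfolding y r' by (simp add: mult.commute[of d] zero_le_mult_iff)
    then show "x \<in> (\<lambda>y. r' * y) ` {0..<d}" using y by blast
  next
    fix x assume "x \<in> (\<lambda>y. r' * y) ` {0..<d}"
    then obtain y where y: "x = r' * y" "0 \<le> y" "y < d" by (elim imageE) (use that in auto)
    then have "x < int r" "0 \<le> x" unfolding r' using r'0 by (simp_all add: mult.commute[of d])
    then show "x \<in> {x\<in>{0..<int r}. int r dvd k * x}" using y by (simp add: k' r')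
  qed
  then show ?thesis using r'0 d0 by (simp add: card_image inj_on_def d_def)
qed

lemma complete_bil_sum:
  assumes "r > 0" "k \<noteq> 0" "coprime a (int r)"
  shows "(\<Sum>x\<in>{0..<int r}. \<Sum>y\<in>{0..<int r}. e_fun (of_int a / r * of_int (k * x * y))) = of_nat r * of_int (gcd k (int r))"
proof -
  have "(\<Sum>y\<in>{0..<int r}. e_fun (of_int a / r * of_int (k * x * y))) = (if int r dvd k * x then of_nat r else 0)" for x
  proof -
    have "int r dvd a * (k * x) \<longleftrightarrow> int r dvd k * x"
      using assms(3) by (simp add: coprime_commute coprime_dvd_mult_right_iff)
    moreover have "of_int a / r * of_int (k * x * y) = of_int (a * (k * x) * y) / real r" for y by simp
    ultimately show ?thesis using sum_e_fun_multiples[OF assms(1), of "a * (k * x)"] by (simp only:)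
  qed
  then have "(\<Sum>x\<in>{0..<int r}. \<Sum>y\<in>{0..<int r}. e_fun (of_int a / r * of_int (k * x * y)))
      = (\<Sum>x\<in>{x\<in>{0..<int r}. int r dvd k * x}. of_nat r)"
    by (simp add: sum.If_cases Int_def conj_commute)
  also have "\<dots> = of_nat r * of_int (int (card {x\<in>{0..<int r}. int r dvd k * x}))" by simp
  finally show ?thesis by (simp only: card_multiples_mod[OF assms(1,2)])
qed

definition units_mod :: "nat \<Rightarrow> int set" where
  "units_mod r = {a \<in> {0..<int r}. coprime a (int r)}"

definition gauss_total :: "nat \<Rightarrow> complex" where
  "gauss_total r = (\<Sum>a\<in>units_mod r. gauss_sum (-2) a r)"

lemma finite_units_mod [simp]: "finite (units_mod r)"
  by (rule finite_subset[of _ "{0..<int r}"]) (auto simp: units_mod_def)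

lemma sum_units_mod: "(\<Sum>a\<in>{a. a < r \<and> gcd a r = 1}. f (int a)) = sum f (units_mod r)"
proof (rule sum.reindex_bij_witness[of _ nat int])
  fix a assume a: "a \<in> units_mod r"
  then have "coprime (int (nat a)) (int r)" by (simp add: units_mod_def)
  then have "coprime (nat a) r" by (simp only: coprime_int_iff)
  then show "nat a \<in> {a. a < r \<and> gcd a r = 1}"
    using a by (simp add: units_mod_def nat_less_iff coprime_iff_gcd_eq_1)
qed (auto simp: units_mod_def coprime_iff_gcd_eq_1)

lemma quad_q_phase:
  fixes M :: "int ^ 4 ^ 4"
  shows "e_fun (t * of_int (quad_q M)) =
     e_fun (t * of_int (-1 * M$1$1 * M$4$4)) * e_fun (t * of_int (-1 * M$2$2 * M$3$3))
     * e_fun (t * of_int (-2 * M$1$2 * M$3$4)) * e_fun (t * of_int (-2 * M$1$3 * M$2$4)) * e_fun (t * of_int (-2 * (M$1$4)\<^sup>2))"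
  unfolding e_fun_add[symmetric] quad_q_def by (rule arg_cong[of _ _ e_fun]) (simp add: algebra_simps)

text \<open>The two pairs with coefficient -1 give r each, the two with coefficient -2 give r gcd(2,
  r) each; only the Gauss sum in b14 still depends on a.\<close>

lemma C_q_eq:
  assumes "r > 0"
  shows "C_q r = of_int (gcd 2 (int r)) ^ 2 / of_nat r ^ 5 * gauss_total r"
proof -
  have VM: "V_mod r = {B\<in>V. \<forall>(i, j)\<in>coords. B $ i $ j \<in> (\<lambda>_ _. {0..<int r}) i j}" by (simp add: V_mod_def)
  have *: "(\<Sum>B\<in>V_mod r. e_fun (of_int a / real r * of_int (quad_q B))) = of_nat r ^ 4 * of_int (gcd 2 (int r)) ^ 2 * gauss_sum (-2) a r"
    if a: "a \<in> units_mod r" for a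
  proof -
    have co: "coprime a (int r)" using a by (simp add: units_mod_def)
    have g: "gauss_sum (-2) a r = (\<Sum>z\<in>{0..<int r}. e_fun (of_int a / r * of_int (-2 * z\<^sup>2)))"
      unfolding gauss_sum_def by (intro sum.cong refl arg_cong[of _ _ e_fun]) simp
    show ?thesis
      unfolding VM quad_q_phase sum_V_box[where S = "\<lambda>_ _. {0..<int r}"
        and ?f1.0 = "\<lambda>x y. e_fun (of_int a / real r * of_int (-1 * x * y))"
        and ?f2.0 = "\<lambda>x y. e_fun (of_int a / real r * of_int (-1 * x * y))"
        and ?f3.0 = "\<lambda>x y. e_fun (of_int a / real r * of_int (-2 * x * y))"
        and ?f4.0 = "\<lambda>x y. e_fun (of_int a / real r * of_int (-2 * x * y))"
        and g = "\<lambda>z. e_fun (of_int a / real r * of_int (-2 * z\<^sup>2))"]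
      by (subst complete_bil_sum[OF assms _ co], simp)+ (simp add: g power2_eq_square power4_eq_xxxx mult_ac)
  qed
  have "C_q r = 1 / of_nat r ^ 9 * (\<Sum>a\<in>units_mod r. \<Sum>B\<in>V_mod r. e_fun (of_int a / real r * of_int (quad_q B)))"
    unfolding C_q_def sum_units_mod[symmetric] by simp
  also have "\<dots> = 1 / of_nat r ^ 9 * (of_nat r ^ 4 * of_int (gcd 2 (int r)) ^ 2 * gauss_total r)"
    by (simp only: * gauss_total_def sum_distrib_left cong: sum.cong)
  also have "(of_nat r :: complex) ^ 9 = of_nat r ^ 4 * of_nat r ^ 5" by (simp flip: power_add)
  also have "1 / (of_nat r ^ 4 * of_nat r ^ 5) * (of_nat r ^ 4 * of_int (gcd 2 (int r)) ^ 2 * gauss_total r)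
     = of_int (gcd 2 (int r)) ^ 2 / (of_nat r :: complex) ^ 5 * gauss_total r" using assms by (simp add: field_simps)
  finally show ?thesis .
qed

lemma C_q_0 [simp]: "C_q 0 = 0" by (simp add: C_q_def)

lemma C_q_1 [simp]: "C_q (Suc 0) = 1"
proof -
  have u: "units_mod (Suc 0) = {0}" by (auto simp: units_mod_def)
  have i: "{0..<1::int} = {0}" by auto
  show ?thesis by (subst C_q_eq) (auto simp: gauss_total_def u gauss_sum_def i)
qed

lemma norm_gauss_sum_le: "norm (gauss_sum l a r) \<le> real r"
  unfolding gauss_sum_def by (rule order_trans[OF norm_sum]) simp

text \<open>For even r only odd residues are units, at most r/2 of them, which offsets the factor
  gcd(2, r)^2 = 4. The constant 2 in the bound for \<open>C_q\<close> comes from here.\<close>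

lemma card_units_mod_le:
  assumes "r > 0" shows "gcd 2 (int r) ^ 2 * int (card (units_mod r)) \<le> 2 * int r"
proof (cases "even r")
  case True
  then obtain s where s: "r = 2 * s" by blast
  have "units_mod r \<subseteq> (\<lambda>k. 2 * k + 1) ` {0..<int s}"
  proof
    fix a assume a: "a \<in> units_mod r"
    have "odd a"
    proof
      assume "even a"
      moreover have "even (int r)" using True by simp
      moreover have "coprime a (int r)" using a by (simp add: units_mod_def)
      ultimately show False using not_coprimeI[of 2 a "int r"] by simp
    qed
    then obtain k where "a = 2 * k + 1" by (elim oddE)
    then show "a \<in> (\<lambda>k. 2 * k + 1) ` {0..<int s}" using a by (auto simp: units_mod_def s)
  qed
  then have "card (units_mod r) \<le> card ((\<lambda>k. 2 * k + 1) ` {0..<int s})" by (intro card_mono) auto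
  also have "\<dots> \<le> s" using card_image_le[of "{0..<int s}"] by simp
  finally show ?thesis using True by (simp add: s gcd_mult_distrib_int[symmetric, of 2 1, simplified])
next
  case False
  have "card (units_mod r) \<le> card {0..<int r}" by (intro card_mono) (auto simp: units_mod_def)
  moreover have "gcd 2 (int r) = 1" using False by (simp flip: coprime_iff_gcd_eq_1)
  ultimately show ?thesis by simp
qed

text \<open>The trivial bound r for each Gauss sum suffices: gcd(2, r)^2 times the number of units
  is at most 2r, and 2r * r / r^5 = 2/r^3.\<close>

lemma norm_C_q_le: "norm (C_q r) \<le> 2 / real r ^ 3"
proof (cases "r = 0")
  case False
  then have r: "r > 0" by simp
  have "norm (gauss_total r) \<le> (\<Sum>a\<in>units_mod r. real r)"
    unfolding gauss_total_def by (intro sum_norm_le norm_gauss_sum_le)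
  then have "norm (gauss_total r) \<le> real (card (units_mod r)) * real r" by simp
  then have "norm (C_q r) \<le> of_int (gcd 2 (int r)) ^ 2 / real r ^ 5 * (real (card (units_mod r)) * real r)"
    unfolding C_q_eq[OF r] norm_mult norm_divide norm_power
    by (auto intro!: divide_right_mono mult_left_mono)
  also have "\<dots> = of_int (gcd 2 (int r) ^ 2 * int (card (units_mod r))) * (real r / real r ^ 5)" by simp
  also have "\<dots> \<le> of_int (2 * int r) * (real r / real r ^ 5)"
    by (intro mult_right_mono card_units_mod_le[OF r] of_int_le_iff[THEN iffD2]) auto
  also have "\<dots> = 2 / real r ^ 3" using r by (simp add: field_simps eval_nat_numeral)
  finally show ?thesis .
qed simp

text \<open>Complex conjugation replaces a by -a, which permutes the units.\<close>

lemma C_q_real: "C_q r \<in> \<real>"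
proof (cases "r = 0")
  case False
  then have r: "r > 0" by simp
  define neg where "neg = (\<lambda>a. (- a) mod int r)"
  have "cnj (gauss_total r) = (\<Sum>a\<in>units_mod r. gauss_sum (-2) (neg a) r)"
    unfolding gauss_total_def cnj_sum gauss_sum_def
  proof (intro sum.cong refl)
    fix a c
    have "- a = neg a + int r * ((- a) div int r)" by (simp add: neg_def)
    then have "- 2 * (-a) * c\<^sup>2 = - 2 * (neg a + int r * ((- a) div int r)) * c\<^sup>2" by (simp only:)
    also have "\<dots> = -2 * neg a * c\<^sup>2 + int r * (- 2 * ((- a) div int r) * c\<^sup>2)"
      by (simp add: algebra_simps)
    finally have "- 2 * (-a) * c\<^sup>2 = -2 * neg a * c\<^sup>2 + int r * (- 2 * ((- a) div int r) * c\<^sup>2)" .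
    then have "- (of_int (-2 * a * c\<^sup>2) / real r) = of_int (-2 * neg a * c\<^sup>2 + int r * (- 2 * ((- a) div int r) * c\<^sup>2)) / real r"
      by (simp only: minus_divide_left of_int_minus[symmetric]) simp
    also have "\<dots> = of_int (-2 * neg a * c\<^sup>2) / real r + of_int (- 2 * ((- a) div int r) * c\<^sup>2)"
      unfolding of_int_add add_divide_distrib of_int_mult[of "int r"] using r by simp
    finally show "cnj (e_fun (of_int (-2 * a * c\<^sup>2) / real r)) = e_fun (of_int (-2 * neg a * c\<^sup>2) / real r)"
      by (simp only: e_fun_minus[symmetric] e_fun_add_of_int)
  qed
  also have "\<dots> = (\<Sum>a\<in>units_mod r. gauss_sum (-2) a r)"
  proof (rule sum.reindex_bij_witness[of _ neg neg])
    fix a assume a: "a \<in> units_mod r"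
    have "coprime (neg a) (int r)" using a by (simp add: units_mod_def neg_def)
    then show "neg a \<in> units_mod r" "neg a \<in> units_mod r" using r by (simp_all add: units_mod_def neg_def)
    show "neg (neg a) = a" "neg (neg a) = a" using a by (simp_all add: neg_def mod_minus_eq units_mod_def)
  qed simp
  finally have "cnj (gauss_total r) = gauss_total r" by (simp add: gauss_total_def)
  then have "gauss_total r \<in> \<real>" by (simp add: Reals_cnj_iff)
  then show ?thesis unfolding C_q_eq[OF r] by (intro Reals_mult Reals_divide Reals_power) auto
qed simp

section \<open>Multiplicativity of the local sums\<close>

text \<open>The fraction with denominator rs is a/r + b/s, so the summand at z is a function of z
  modulo r times a function of z modulo s. Pairs of residues are matched with z by the Chinese
  remainder theorem, with ur + vs = 1.\<close>

lemma gauss_sum_crt: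
  assumes "r > 0" "s > 0" "coprime r s"
  shows "gauss_sum l (a * int s + b * int r) (r * s) = gauss_sum l a r * gauss_sum l b s"
proof -
  obtain u v where uv: "u * int r + v * int s = 1"
    using bezout_int[of "int r" "int s"] assms(3) by (auto simp: coprime_iff_gcd_eq_1)
  have vs: "v * int s = 1 - u * int r" and ur: "u * int r = 1 - v * int s" using uv by linarith+
  have z1: "c * (v * int s) + d * (u * int r) = c + int r * (d * u - c * u)" for c d
    unfolding vs by (simp add: algebra_simps)
  have z2: "c * (v * int s) + d * (u * int r) = d + int s * (c * v - d * v)" for c d
    unfolding ur by (simp add: algebra_simps)
  define f where "f = (\<lambda>r a c. e_fun (of_int (l * a * c\<^sup>2) / real r))"
  have per: "f r a (x mod int r) = f r a x" if "r > 0" for r a x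
  proof -
    have "int r dvd l * a * x\<^sup>2 - l * a * (x mod int r)\<^sup>2"
      by (metis mod_eq_dvd_iff mod_mult_right_eq power_mod)
    then obtain k where "l * a * x\<^sup>2 = l * a * (x mod int r)\<^sup>2 + int r * k"
      by (metis dvd_def add.commute diff_add_cancel)
    then have "of_int (l * a * x\<^sup>2) / real r = of_int (l * a * (x mod int r)\<^sup>2) / real r + of_int k"
      using that by (simp add: add_divide_distrib)
    then show ?thesis unfolding f_def by (simp only: e_fun_add_of_int)
  qed
  have mult: "f (r * s) (a * int s + b * int r) z = f r a z * f s b z" for z
  proof -
    have "of_int (l * (a * int s + b * int r) * z\<^sup>2) / real (r * s) = of_int (l * a * z\<^sup>2) / real r + of_int (l * b * z\<^sup>2) / real s"
      using assms by (simp add: field_simps)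
    then show ?thesis unfolding f_def by (simp only: e_fun_add)
  qed
  have "gauss_sum l a r * gauss_sum l b s = (\<Sum>(c, d)\<in>{0..<int r} \<times> {0..<int s}. f r a c * f s b d)"
    by (simp add: gauss_sum_def f_def sum_product sum.cartesian_product)
  also have "\<dots> = (\<Sum>z\<in>{0..<int (r * s)}. f (r * s) (a * int s + b * int r) z)"
  proof (rule sum.reindex_bij_witness[where i = "\<lambda>z. (z mod int r, z mod int s)"
        and j = "\<lambda>(c, d). (c * (v * int s) + d * (u * int r)) mod int (r * s)"], goal_cases)
    case (1 x)
    then obtain c d where x: "x = (c, d)" "c \<in> {0..<int r}" "d \<in> {0..<int s}" by auto
    have 1: "(c * (v * int s) + d * (u * int r)) mod int r = c" unfolding z1 using x by simp
    have 2: "(c * (v * int s) + d * (u * int r)) mod int s = d" unfolding z2 using x by simp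
    show ?case using 1 2 x by (simp add: mod_mod_cancel)
  next
    case (2 x)
    then show ?case using assms by auto
  next
    case (3 z)
    have "z = z * (v * int s) + z * (u * int r)" unfolding vs by (simp add: algebra_simps)
    moreover have "int (r * s) dvd z * (v * int s) + z * (u * int r) - ((z mod int r) * (v * int s) + (z mod int s) * (u * int r))"
    proof -
      have "z * (v * int s) + z * (u * int r) - ((z mod int r) * (v * int s) + (z mod int s) * (u * int r))
        = (z - z mod int r) * (v * int s) + (z - z mod int s) * (u * int r)" by (simp add: algebra_simps)
      also have "\<dots> = int (r * s) * ((z div int r) * v + (z div int s) * u)"
        by (simp add: minus_mod_eq_mult_div algebra_simps)
      finally show ?thesis by simp
    qed
    ultimately have "(z mod int r * (v * int s) + z mod int s * (u * int r)) mod int (r * s) = z mod int (r * s)"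
      by (metis mod_eq_dvd_iff)
    then show ?case using 3 by simp
  next
    case (4 z)
    then show ?case using assms by auto
  next
    case (5 x)
    then obtain c d where x: "x = (c, d)" by (cases x)
    define z where "z = c * (v * int s) + d * (u * int r)"
    have rs: "r * s > 0" using assms by simp
    have "z = c + int r * (d * u - c * u)" unfolding z_def by (rule z1)
    then have zr: "z mod int r = c mod int r" by simp
    have "z = d + int s * (c * v - d * v)" unfolding z_def by (rule z2)
    then have "z mod int s = d mod int s" by simp
    note zr this
    then have "f r a z = f r a c" "f s b z = f s b d" using per[OF assms(1)] per[OF assms(2)] by metis+
    then show ?case unfolding x prod.case z_def[symmetric] per[OF rs] mult by simp
  qed
  also have "\<dots> = gauss_sum l (a * int s + b * int r) (r * s)" by (simp add: gauss_sum_def f_def)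
  finally show ?thesis ..
qed

lemma gauss_sum_mod: 
  assumes "r > 0" shows "gauss_sum l (a mod int r) r = gauss_sum l a r"
  unfolding gauss_sum_def
proof (intro sum.cong refl)
  fix c
  have "a = a mod int r + int r * (a div int r)" by simp
  then have "l * a * c\<^sup>2 = l * (a mod int r) * c\<^sup>2 + int r * (l * (a div int r) * c\<^sup>2)"
    by (metis (no_types, opaque_lifting) distrib_left distrib_right mult.assoc mult.left_commute)
  then have "of_int (l * a * c\<^sup>2) / real r = of_int (l * (a mod int r) * c\<^sup>2) / real r + of_int (l * (a div int r) * c\<^sup>2)"
    using assms by (simp add: add_divide_distrib)
  then show "e_fun (of_int (l * (a mod int r) * c\<^sup>2) / real r) = e_fun (of_int (l * a * c\<^sup>2) / real r)"
    by (simp only: e_fun_add_of_int)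
qed

text \<open>Units modulo rs are reached as t = as + br, so that t/(rs) = a/r + b/s. Since vs is 1
  modulo r and ur is 1 modulo s, the inverse map sends t to (tv mod r, tu mod s).\<close>

lemma gauss_total_mult:
  assumes "r > 0" "s > 0" "coprime r s"
  shows "gauss_total (r * s) = gauss_total r * gauss_total s"
proof -
  obtain u v where uv: "u * int r + v * int s = 1"
    using bezout_int[of "int r" "int s"] assms(3) by (auto simp: coprime_iff_gcd_eq_1)
  have vs: "v * int s = 1 - u * int r" and ur: "u * int r = 1 - v * int s" using uv by linarith+
  have rs: "r * s > 0" using assms by simp
  have cv: "coprime v (int r)" "coprime u (int s)"
  proof -
    have "gcd v (int r) dvd u * int r + v * int s" by simp
    then show "coprime v (int r)" unfolding uv by (simp add: coprime_iff_gcd_eq_1)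
    have "gcd u (int s) dvd u * int r + v * int s" by simp
    then show "coprime u (int s)" unfolding uv by (simp add: coprime_iff_gcd_eq_1)
  qed
  have cors: "coprime (int r) (int s)" using assms(3) by simp
  define i where "i = (\<lambda>t::int. ((t * v) mod int r, (t * u) mod int s))"
  define j where "j = (\<lambda>(a, b). (a * int s + b * int r) mod int (r * s))"
  have "gauss_total r * gauss_total s = (\<Sum>(a, b)\<in>units_mod r \<times> units_mod s. gauss_sum (-2) a r * gauss_sum (-2) b s)"
    by (simp add: gauss_total_def sum_product sum.cartesian_product)
  also have "\<dots> = (\<Sum>t\<in>units_mod (r * s). gauss_sum (-2) t (r * s))"
  proof (rule sum.reindex_bij_witness[where i = i and j = j], goal_cases)
    case (1 x)
    then obtain a b where x: "x = (a, b)" "a \<in> {0..<int r}" "b \<in> {0..<int s}" by (auto simp: units_mod_def)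
    define t where "t = a * int s + b * int r"
    have jt: "j x = t mod int (r * s)" by (simp add: j_def x t_def)
    have "t * v = a * (v * int s) + int r * (b * v)" by (simp add: t_def algebra_simps)
    also have "\<dots> = a + int r * (b * v - a * u)" unfolding vs by (simp add: algebra_simps)
    finally have tv: "(t * v) mod int r = a" using x by simp
    have "t * u = b * (u * int r) + int s * (a * u)" by (simp add: t_def algebra_simps)
    also have "\<dots> = b + int s * (a * u - b * v)" unfolding ur by (simp add: algebra_simps)
    finally have tu: "(t * u) mod int s = b" using x by simp
    have "(t mod int (r * s) * v) mod int r = (t * v) mod int r" "(t mod int (r * s) * u) mod int s = (t * u) mod int s"
      by (metis dvd_triv_left dvd_triv_right mod_mod_cancel mod_mult_left_eq of_nat_mult)+
    then show ?case unfolding jt i_def using tv tu x by simp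
  next
    case (2 x)
    then obtain a b where x: "x = (a, b)" "a \<in> units_mod r" "b \<in> units_mod s" by auto
    have "gcd (int r) (b * int r + a * int s) = gcd (int r) (a * int s)" by (rule gcd_add_mult)
    moreover have "coprime (int r) (a * int s)" using x cors by (simp add: units_mod_def coprime_commute)
    ultimately have c1: "coprime (a * int s + b * int r) (int r)"
      by (simp add: coprime_iff_gcd_eq_1 gcd.commute add.commute)
    have "gcd (int s) (a * int s + b * int r) = gcd (int s) (b * int r)" by (rule gcd_add_mult)
    moreover have "coprime (int s) (b * int r)" using x cors by (simp add: units_mod_def coprime_commute)
    ultimately have "coprime (a * int s + b * int r) (int s)"
      by (simp add: coprime_iff_gcd_eq_1 gcd.commute)
    note c1 this
    then have "coprime (a * int s + b * int r) (int (r * s))" by simp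
    then have "coprime ((a * int s + b * int r) mod int (r * s)) (int (r * s))"
      using rs by (simp only: coprime_mod_left_iff of_nat_eq_0_iff)
    then show ?case using rs x by (simp add: units_mod_def j_def del: of_nat_mult coprime_mult_right_iff)
  next
    case (3 t)
    have "int (r * s) dvd t - ((t * v) mod int r * int s + (t * u) mod int s * int r)"
    proof -
      have "t = t * (v * int s) + t * (u * int r)" unfolding vs by (simp add: algebra_simps)
      then have "t - ((t * v) mod int r * int s + (t * u) mod int s * int r)
         = (t * v - (t * v) mod int r) * int s + (t * u - (t * u) mod int s) * int r" by (simp add: algebra_simps)
      also have "\<dots> = int (r * s) * ((t * v) div int r + (t * u) div int s)"
        by (simp add: minus_mod_eq_mult_div algebra_simps)
      finally show ?thesis by simp
    qed
    then have "((t * v) mod int r * int s + (t * u) mod int s * int r) mod int (r * s) = t mod int (r * s)"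
      by (metis mod_eq_dvd_iff)
    then show ?case using 3 by (simp add: i_def j_def units_mod_def)
  next
    case (4 t)
    then have "coprime t (int r)" "coprime t (int s)" by (auto simp: units_mod_def)
    then show ?case using assms cv by (simp add: i_def units_mod_def)
  next
    case (5 x)
    then obtain a b where x: "x = (a, b)" by (cases x)
    show ?case using assms by (simp add: x j_def gauss_sum_crt[symmetric] gauss_sum_mod[OF rs, simplified])
  qed
  finally show ?thesis by (simp add: gauss_total_def)
qed

lemma C_q_mult:
  assumes "coprime r s" shows "C_q (r * s) = C_q r * C_q s"
proof (cases "r = 0 \<or> s = 0")
  case False
  then have rs: "r > 0" "s > 0" "r * s > 0" by auto
  have "gcd 2 (int (r * s)) = gcd 2 (int r) * gcd 2 (int s)"
  proof -
    have g2: "gcd 2 n = (if even n then 2 else 1)" for n :: int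
      by (simp flip: coprime_iff_gcd_eq_1)
    have "\<not> (even r \<and> even s)" using assms by (meson coprime_common_divisor odd_one)
    then show ?thesis by (auto simp: g2)
  qed
  then show ?thesis unfolding C_q_eq[OF rs(1)] C_q_eq[OF rs(2)] C_q_eq[OF rs(3)] gauss_total_mult[OF rs(1,2) assms]
    by (simp add: power_mult_distrib)
qed auto

section \<open>Absolute convergence and positivity\<close>

text \<open>2/x^3 <= 2/((x - 1) x (x + 1)), and summed from x = 2 the right side telescopes to
  exactly 1/2.\<close>

lemma summable_C_q_tail:
  "summable (\<lambda>n. norm (C_q (n + 2)))" "(\<Sum>n. norm (C_q (n + 2))) \<le> 1 / 2"
proof -
  define g where "g = (\<lambda>n::nat. 1 / (real (n + 1) * real (n + 2)))"
  have "g \<longlonglongrightarrow> 0"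
  proof (rule tendsto_sandwich[OF _ _ tendsto_const LIMSEQ_inverse_real_of_nat])
    show "\<forall>\<^sub>F n in sequentially. g n \<le> inverse (real (Suc n))"
      by (intro always_eventually allI) (simp add: g_def divide_simps mult_le_cancel_left1)
  qed (simp add: g_def)
  then have sm: "(\<lambda>n. g n - g (Suc n)) sums (g 0 - 0)" by (rule telescope_sums')
  have le: "norm (C_q (n + 2)) \<le> g n - g (Suc n)" for n
  proof -
    define x where "x = real n + 2"
    have x: "x \<ge> 2" by (simp add: x_def)
    have "norm (C_q (n + 2)) \<le> 2 / x ^ 3" using norm_C_q_le[of "n + 2"] by (simp add: x_def add.commute)
    also have "\<dots> \<le> 2 / ((x - 1) * x * (x + 1))"
      using x by (intro divide_left_mono mult_pos_pos) (auto simp: power3_eq_cube algebra_simps)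
    also have "\<dots> = 1 / ((x - 1) * x) - 1 / (x * (x + 1))" using x by (simp add: divide_simps)
    also have "\<dots> = g n - g (Suc n)" by (simp add: g_def x_def algebra_simps)
    finally show ?thesis .
  qed
  show s: "summable (\<lambda>n. norm (C_q (n + 2)))"
    by (rule summable_comparison_test'[OF sums_summable[OF sm], of 0]) (use le in auto)
  have "(\<Sum>n. norm (C_q (n + 2))) \<le> (\<Sum>n. g n - g (Suc n))"
    by (intro suminf_le le s sums_summable[OF sm])
  also have "\<dots> = 1 / 2" using sums_unique[OF sm] by (simp add: g_def)
  finally show "(\<Sum>n. norm (C_q (n + 2))) \<le> 1 / 2" .
qed

lemma summable_norm_C_q: "summable (\<lambda>r. norm (C_q r))"
  using summable_C_q_tail(1) by (subst (asm) summable_iff_shift)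

lemma C_q_abs_summable: "(\<lambda>r. norm (C_q r)) summable_on S"
  by (rule summable_on_subset[of _ UNIV, OF _ subset_UNIV] summable_on_subset_banach[of _ UNIV, OF _ subset_UNIV])
    (simp add: summable_on_UNIV_nonneg_real_iff summable_norm_C_q)

lemma C_q_summable: "C_q summable_on S"
  by (rule abs_summable_summable[OF C_q_abs_summable])

lemma infsum_C_q_bound:
  assumes "S \<inter> {..<2} = {}" shows "norm (infsum C_q S) \<le> 1 / 2"
proof -
  have "norm (infsum C_q S) \<le> infsum (\<lambda>r. norm (C_q r)) S"
    by (rule norm_infsum_bound[OF C_q_abs_summable])
  also have "\<dots> \<le> infsum (\<lambda>r. norm (C_q r)) {2..}"
    using assms by (intro infsum_mono_neutral C_q_abs_summable) (auto simp: not_less disjoint_iff)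
  also have "\<dots> = infsum (\<lambda>n. norm (C_q (n + 2))) UNIV"
    by (rule infsum_reindex_bij_witness[of _ "\<lambda>n. n + 2" "\<lambda>n. n - 2"])
      (auto simp: numeral_2_eq_2 Suc_diff_Suc Suc_le_eq)
  also have "\<dots> = (\<Sum>n. norm (C_q (n + 2)))"
    using summable_C_q_tail(1) by (intro infsumI norm_summable_imp_has_sum) (auto simp: summable_sums)
  also have "\<dots> \<le> 1 / 2" by (rule summable_C_q_tail(2))
  finally show ?thesis .
qed

text \<open>For an arbitrary index set, so that the full series and the series over the powers of
  one prime are both instances: the term 1 outweighs all others.\<close>

lemma infsum_C_q_props:
  assumes "1 \<in> S" "0 \<notin> S"
  shows "infsum C_q S \<in> \<real>" "Re (infsum C_q S) \<ge> 1 / 2"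
proof -
  have "infsum C_q S = infsum (\<lambda>r. of_real (Re (C_q r))) S"
    using C_q_real by (intro infsum_cong) auto
  also have "\<dots> = of_real (infsum (\<lambda>r. Re (C_q r)) S)"
  proof (rule infsumI, rule has_sum_of_real, rule has_sum_infsum)
    have "(\<lambda>r. norm (Re (C_q r))) summable_on S"
      by (rule summable_on_comparison_test[OF C_q_abs_summable]) (auto simp: abs_Re_le_cmod)
    then show "(\<lambda>r. Re (C_q r)) summable_on S" by (rule abs_summable_summable)
  qed
  finally show "infsum C_q S \<in> \<real>" by simp
  have "S = insert 1 (S - {1})" using assms by auto
  then have "infsum C_q S = infsum C_q (insert 1 (S - {1}))" by simp
  also have "\<dots> = C_q 1 + infsum C_q (S - {1})" by (rule infsum_insert[OF C_q_summable]) auto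
  finally have eq: "infsum C_q S = 1 + infsum C_q (S - {1})" by simp
  have "norm (infsum C_q (S - {1})) \<le> 1 / 2"
  proof (rule infsum_C_q_bound)
    have "x \<ge> 2" if "x \<in> S - {1}" for x using that assms(2) by (cases "x = 0") auto
    then show "(S - {1}) \<inter> {..<2} = {}" by fastforce
  qed
  then show "Re (infsum C_q S) \<ge> 1 / 2" unfolding eq using abs_Re_le_cmod[of "infsum C_q (S - {1})"] by simp
qed

lemma sing_series_eq: "sing_series = infsum C_q {0<..}"
proof -
  have "infsum C_q {0<..} = infsum (\<lambda>n. C_q (Suc n)) UNIV"
    by (rule infsum_reindex_bij_witness[of _ Suc "\<lambda>n. n - 1"]) auto
  also have "\<dots> = (\<Sum>n. C_q (Suc n))"
  proof -
    have "summable (\<lambda>n. norm (C_q (Suc n)))"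
      using summable_norm_C_q by (subst summable_Suc_iff)
    then show ?thesis by (intro infsumI norm_summable_imp_has_sum summable_sums) (auto dest: summable_norm_cancel)
  qed
  finally show ?thesis by (simp add: sing_series_def)
qed

lemma inj_power_prime: "prime p \<Longrightarrow> inj (\<lambda>l::nat. (p::nat) ^ l)"
  using prime_gt_1_nat[of p] by (auto simp: inj_on_def)

lemma summable_C_q_prime_powers:
  assumes "prime p" shows "summable (\<lambda>l. norm (C_q (p ^ l)))"
proof -
  have "(\<lambda>r. norm (C_q r)) summable_on range (\<lambda>l. p ^ l)" by (rule C_q_abs_summable)
  then have "((\<lambda>r. norm (C_q r)) \<circ> (\<lambda>l. p ^ l)) summable_on UNIV"
    by (subst (asm) summable_on_reindex[OF inj_power_prime[OF assms]])
  then show ?thesis by (simp add: o_def summable_on_UNIV_nonneg_real_iff)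
qed

lemma sing_series_at_eq:
  assumes "prime p" shows "sing_series_at p = infsum C_q (range (\<lambda>l. p ^ l))"
proof -
  have "infsum C_q (range (\<lambda>l. p ^ l)) = infsum (\<lambda>l. C_q (p ^ l)) UNIV"
    by (subst infsum_reindex[OF inj_power_prime[OF assms]]) (simp add: o_def)
  also have "\<dots> = (\<Sum>l. C_q (p ^ l))"
    using summable_C_q_prime_powers[OF assms]
    by (intro infsumI norm_summable_imp_has_sum summable_sums) (auto dest: summable_norm_cancel)
  finally show ?thesis by (simp add: sing_series_at_def)
qed

lemma sing_series_props: "sing_series \<in> \<real>" "0 < Re sing_series"
  using infsum_C_q_props[of "{0<..}"] by (auto simp: sing_series_eq)

lemma sing_series_at_props:
  assumes "prime p" shows "sing_series_at p \<in> \<real>" "0 < Re (sing_series_at p)"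
proof -
  have "1 \<in> range (\<lambda>l. p ^ l)" by (rule range_eqI[of _ _ 0]) simp
  moreover have "0 \<notin> range (\<lambda>l. p ^ l)" using assms by auto
  ultimately show "sing_series_at p \<in> \<real>" "0 < Re (sing_series_at p)"
    using infsum_C_q_props[of "range (\<lambda>l. p ^ l)"] by (auto simp: sing_series_at_eq[OF assms])
qed

section \<open>Removal of finitely many Euler factors\<close>

definition free_of :: "nat set \<Rightarrow> nat set" where
  "free_of P = {r. r > 0 \<and> (\<forall>p\<in>P. \<not> p dvd r)}"

text \<open>An element of \<open>free_of P\<close> is uniquely p^l s with s also prime to p, and
  \<open>C_q\<close> is multiplicative on such products; absolute summability turns the double
  series into a product. Removing one prime at a time avoids infinite Euler products.\<close>

lemma infsum_C_q_remove_prime: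
  assumes p: "prime p" "p \<notin> P" and P: "\<And>q. q \<in> P \<Longrightarrow> prime q"
  shows "infsum C_q (free_of P) = sing_series_at p * infsum C_q (free_of (insert p P))"
proof -
  define S where "S = free_of (insert p P)"
  define h where "h = (\<lambda>(l::nat, r). p ^ l * r)"
  have Sr: "r > 0" "\<not> p dvd r" if "r \<in> S" for r using that by (auto simp: S_def free_of_def)
  have mult: "multiplicity p (p ^ l * r) = l" if "r \<in> S" for l r
    using Sr[OF that] p(1) by (simp add: prime_elem_multiplicity_mult_distrib multiplicity_same_power not_dvd_imp_multiplicity_0)
  have inj: "inj_on h (UNIV \<times> S)"
  proof (rule inj_onI, clarify)
    fix l r k s assume rs: "r \<in> S" "s \<in> S" and eq: "h (l, r) = h (k, s)"
    then have "multiplicity p (p ^ l * r) = multiplicity p (p ^ k * s)" by (simp add: h_def)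
    then have "l = k" using rs by (simp add: mult)
    then show "l = k \<and> r = s" using eq p(1) by (auto simp: h_def)
  qed
  have img: "h ` (UNIV \<times> S) = free_of P"
  proof (intro set_eqI iffI)
    fix x assume "x \<in> h ` (UNIV \<times> S)"
    then obtain l r where x: "x = p ^ l * r" "r \<in> S" by (auto simp: h_def)
    have "\<not> q dvd p ^ l * r" if "q \<in> P" for q
    proof
      assume "q dvd p ^ l * r"
      then have "q dvd p ^ l \<or> q dvd r" using P[OF that] by (simp add: prime_dvd_mult_iff)
      moreover have "\<not> q dvd r" using x(2) that by (auto simp: S_def free_of_def)
      ultimately have "q dvd p" using P[OF that] prime_dvd_power by blast
      then have "q = p" using P[OF that] p(1) by (simp add: primes_dvd_imp_eq)
      then show False using that p(2) by simp
    qed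
    then show "x \<in> free_of P" using x Sr[OF x(2)] p(1) by (auto simp: free_of_def prime_gt_0_nat)
  next
    fix x assume x: "x \<in> free_of P"
    then have x0: "x \<noteq> 0" by (simp add: free_of_def)
    obtain r where r: "x = p ^ multiplicity p x * r" "\<not> p dvd r"
      using multiplicity_decompose'[of x p] x0 p(1) not_prime_unit by metis
    have "\<not> q dvd r" if "q \<in> P" for q
    proof
      assume "q dvd r"
      then have "q dvd x" by (subst r(1)) (rule dvd_mult)
      then show False using x that by (auto simp: free_of_def)
    qed
    moreover have "r > 0" using r(1) x0 by (metis gr0I mult_0_right)
    ultimately have "r \<in> S" using r(2) unfolding S_def free_of_def by auto
    then show "x \<in> h ` (UNIV \<times> S)" using r(1) by (intro image_eqI[of _ _ "(multiplicity p x, r)"]) (auto simp: h_def)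
  qed
  have Ch: "C_q (h (l, r)) = C_q (p ^ l) * C_q r" if "r \<in> S" for l r
  proof -
    have "coprime p r" using p(1) Sr[OF that] by (simp add: prime_imp_coprime)
    then show ?thesis unfolding h_def by (simp add: C_q_mult)
  qed
  have "C_q summable_on h ` (UNIV \<times> S)" by (rule C_q_summable)
  then have "(C_q \<circ> h) summable_on (UNIV \<times> S)" by (subst (asm) summable_on_reindex[OF inj])
  then have sm: "(\<lambda>(l, r). C_q (h (l, r))) summable_on (UNIV \<times> S)"
    by (rule summable_on_cong[THEN iffD1, rotated]) auto
  have "infsum C_q (free_of P) = infsum (C_q \<circ> h) (UNIV \<times> S)"
    unfolding img[symmetric] by (rule infsum_reindex[OF inj])
  also have "\<dots> = infsum (\<lambda>(l, r). C_q (h (l, r))) (UNIV \<times> S)" by (intro infsum_cong) auto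
  also have "\<dots> = infsum (\<lambda>l. infsum (\<lambda>r. C_q (h (l, r))) S) UNIV"
    by (rule infsum_Sigma'_banach[OF sm, symmetric])
  also have "\<dots> = infsum (\<lambda>l. C_q (p ^ l) * infsum C_q S) UNIV"
    by (intro infsum_cong) (simp add: Ch infsum_cmult_right' cong: infsum_cong)
  also have "\<dots> = infsum (\<lambda>l. C_q (p ^ l)) UNIV * infsum C_q S" by (rule infsum_cmult_left')
  also have "infsum (\<lambda>l. C_q (p ^ l)) UNIV = sing_series_at p"
    unfolding sing_series_at_eq[OF p(1)] by (subst infsum_reindex[OF inj_power_prime[OF p(1)]]) (simp add: o_def)
  finally show ?thesis by (simp add: S_def)
qed

lemma sing_series_euler:
  assumes "finite P" "\<And>p. p \<in> P \<Longrightarrow> prime p"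
  shows "sing_series = (\<Prod>p\<in>P. sing_series_at p) * infsum C_q (free_of P)"
  using assms
proof (induction P rule: finite_induct)
  case empty
  have "free_of {} = {0<..}" by (auto simp: free_of_def)
  then show ?case by (simp add: sing_series_eq)
next
  case (insert p P)
  then show ?case using infsum_C_q_remove_prime[of p P] by (simp add: mult_ac)
qed

text \<open>This is the meaning of the local factors in the main term: dividing by them leaves the
  subseries that the arcs actually produce. The division is legitimate because each local series has
  positive real part.\<close>

lemma sing_series_coprime_part:
  assumes "m > 0"
  shows "(\<Prod>p\<in>prime_factors m. inverse (sing_series_at p)) * sing_series = infsum C_q {r. r > 0 \<and> coprime m r}"
proof -
  have eq: "free_of (prime_factors m) = {r. r > 0 \<and> coprime m r}"
  proof (intro set_eqI)
    fix r
    have "(\<forall>p\<in>prime_factors m. \<not> p dvd r) \<longleftrightarrow> coprime m r" if "r > 0"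
    proof
      assume *: "\<forall>p\<in>prime_factors m. \<not> p dvd r"
      show "coprime m r"
      proof (rule ccontr)
        assume "\<not> coprime m r"
        then have "gcd m r \<noteq> 1" by (simp add: coprime_iff_gcd_eq_1)
        then obtain p where "prime p" "p dvd gcd m r" using prime_factor_nat by blast
        then show False using * assms by (auto simp: in_prime_factors_iff)
      qed
    next
      assume "coprime m r"
      then show "\<forall>p\<in>prime_factors m. \<not> p dvd r"
        by (metis coprime_common_divisor in_prime_factors_imp_dvd in_prime_factors_imp_prime not_prime_unit)
    qed
    then show "r \<in> free_of (prime_factors m) \<longleftrightarrow> r \<in> {r. r > 0 \<and> coprime m r}"
      by (auto simp: free_of_def)
  qed
  have nz: "sing_series_at p \<noteq> 0" if "p \<in> prime_factors m" for p
    using sing_series_at_props(2)[of p] that by (auto simp: in_prime_factors_imp_prime)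
  have "sing_series = (\<Prod>p\<in>prime_factors m. sing_series_at p) * infsum C_q {r. r > 0 \<and> coprime m r}"
    using sing_series_euler[of "prime_factors m"] by (simp add: eq in_prime_factors_imp_prime)
  then have "(\<Prod>p\<in>prime_factors m. inverse (sing_series_at p)) * sing_series
     = ((\<Prod>p\<in>prime_factors m. inverse (sing_series_at p)) * (\<Prod>p\<in>prime_factors m. sing_series_at p)) * infsum C_q {r. r > 0 \<and> coprime m r}"
    by (simp add: mult.assoc)
  also have "(\<Prod>p\<in>prime_factors m. inverse (sing_series_at p)) * (\<Prod>p\<in>prime_factors m. sing_series_at p) = 1"
    using nz by (simp add: prod.distrib[symmetric])
  finally show ?thesis by simp
qed

section \<open>The singular integral\<close>

definition box_int :: "(4 \<Rightarrow> 4 \<Rightarrow> real) \<Rightarrow> real \<Rightarrow> complex" where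
  "box_int Y \<theta> = bil_int (Y 1 1) (Y 4 4) (-1 * \<theta>) * bil_int (Y 2 2) (Y 3 3) (-1 * \<theta>)
     * bil_int (Y 1 2) (Y 3 4) (-2 * \<theta>) * bil_int (Y 1 3) (Y 2 4) (-2 * \<theta>) * qseg (Y 1 4) (-2 * \<theta>)"

section \<open>Fubini in the nine coordinates\<close>

interpretation lb: product_sigma_finite "\<lambda>_ :: 4 \<times> 4. lborel :: real measure"
  by standard

text \<open>A product over coordinates instead of the indicator of a set, so that it splits along
  every partition of the index set.\<close>

definition cube :: "(4 \<Rightarrow> 4 \<Rightarrow> real) \<Rightarrow> (4 \<times> 4) set \<Rightarrow> (4 \<times> 4 \<Rightarrow> real) \<Rightarrow> real" where
  "cube Y I b = (\<Prod>(i, j)\<in>I. indicator {- Y i j..Y i j} (b (i, j)))"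

lemma component_measurable:
  "k \<in> I \<Longrightarrow> (\<lambda>b. b k) \<in> borel_measurable (Pi\<^sub>M I (\<lambda>_. lborel :: real measure))"
  using measurable_component_singleton[of k I "\<lambda>_. lborel :: real measure"] by simp

lemma cube_integrable:
  assumes "finite I" "\<phi> \<in> borel_measurable (Pi\<^sub>M I (\<lambda>_. lborel))" "\<And>b. norm (\<phi> b) \<le> (1::real)"
  shows "integrable (Pi\<^sub>M I (\<lambda>_. lborel)) (\<lambda>b. cube Y I b *\<^sub>R (\<phi> b :: complex))"
proof (rule Bochner_Integration.integrable_bound)
  have c: "integrable (Pi\<^sub>M I (\<lambda>_. lborel)) (\<lambda>b. \<Prod>k\<in>I. (\<lambda>k t. indicator {- Y (fst k) (snd k)..Y (fst k) (snd k)} t :: real) k (b k))"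
    by (rule lb.product_integrable_prod[OF assms(1)]) (simp add: integrable_indicator_iff emeasure_lborel_Icc_eq)
  then show 1: "integrable (Pi\<^sub>M I (\<lambda>_. lborel)) (cube Y I)"
    unfolding cube_def by (simp add: case_prod_unfold)
  show "(\<lambda>b. cube Y I b *\<^sub>R \<phi> b) \<in> borel_measurable (Pi\<^sub>M I (\<lambda>_. lborel))"
    using borel_measurable_integrable[OF 1] assms(2) by measurable
  show "AE b in Pi\<^sub>M I (\<lambda>_. lborel). norm (cube Y I b *\<^sub>R \<phi> b) \<le> norm (cube Y I b)"
    using assms(3) by (intro AE_I2) (simp add: mult_left_le)
qed

text \<open>The assumptions on \<open>merge\<close> express that \<open>\<phi>\<close> depends only
  on the coordinates in I and \<open>\<psi>\<close> only on those in J; then Fubini applies.\<close>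

lemma cube_integral_split:
  assumes fin: "finite I" "finite J" and dis: "I \<inter> J = {}"
    and meas: "\<phi> \<in> borel_measurable (Pi\<^sub>M (I \<union> J) (\<lambda>_. lborel))" "\<psi> \<in> borel_measurable (Pi\<^sub>M (I \<union> J) (\<lambda>_. lborel))"
    and bd: "\<And>b. norm (\<phi> b) \<le> (1::real)" "\<And>b. norm (\<psi> b) \<le> (1::real)"
    and mg: "\<And>x y. \<phi> (merge I J (x, y)) = \<phi> x" "\<And>x y. \<psi> (merge I J (x, y)) = \<psi> y"
  shows "(LINT b|Pi\<^sub>M (I \<union> J) (\<lambda>_. lborel). cube Y (I \<union> J) b *\<^sub>R (\<phi> b * \<psi> b :: complex))
     = (LINT b|Pi\<^sub>M I (\<lambda>_. lborel). cube Y I b *\<^sub>R \<phi> b) * (LINT b|Pi\<^sub>M J (\<lambda>_. lborel). cube Y J b *\<^sub>R \<psi> b)"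
proof -
  have cm: "cube Y (I \<union> J) (merge I J (x, y)) = cube Y I x * cube Y J y" for x y
  proof -
    have "cube Y (I \<union> J) (merge I J (x, y)) = (\<Prod>(i, j)\<in>I. indicator {- Y i j..Y i j} (merge I J (x, y) (i, j)))
       * (\<Prod>(i, j)\<in>J. indicator {- Y i j..Y i j} (merge I J (x, y) (i, j)))"
      unfolding cube_def by (rule prod.union_disjoint[OF fin dis])
    also have "\<dots> = cube Y I x * cube Y J y"
      unfolding cube_def using dis by (intro arg_cong2[of _ _ _ _ "(*)"] prod.cong refl) (auto simp: merge_def)
    finally show ?thesis .
  qed
  have "integrable (Pi\<^sub>M (I \<union> J) (\<lambda>_. lborel)) (\<lambda>b. cube Y (I \<union> J) b *\<^sub>R (\<phi> b * \<psi> b))"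
    using fin meas bd by (intro cube_integrable) (auto simp: norm_mult intro: mult_le_one)
  from lb.product_integral_fold[OF dis fin this]
  have "(LINT b|Pi\<^sub>M (I \<union> J) (\<lambda>_. lborel). cube Y (I \<union> J) b *\<^sub>R (\<phi> b * \<psi> b))
    = (LINT x|Pi\<^sub>M I (\<lambda>_. lborel). LINT y|Pi\<^sub>M J (\<lambda>_. lborel). (cube Y I x *\<^sub>R \<phi> x) * (cube Y J y *\<^sub>R \<psi> y))"
    unfolding cm mg by (simp only: mult_scaleR_left mult_scaleR_right scaleR_scaleR mult.commute[of "cube Y J _"])
  also have "\<dots> = (LINT b|Pi\<^sub>M I (\<lambda>_. lborel). cube Y I b *\<^sub>R \<phi> b) * (LINT b|Pi\<^sub>M J (\<lambda>_. lborel). cube Y J b *\<^sub>R \<psi> b)"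
    by (simp only: integral_mult_right_zero integral_mult_left_zero)
  finally show ?thesis .
qed

lemma cube_integral_pair:
  assumes "p \<noteq> q"
  shows "(LINT b|Pi\<^sub>M {q, p} (\<lambda>_. lborel). cube Y {q, p} b *\<^sub>R e_fun (c * b p * b q))
     = bil_int (Y (fst p) (snd p)) (Y (fst q) (snd q)) c"
proof -
  have m: "(\<lambda>b. e_fun (c * b p * b q)) \<in> borel_measurable (Pi\<^sub>M {q, p} (\<lambda>_. lborel))"
    using component_measurable[of p "{q, p}"] component_measurable[of q "{q, p}"] by measurable
  have int: "integrable (Pi\<^sub>M (insert q {p}) (\<lambda>_. lborel)) (\<lambda>b. cube Y {q, p} b *\<^sub>R e_fun (c * b p * b q))"
    using m by (intro cube_integrable) auto
  have "(LINT b|Pi\<^sub>M {q, p} (\<lambda>_. lborel). cube Y {q, p} b *\<^sub>R e_fun (c * b p * b q))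
    = (LINT x|Pi\<^sub>M {p} (\<lambda>_. lborel). LINT y|lborel. cube Y {q, p} (x(q := y)) *\<^sub>R e_fun (c * (x(q := y)) p * (x(q := y)) q))"
    using lb.product_integral_insert[OF _ _ int] assms by simp
  also have "\<dots> = (LINT x|Pi\<^sub>M {p} (\<lambda>_. lborel). (\<lambda>t. indicator {- Y (fst p) (snd p)..Y (fst p) (snd p)} t *\<^sub>R seg (Y (fst q) (snd q)) (c * t)) (x p))"
  proof (intro Bochner_Integration.integral_cong refl)
    fix x :: "4 \<times> 4 \<Rightarrow> real"
    have "cube Y {q, p} (x(q := y)) *\<^sub>R e_fun (c * (x(q := y)) p * (x(q := y)) q)
      = indicator {- Y (fst p) (snd p)..Y (fst p) (snd p)} (x p) *\<^sub>R
         (indicator {- Y (fst q) (snd q)..Y (fst q) (snd q)} y *\<^sub>R e_fun ((c * x p) * y))" for y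
      using assms unfolding cube_def by (simp add: case_prod_unfold mult.commute)
    then show "(LINT y|lborel. cube Y {q, p} (x(q := y)) *\<^sub>R e_fun (c * (x(q := y)) p * (x(q := y)) q))
      = (\<lambda>t. indicator {- Y (fst p) (snd p)..Y (fst p) (snd p)} t *\<^sub>R seg (Y (fst q) (snd q)) (c * t)) (x p)"
      unfolding seg_def set_lebesgue_integral_def by (simp only: integral_scaleR_right)
  qed
  also have "\<dots> = (LINT t|lborel. indicator {- Y (fst p) (snd p)..Y (fst p) (snd p)} t *\<^sub>R seg (Y (fst q) (snd q)) (c * t))"
  proof (rule lb.product_integral_singleton)
    have "seg (Y (fst q) (snd q)) \<in> borel_measurable borel"
      unfolding seg_def set_lebesgue_integral_def by measurable
    then show "(\<lambda>t. indicator {- Y (fst p) (snd p)..Y (fst p) (snd p)} t *\<^sub>R seg (Y (fst q) (snd q)) (c * t)) \<in> borel_measurable lborel"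
      by measurable
  qed
  finally show ?thesis by (simp add: bil_int_def set_lebesgue_integral_def)
qed

lemma cube_integral_single:
  "(LINT b|Pi\<^sub>M {p} (\<lambda>_. lborel). cube Y {p} b *\<^sub>R e_fun (c * (b p)\<^sup>2)) = qseg (Y (fst p) (snd p)) c"
proof -
  have "(LINT b|Pi\<^sub>M {p} (\<lambda>_. lborel). cube Y {p} b *\<^sub>R e_fun (c * (b p)\<^sup>2))
    = (LINT b|Pi\<^sub>M {p} (\<lambda>_. lborel). (\<lambda>t. indicator {- Y (fst p) (snd p)..Y (fst p) (snd p)} t *\<^sub>R e_fun (c * t\<^sup>2)) (b p))"
    by (simp add: cube_def case_prod_unfold)
  also have "\<dots> = qseg (Y (fst p) (snd p)) c"
    unfolding qseg_def set_lebesgue_integral_def by (rule lb.product_integral_singleton) simp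
  finally show ?thesis .
qed

lemma closed_coord_box: "closed (coord_box Y)"
proof -
  have "coord_box Y = {B. (\<forall>i j. B $ j $ i = B $ i $ j) \<and> B $ 2 $ 3 = - (B $ 1 $ 4) \<and> (\<forall>p. p \<in> coords \<longrightarrow> \<bar>B $ fst p $ snd p\<bar> \<le> Y (fst p) (snd p))}"
    unfolding coord_box_def V_def transpose_def by (auto simp: vec_eq_iff)
  also have "closed \<dots>"
    by (intro closed_Collect_conj closed_Collect_all closed_Collect_imp closed_Collect_eq closed_Collect_le continuous_intros open_Collect_const)
  finally show ?thesis .
qed

lemma set_integral_coord_box:
  "set_lebesgue_integral lebesgue_V (coord_box Y) (\<lambda>B. e_fun (\<theta> * quad_q B)) = box_int Y \<theta>"
proof -
  define M where "M = (\<lambda>_ :: 4 \<times> 4. lborel :: real measure)"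
  \<comment> \<open>The bracketing gives one block per factor of \<open>box_int\<close>, so that
    each use of the splitting lemma peels off the last factor. In a pair, the coordinate listed
    first becomes the inner integration variable.\<close>
  have coords: "coords = ((({(4,4), (1,1)} \<union> {(3,3), (2,2)}) \<union> {(3,4), (1,2)}) \<union> {(2,4), (1,3)}) \<union> {(1,4)}"
    by (auto simp: coords_def)
  have fin: "finite coords" by (simp add: coords_def)
  have meas: "(\<lambda>B. indicator (coord_box Y) B *\<^sub>R e_fun (\<theta> * quad_q B)) \<in> borel_measurable borel"
  proof (rule borel_measurable_scaleR)
    show "indicator (coord_box Y) \<in> borel_measurable borel"
      using closed_coord_box[of Y] by (intro borel_measurable_indicator) auto
    show "(\<lambda>B::real^4^4. e_fun (\<theta> * quad_q B)) \<in> borel_measurable borel"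
      unfolding quad_q_def by (intro borel_measurable_continuous_onI continuous_intros)
  qed
  have ind: "indicator (coord_box Y) (of_coords b) = cube Y coords b" for b
  proof -
    have "of_coords b \<in> coord_box Y \<longleftrightarrow> (\<forall>(i, j)\<in>coords. b (i, j) \<in> {- Y i j..Y i j})"
      unfolding coord_box_def using of_coords_in_V[of b] of_coords_nth[of _ _ b] by (auto simp: abs_le_iff)
    moreover have "cube Y coords b = (if \<forall>(i, j)\<in>coords. b (i, j) \<in> {- Y i j..Y i j} then 1 else 0)"
    proof (cases "\<forall>(i, j)\<in>coords. b (i, j) \<in> {- Y i j..Y i j}")
      case True
      then have "cube Y coords b = 1" unfolding cube_def by (intro prod.neutral) auto
      then show ?thesis using True by simp
    next
      case False
      then obtain i j where "(i, j) \<in> coords" "b (i, j) \<notin> {- Y i j..Y i j}" by auto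
      then have "cube Y coords b = 0" unfolding cube_def using fin by (intro prod_zero) (auto intro!: bexI[of _ "(i, j)"])
      then show ?thesis using False by simp
    qed
    ultimately show ?thesis by (simp add: indicator_def)
  qed
  have q: "e_fun (\<theta> * quad_q (of_coords b)) = (((e_fun ((-1 * \<theta>) * b (1,1) * b (4,4)) * e_fun ((-1 * \<theta>) * b (2,2) * b (3,3)))
      * e_fun ((-2 * \<theta>) * b (1,2) * b (3,4))) * e_fun ((-2 * \<theta>) * b (1,3) * b (2,4))) * e_fun ((-2 * \<theta>) * (b (1,4))\<^sup>2)" for b
    unfolding e_fun_add[symmetric] quad_q_def by (rule arg_cong[of _ _ e_fun]) (simp add: of_coords_def coords_def algebra_simps)
  have cm: "(\<lambda>b. b k) \<in> borel_measurable (Pi\<^sub>M I M)" if "k \<in> I" for k I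
    using component_measurable[OF that] by (simp add: M_def)
  have "set_lebesgue_integral lebesgue_V (coord_box Y) (\<lambda>B. e_fun (\<theta> * quad_q B))
     = (LINT b|Pi\<^sub>M coords M. cube Y coords b *\<^sub>R e_fun (\<theta> * quad_q (of_coords b)))"
    unfolding set_lebesgue_integral_def lebesgue_V_def M_def
    by (subst integral_distr[OF measurable_of_coords meas]) (simp only: ind)
  also have "\<dots> = box_int Y \<theta>"
    unfolding q box_int_def unfolding coords unfolding M_def
    apply (subst cube_integral_split, simp, simp, simp)
          apply (intro borel_measurable_times measurable_compose[OF _ borel_measurable_e_fun] borel_measurable_const component_measurable borel_measurable_power; simp)+
        apply (simp add: norm_mult, simp)
      apply (simp add: merge_def, simp add: merge_def)
    apply (subst cube_integral_split, simp, simp, simp)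
          apply (intro borel_measurable_times measurable_compose[OF _ borel_measurable_e_fun] borel_measurable_const component_measurable borel_measurable_power; simp)+
        apply (simp add: norm_mult, simp)
      apply (simp add: merge_def, simp add: merge_def)
    apply (subst cube_integral_split, simp, simp, simp)
          apply (intro borel_measurable_times measurable_compose[OF _ borel_measurable_e_fun] borel_measurable_const component_measurable borel_measurable_power; simp)+
        apply (simp add: norm_mult, simp)
      apply (simp add: merge_def, simp add: merge_def)
    apply (subst cube_integral_split, simp, simp, simp)
          apply (intro borel_measurable_times measurable_compose[OF _ borel_measurable_e_fun] borel_measurable_const component_measurable borel_measurable_power; simp)+
        apply (simp, simp)
      apply (simp add: merge_def, simp add: merge_def)
    apply (subst cube_integral_pair, simp)+
    apply (subst cube_integral_single)
    apply simp
    done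
  finally show ?thesis .
qed

lemma sing_integral_eq: "sing_integral (coord_box Y) = (LINT \<theta>|lborel. box_int Y \<theta>)"
  by (simp add: sing_integral_def set_integral_coord_box)

section \<open>An integrable majorant on the real line\<close>

definition kern :: "real \<Rightarrow> real" where
  "kern u = 1 / (1 + \<bar>u\<bar>)\<^sup>2"

lemma kern_nonneg [simp]: "0 \<le> kern u" by (simp add: kern_def)

lemma kern_measurable [measurable]: "kern \<in> borel_measurable borel"
  unfolding kern_def by measurable

text \<open>The fourth power of \<open>wt\<close> is (1 + u)^(-3), with one factor 1 + u to spare
  for the error of the quadratic sum; the third power (1 + u)^(-9/4) is already below (1 +
  u)^(-2).\<close>

lemma wt_pow4: "u \<ge> 0 \<Longrightarrow> wt u ^ 4 * (1 + u) = kern u" "u \<ge> 0 \<Longrightarrow> wt u ^ 4 \<le> kern u" "u \<ge> 0 \<Longrightarrow> wt u ^ 3 \<le> kern u"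
proof -
  assume u: "u \<ge> 0"
  have "wt u ^ 4 = (1 + u) powr (-3)" using u by (simp add: wt_def powr_powr flip: powr_numeral)
  also have "\<dots> = 1 / (1 + u) ^ 3" using u by (simp add: powr_minus field_simps)
  finally have 4: "wt u ^ 4 = 1 / (1 + u) ^ 3" .
  then show "wt u ^ 4 * (1 + u) = kern u" using u by (simp add: kern_def eval_nat_numeral)
  have "wt u ^ 4 * 1 \<le> wt u ^ 4 * (1 + u)" using u by (intro mult_left_mono) auto
  then show "wt u ^ 4 \<le> kern u" using \<open>wt u ^ 4 * (1 + u) = kern u\<close> by simp
  have "wt u ^ 3 = (1 + u) powr (-9/4)" using u by (simp add: wt_def powr_powr flip: powr_numeral)
  also have "\<dots> \<le> (1 + u) powr (-2)" using u by (intro powr_mono) auto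
  also have "\<dots> = kern u" using u by (simp add: kern_def powr_minus field_simps)
  finally show "wt u ^ 3 \<le> kern u" .
qed

text \<open>An explicit primitive on one half-line and reflection for the other. For \<eta> = 0 the
  closed half-lines overlap in 0, which is harmless for an upper bound, and the integral over the
  whole line results.\<close>

lemma nn_integral_kern_tail:
  assumes "c > 0" "\<eta> \<ge> 0"
  shows "(\<integral>\<^sup>+x. ennreal (kern (c * x)) * indicator {x. \<eta> \<le> \<bar>x\<bar>} x \<partial>lborel) \<le> ennreal (2 / (c * (1 + c * \<eta>)))"
proof -
  define F where "F = (\<lambda>x. - (1 / (c * (1 + c * x))))"
  have F': "F = (\<lambda>x. - (inverse (1 + c * x) / c))" by (simp add: F_def divide_inverse fun_eq_iff mult.commute)
  have nn: "(\<integral>\<^sup>+x. ennreal (kern (c * x)) * indicator {\<eta>..} x \<partial>lborel) = ennreal (0 - F \<eta>)"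
  proof (rule nn_integral_FTC_atLeast)
    show "(\<lambda>x. kern (c * x)) \<in> borel_measurable borel" by measurable
    fix x assume "\<eta> \<le> x"
    then have x: "0 \<le> c * x" using assms by simp
    have "1 + c * x \<noteq> 0" using x by linarith
    then show "(F has_real_derivative kern (c * x)) (at x)"
      using assms(1) x unfolding F'
      by (auto intro!: derivative_eq_intros simp: kern_def power2_eq_square inverse_eq_divide)
    show "0 \<le> kern (c * x)" by simp
  next
    have "LIM x at_top. c * (1 + c * x) :> at_top"
      using assms by (intro filterlim_tendsto_pos_mult_at_top[OF tendsto_const] filterlim_tendsto_add_at_top[OF tendsto_const] filterlim_ident) auto
    then show "(F \<longlongrightarrow> 0) at_top"
      unfolding F_def using tendsto_minus[OF tendsto_divide_0[OF tendsto_const filterlim_at_top_imp_at_infinity]] by fastforce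
  qed
  have neg: "(\<integral>\<^sup>+x. ennreal (kern (c * x)) * indicator {..-\<eta>} x \<partial>lborel) = (\<integral>\<^sup>+x. ennreal (kern (c * x)) * indicator {\<eta>..} x \<partial>lborel)"
  proof -
    have "(\<integral>\<^sup>+x. ennreal (kern (c * x)) * indicator {..-\<eta>} x \<partial>lborel)
      = (\<integral>\<^sup>+x. ennreal (kern (c * x)) * indicator {..-\<eta>} x \<partial>distr lborel borel uminus)"
      by (simp add: lborel_distr_uminus)
    also have "\<dots> = (\<integral>\<^sup>+x. ennreal (kern (c * - x)) * indicator {..-\<eta>} (- x) \<partial>lborel)"
      by (subst nn_integral_distr) auto
    also have "\<dots> = (\<integral>\<^sup>+x. ennreal (kern (c * x)) * indicator {\<eta>..} x \<partial>lborel)"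
      by (intro nn_integral_cong) (simp add: kern_def indicator_def)
    finally show ?thesis .
  qed
  have "(\<integral>\<^sup>+x. ennreal (kern (c * x)) * indicator {x. \<eta> \<le> \<bar>x\<bar>} x \<partial>lborel)
    \<le> (\<integral>\<^sup>+x. ennreal (kern (c * x)) * indicator {\<eta>..} x + ennreal (kern (c * x)) * indicator {..-\<eta>} x \<partial>lborel)"
    by (intro nn_integral_mono) (auto simp: indicator_def)
  also have "\<dots> = ennreal (0 - F \<eta>) + ennreal (0 - F \<eta>)"
    by (subst nn_integral_add) (auto simp: nn neg)
  also have "\<dots> = ennreal (2 / (c * (1 + c * \<eta>)))"
    using assms by (simp add: F_def flip: ennreal_plus)
  finally show ?thesis .
qed

lemma integrable_kern: "c > 0 \<Longrightarrow> integrable lborel (\<lambda>x. kern (c * x))"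
  using nn_integral_kern_tail[of c 0]
  by (intro integrableI_nonneg) (auto intro: le_less_trans)

lemma integral_kern_tail:
  assumes "c > 0" "\<eta> \<ge> 0"
  shows "(LINT x|lborel. kern (c * x) * indicator {x. \<eta> \<le> \<bar>x\<bar>} x) \<le> 2 / (c * (1 + c * \<eta>))"
proof -
  have "ennreal (kern (c * x) * indicator {x. \<eta> \<le> \<bar>x\<bar>} x) = ennreal (kern (c * x)) * indicator {x. \<eta> \<le> \<bar>x\<bar>} x" for x
    by (auto simp: indicator_def)
  then have "(LINT x|lborel. kern (c * x) * indicator {x. \<eta> \<le> \<bar>x\<bar>} x)
     = enn2real (\<integral>\<^sup>+x. ennreal (kern (c * x)) * indicator {x. \<eta> \<le> \<bar>x\<bar>} x \<partial>lborel)"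
    by (subst integral_eq_nn_integral) auto
  also have "\<dots> \<le> enn2real (ennreal (2 / (c * (1 + c * \<eta>))))"
    by (intro enn2real_mono nn_integral_kern_tail assms) auto
  also have "\<dots> = 2 / (c * (1 + c * \<eta>))" using assms by simp
  finally show ?thesis .
qed

lemma integral_kern: "c > 0 \<Longrightarrow> (LINT x|lborel. kern (c * x)) \<le> 2 / c"
  using integral_kern_tail[of c 0] by simp

lemma measurable_bil_int [measurable]:
  "bil_int A B \<in> borel_measurable borel"
proof -
  have [measurable]: "seg B \<in> borel_measurable borel"
    unfolding seg_def set_lebesgue_integral_def by measurable
  show ?thesis unfolding bil_int_def set_lebesgue_integral_def by measurable
qed

lemma measurable_qseg [measurable]: "qseg A \<in> borel_measurable borel"
  unfolding qseg_def set_lebesgue_integral_def by measurable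

lemma norm_qseg_le: "A \<ge> 0 \<Longrightarrow> norm (qseg A \<phi>) \<le> 2 * A"
proof -
  assume A: "A \<ge> 0"
  have "norm (qseg A \<phi>) \<le> (LINT t:{-A..A}|lborel. 1)"
    unfolding qseg_def set_lebesgue_integral_def
    by (intro Bochner_Integration.integral_norm_bound_integral integrable_indicator_Icc continuous_intros) (auto simp: indicator_def)
  then show ?thesis using A by (simp add: set_lebesgue_integral_def)
qed

text \<open>Monotonicity of \<open>wt\<close> lets the frequencies of size |\<beta>| and 2 |\<beta>|
  in \<open>box_int\<close> share one weight.\<close>

lemma norm_bil_int_le':
  assumes "A > 0" "B > 0" "A * B = W" "\<bar>\<beta>\<bar> \<le> \<bar>\<phi>\<bar>"
  shows "norm (bil_int A B \<phi>) \<le> 32 * W * wt (W * \<bar>\<beta>\<bar>)"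
proof -
  have W: "W > 0" using assms by auto
  have "wt (W * \<bar>\<phi>\<bar>) \<le> wt (W * \<bar>\<beta>\<bar>)"
    unfolding wt_def using W assms(4) by (intro powr_mono2') (auto simp: mult_left_mono add_pos_nonneg)
  then have "32 * W * wt (W * \<bar>\<phi>\<bar>) \<le> 32 * W * wt (W * \<bar>\<beta>\<bar>)" using W by (intro mult_left_mono) auto
  then show ?thesis using norm_bil_int_le[OF assms(1,2), of \<phi>] unfolding assms(3) by linarith
qed

section \<open>The singular integral of a box with equal pair products\<close>

locale box =
  fixes Y :: "4 \<Rightarrow> 4 \<Rightarrow> real" and W Z :: real
  assumes Ypos: "\<And>i j. (i, j) \<in> coords \<Longrightarrow> Y i j > 0"
    and prods: "Y 1 1 * Y 4 4 = W" "Y 2 2 * Y 3 3 = W" "Y 1 2 * Y 3 4 = W" "Y 1 3 * Y 2 4 = W"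
    and Z: "Y 1 4 = Z" "Z\<^sup>2 = W"
begin

lemma Y_pos: "Y 1 1 > 0" "Y 4 4 > 0" "Y 2 2 > 0" "Y 3 3 > 0" "Y 1 2 > 0" "Y 3 4 > 0" "Y 1 3 > 0" "Y 2 4 > 0" "Z > 0" "W > 0"
proof -
  show "Y 1 1 > 0" "Y 4 4 > 0" "Y 2 2 > 0" "Y 3 3 > 0" "Y 1 2 > 0" "Y 3 4 > 0" "Y 1 3 > 0" "Y 2 4 > 0"
    by (rule Ypos, simp add: coords_def)+
  show Zp: "Z > 0" using Ypos[of 1 4] by (simp add: coords_def Z)
  then show "W > 0" by (simp add: Z(2)[symmetric])
qed

text \<open>2^21 = 32^4 * 2: the constant 32 W of each of four bilinear integrals, and the trivial
  bound 2Z of the quadratic one.\<close>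

definition KI :: real where "KI = 2 ^ 21 * W ^ 4 * Z"

lemma KI_pos: "KI > 0" using Y_pos by (simp add: KI_def)

lemma norm_box_int_le: "norm (box_int Y \<beta>) \<le> KI * kern (W * \<beta>)"
proof -
  define x where "x = 32 * W * wt (W * \<bar>\<beta>\<bar>)"
  have x: "x \<ge> 0" using Y_pos by (simp add: x_def)
  have "norm (box_int Y \<beta>) \<le> x * x * x * x * (2 * Z)"
  proof -
    have b: "norm (bil_int (Y 1 1) (Y 4 4) (-1 * \<beta>)) \<le> x" "norm (bil_int (Y 2 2) (Y 3 3) (-1 * \<beta>)) \<le> x"
      "norm (bil_int (Y 1 2) (Y 3 4) (-2 * \<beta>)) \<le> x" "norm (bil_int (Y 1 3) (Y 2 4) (-2 * \<beta>)) \<le> x"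
      unfolding x_def by (rule norm_bil_int_le'; use Y_pos prods in simp)+
    have "norm (qseg (Y 1 4) (-2 * \<beta>)) \<le> 2 * Z" using norm_qseg_le[of Z] Y_pos by (simp add: Z)
    then show ?thesis
      unfolding box_int_def norm_mult using b x by (intro mult_mono mult_nonneg_nonneg) auto
  qed
  also have "\<dots> = KI * wt (W * \<bar>\<beta>\<bar>) ^ 4"
    by (simp add: x_def KI_def power4_eq_xxxx)
  also have "\<dots> \<le> KI * kern (W * \<bar>\<beta>\<bar>)"
    using KI_pos Y_pos by (intro mult_left_mono wt_pow4) auto
  also have "kern (W * \<bar>\<beta>\<bar>) = kern (W * \<beta>)" by (simp add: kern_def abs_mult)
  finally show ?thesis .
qed

lemma measurable_box_int [measurable]: "box_int Y \<in> borel_measurable borel"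
  unfolding box_int_def by measurable

lemma integrable_box_int: "integrable lborel (box_int Y)"
proof (rule Bochner_Integration.integrable_bound)
  show "integrable lborel (\<lambda>\<beta>. KI * kern (W * \<beta>))"
    using integrable_kern[OF Y_pos(10)] by (rule integrable_mult_right)
  show "AE \<beta> in lborel. norm (box_int Y \<beta>) \<le> norm (KI * kern (W * \<beta>))"
  proof (rule AE_I2)
    fix \<beta> show "norm (box_int Y \<beta>) \<le> norm (KI * kern (W * \<beta>))"
      using norm_box_int_le[of \<beta>] by (rule order_trans) simp
  qed
qed simp

lemma norm_sing_integral_le: "norm (sing_integral (coord_box Y)) \<le> KI * (2 / W)"
proof -
  have "norm (sing_integral (coord_box Y)) \<le> (LINT \<beta>|lborel. KI * kern (W * \<beta>))"
    unfolding sing_integral_eq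
    by (rule Bochner_Integration.integral_norm_bound_integral[OF integrable_box_int
         integrable_mult_right[OF integrable_kern[OF Y_pos(10)]] norm_box_int_le])
  also have "\<dots> \<le> KI * (2 / W)" unfolding integral_mult_right_zero using integral_kern[OF Y_pos(10)] KI_pos by (intro mult_left_mono) auto
  finally show ?thesis .
qed

lemma sing_integral_truncate:
  assumes "\<eta> \<ge> 0"
  shows "norm (sing_integral (coord_box Y) - (LINT \<beta>:{-\<eta>..\<eta>}|lborel. box_int Y \<beta>)) \<le> KI * (2 / (W * (1 + W * \<eta>)))"
proof -
  have i1: "integrable lborel (\<lambda>\<beta>. indicator {-\<eta>..\<eta>} \<beta> *\<^sub>R box_int Y \<beta>)"
    by (rule integrable_mult_indicator[OF _ integrable_box_int]) simp
  have "sing_integral (coord_box Y) - (LINT \<beta>:{-\<eta>..\<eta>}|lborel. box_int Y \<beta>)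
     = (LINT \<beta>|lborel. box_int Y \<beta> - indicator {-\<eta>..\<eta>} \<beta> *\<^sub>R box_int Y \<beta>)"
    unfolding sing_integral_eq set_lebesgue_integral_def
    by (rule Bochner_Integration.integral_diff[symmetric, OF integrable_box_int i1])
  also have "norm \<dots> \<le> (LINT \<beta>|lborel. KI * (kern (W * \<beta>) * indicator {\<beta>. \<eta> \<le> \<bar>\<beta>\<bar>} \<beta>))"
  proof (rule Bochner_Integration.integral_norm_bound_integral)
    show "integrable lborel (\<lambda>\<beta>. KI * (kern (W * \<beta>) * indicator {\<beta>. \<eta> \<le> \<bar>\<beta>\<bar>} \<beta>))"
      by (intro integrable_mult_right integrable_real_mult_indicator integrable_kern Y_pos) simp
    show "norm (box_int Y \<beta> - indicator {-\<eta>..\<eta>} \<beta> *\<^sub>R box_int Y \<beta>) \<le> KI * (kern (W * \<beta>) * indicator {\<beta>. \<eta> \<le> \<bar>\<beta>\<bar>} \<beta>)" for \<beta>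
      using norm_box_int_le[of \<beta>] by (cases "\<beta> \<in> {-\<eta>..\<eta>}") (auto simp: indicator_def KI_pos less_imp_le abs_le_iff)
    show "integrable lborel (\<lambda>\<beta>. box_int Y \<beta> - indicator {-\<eta>..\<eta>} \<beta> *\<^sub>R box_int Y \<beta>)"
      by (rule Bochner_Integration.integrable_diff[OF integrable_box_int i1])
  qed
  also have "\<dots> \<le> KI * (2 / (W * (1 + W * \<eta>)))"
    unfolding integral_mult_right_zero using integral_kern_tail[OF Y_pos(10) assms] KI_pos by (intro mult_left_mono) auto
  finally show ?thesis .
qed

end

section \<open>The circle method\<close>

lemma norm_prod4_diff_le:
  fixes a1 a2 a3 a4 b1 b2 b3 b4 :: complex
  assumes "norm a1 \<le> T" "norm a2 \<le> T" "norm a3 \<le> T" "norm a4 \<le> T"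
    and "norm b1 \<le> T" "norm b2 \<le> T" "norm b3 \<le> T" "norm b4 \<le> T"
    and "norm (a1 - b1) \<le> E" "norm (a2 - b2) \<le> E" "norm (a3 - b3) \<le> E" "norm (a4 - b4) \<le> E"
  shows "norm (a1 * a2 * a3 * a4 - b1 * b2 * b3 * b4) \<le> 4 * E * T ^ 3"
proof -
  have T: "T \<ge> 0" using assms(1) norm_ge_zero order_trans by blast
  have E: "E \<ge> 0" using assms(9) norm_ge_zero order_trans by blast
  have "a1 * a2 * a3 * a4 - b1 * b2 * b3 * b4
    = (a1 - b1) * (a2 * a3 * a4) + b1 * ((a2 - b2) * (a3 * a4)) + b1 * (b2 * ((a3 - b3) * a4)) + b1 * (b2 * (b3 * (a4 - b4)))"
    by (simp add: algebra_simps)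
  also have "norm \<dots> \<le> E * (T * T * T) + T * (E * (T * T)) + T * (T * (E * T)) + T * (T * (T * E))"
    using assms T E
    by (intro norm_triangle_mono; unfold norm_mult) (intro mult_mono; auto)+
  also have "\<dots> = 4 * E * T ^ 3" by (simp add: power3_eq_cube algebra_simps)
  finally show ?thesis .
qed

lemma norm_prod4_le:
  fixes a1 a2 a3 a4 :: complex
  assumes "norm a1 \<le> T1" "norm a2 \<le> T2" "norm a3 \<le> T3" "norm a4 \<le> T4"
  shows "norm (a1 * a2 * a3 * a4) \<le> T1 * T2 * T3 * T4"
proof -
  have "T1 \<ge> 0" "T2 \<ge> 0" "T3 \<ge> 0" "T4 \<ge> 0" using assms norm_ge_zero order_trans by blast+
  then show ?thesis unfolding norm_mult using assms by (intro mult_mono mult_nonneg_nonneg) auto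
qed

lemma cube_sum_le: "0 \<le> a \<Longrightarrow> 0 \<le> b \<Longrightarrow> (a + b) ^ 3 \<le> 4 * (a ^ 3 + b ^ 3)" for a b :: real
proof -
  assume ab: "0 \<le> a" "0 \<le> b"
  have "4 * (a ^ 3 + b ^ 3) - (a + b) ^ 3 = 3 * (a + b) * (a - b)\<^sup>2"
    by (simp add: power2_eq_square power3_eq_cube algebra_simps)
  also have "\<dots> \<ge> 0" using ab by simp
  finally show ?thesis by simp
qed

lemma fourth_power_sum_le: "(a + b) ^ 4 \<le> 8 * (a ^ 4 + b ^ 4)" for a b :: real
proof -
  have 1: "(x + y)\<^sup>2 \<le> 2 * (x\<^sup>2 + y\<^sup>2)" for x y :: real
    using sum_squares_bound[of x y] by (simp add: power2_sum)
  have "(a + b) ^ 4 = ((a + b)\<^sup>2)\<^sup>2" by (simp flip: power_mult)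
  also have "\<dots> \<le> (2 * (a\<^sup>2 + b\<^sup>2))\<^sup>2" by (intro power_mono 1) auto
  also have "\<dots> = 4 * (a\<^sup>2 + b\<^sup>2)\<^sup>2" unfolding power_mult_distrib by simp
  also have "\<dots> \<le> 4 * (2 * ((a\<^sup>2)\<^sup>2 + (b\<^sup>2)\<^sup>2))" by (intro mult_left_mono 1) auto
  also have "\<dots> = 8 * (a ^ 4 + b ^ 4)" by (simp flip: power_mult)
  finally show ?thesis .
qed

text \<open>The left endpoint is free because the integration later runs over
  [1/R, 1 + 1/R].\<close>

lemma integral_e_fun_unit_interval:
  "(LINT t:{a..a + 1}|lborel. e_fun (t * of_int n)) = (if n = 0 then 1 else 0)"
proof (cases "n = 0")
  case False
  define F where "F = (\<lambda>t. e_fun (t * of_int n) / (2 * of_real pi * \<i> * of_real (of_int n)))"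
  have "(LINT t:{a..a + 1}|lborel. e_fun (t * of_int n)) = F (a + 1) - F a"
    unfolding set_lebesgue_integral_def
  proof (rule integral_FTC_Icc)
    fix x
    have "((\<lambda>t. e_fun (t * of_int n)) has_vector_derivative 2 * of_real pi * \<i> * of_real (of_int n) * e_fun (x * of_int n)) (at x within {a..a+1})"
      by (rule e_fun_has_vector_derivative) (auto intro!: derivative_eq_intros)
    from has_vector_derivative_divide[OF this, of "2 * of_real pi * \<i> * of_real (of_int n)"]
    show "(F has_vector_derivative e_fun (x * of_int n)) (at x within {a..a+1})"
      using False by (simp add: F_def)
  qed (auto intro!: continuous_intros)
  also have "F (a + 1) = F a" by (simp add: F_def ring_distribs e_fun_add)
  finally show ?thesis using False by simp
qed (simp add: set_lebesgue_integral_def)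

section \<open>The generating function\<close>

text \<open>\<open>2 * Q < R\<close> separates the arcs, \<open>4 * Y i j \<le> R\<close> keeps the
  phases close to their rational parts, and \<open>real (m * Q) \<le> Z\<close> admits the steps mr
  with r <= Q in the quadratic sum. \<open>real m \<le> Y i j\<close> absorbs the +1 in the number
  of points of a progression.\<close>

locale circle = box +
  fixes m R Q :: nat and B0 :: "int ^ 4 ^ 4"
  assumes m: "m > 0" "odd m" and B0: "B0 \<in> V" "int m dvd quad_q B0"
    and nonzero: "\<And>p. prime p \<Longrightarrow> p dvd m \<Longrightarrow> \<exists>(i, j)\<in>coords. \<not> int p dvd B0 $ i $ j"
    and mY: "\<And>i j. (i, j) \<in> coords \<Longrightarrow> real m \<le> Y i j"
    and RY: "\<And>i j. (i, j) \<in> coords \<Longrightarrow> 4 * Y i j \<le> R"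
    and Q: "Q \<ge> 1" "2 * Q < R" "real (m * Q) \<le> Z"
begin

definition pts :: "(int ^ 4 ^ 4) set" where
  "pts = {B \<in> V. \<forall>(i, j)\<in>coords. B $ i $ j \<in> prog (Y i j) m (B0 $ i $ j)}"

text \<open>The phase is divided by m because m divides q on all of \<open>pts\<close>: S has period
  1, and integration over a unit interval detects q = 0.\<close>

definition S :: "real \<Rightarrow> complex" where
  "S t = (\<Sum>B\<in>pts. e_fun (t / m * of_int (quad_q B)))"

definition zsum :: "real \<Rightarrow> complex" where
  "zsum \<theta> = (\<Sum>z\<in>prog (Y 1 4) m (B0 $ 1 $ 4). e_fun (of_int (-2) * \<theta> * (of_int z)\<^sup>2))"

lemma S_eq: "S t = bil_sum (-1) (Y 1 1) (Y 4 4) m (B0$1$1) (B0$4$4) (t / m) * bil_sum (-1) (Y 2 2) (Y 3 3) m (B0$2$2) (B0$3$3) (t / m)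
  * bil_sum (-2) (Y 1 2) (Y 3 4) m (B0$1$2) (B0$3$4) (t / m) * bil_sum (-2) (Y 1 3) (Y 2 4) m (B0$1$3) (B0$2$4) (t / m) * zsum (t / m)"
proof -
  have b: "bil_sum k A B m x0 y0 (t / m) = (\<Sum>x\<in>prog A m x0. \<Sum>y\<in>prog B m y0. e_fun (t / m * of_int (k * x * y)))" for k A B x0 y0
    unfolding bil_sum_def by (intro sum.cong refl arg_cong[of _ _ e_fun]) simp
  have z: "zsum (t / m) = (\<Sum>z\<in>prog (Y 1 4) m (B0 $ 1 $ 4). e_fun (t / m * of_int (-2 * z\<^sup>2)))"
    unfolding zsum_def by (intro sum.cong refl arg_cong[of _ _ e_fun]) simp
  show ?thesis
    unfolding S_def pts_def quad_q_phase b z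
    by (rule sum_V_box[where S = "\<lambda>i j. prog (Y i j) m (B0 $ i $ j)"
        and ?f1.0 = "\<lambda>x y. e_fun (t / m * of_int (-1 * x * y))"
        and ?f2.0 = "\<lambda>x y. e_fun (t / m * of_int (-1 * x * y))"
        and ?f3.0 = "\<lambda>x y. e_fun (t / m * of_int (-2 * x * y))"
        and ?f4.0 = "\<lambda>x y. e_fun (t / m * of_int (-2 * x * y))"
        and g = "\<lambda>z. e_fun (t / m * of_int (-2 * z\<^sup>2))"])
qed

lemma quad_q_cong:
  assumes "\<And>i j. (i, j) \<in> coords \<Longrightarrow> int m dvd B $ i $ j - B0 $ i $ j"
  shows "int m dvd quad_q B"
proof -
  have c: "B $ i $ j mod int m = B0 $ i $ j mod int m" if "(i, j) \<in> coords" for i j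
    using assms[OF that] by (simp add: mod_eq_dvd_iff)
  have "quad_q B mod int m = quad_q B0 mod int m"
    unfolding quad_q_def
    by (intro mod_diff_cong mod_minus_cong mod_mult_cong c refl)
       (auto simp: coords_def power2_eq_square intro!: mod_mult_cong c)
  then show ?thesis using B0(2) by (simp add: dvd_eq_mod_eq_0)
qed

lemma quad_q_pts: "B \<in> pts \<Longrightarrow> int m dvd quad_q B"
  by (rule quad_q_cong) (auto simp: pts_def prog_def)

lemma finite_pts: "finite pts"
proof -
  have "inj_on (\<lambda>B. \<lambda>p\<in>coords. B $ fst p $ snd p) pts"
  proof (rule inj_onI)
    fix B C assume BC: "B \<in> pts" "C \<in> pts" and eq: "(\<lambda>p\<in>coords. B $ fst p $ snd p) = (\<lambda>p\<in>coords. C $ fst p $ snd p)"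
    have e: "B $ i $ j = C $ i $ j" if "(i, j) \<in> coords" for i j
      using fun_cong[OF eq, of "(i, j)"] that by simp
    have "(1, 4) \<in> coords" by (simp add: coords_def)
    then have "of_coords (\<lambda>(i, j). B $ i $ j) = of_coords (\<lambda>(i, j). C $ i $ j)"
      unfolding of_coords_def using e by (auto simp: vec_eq_iff)
    moreover have "B \<in> V" "C \<in> V" using BC by (auto simp: pts_def)
    ultimately show "B = C" using of_coords_entries[of B] of_coords_entries[of C] by simp
  qed
  moreover have "(\<lambda>B. \<lambda>p\<in>coords. B $ fst p $ snd p) ` pts \<subseteq> (\<Pi>\<^sub>E p\<in>coords. prog (Y (fst p) (snd p)) m (B0 $ fst p $ snd p))"
    by (auto simp: pts_def)
  moreover have "finite (\<Pi>\<^sub>E p\<in>coords. prog (Y (fst p) (snd p)) m (B0 $ fst p $ snd p))"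
    using m by (intro finite_PiE) (auto simp: coords_def)
  ultimately show ?thesis by (rule inj_on_finite)
qed

lemma N_q_eq: "N_q (coord_box Y) m B0 = card {B \<in> pts. quad_q B = 0}"
proof -
  have "map_matrix real_of_int B \<in> V" if "B \<in> V" for B :: "int ^ 4 ^ 4"
    using that by (auto simp: V_def transpose_def vec_eq_iff map_matrix_def)
  then have "{B \<in> V. map_matrix real_of_int B \<in> coord_box Y \<and> (\<forall>(i, j) \<in> coords. int m dvd B $ i $ j - B0 $ i $ j) \<and> quad_q B = 0}
     = {B \<in> pts. quad_q B = 0}"
    by (auto simp: pts_def coord_box_def prog_def map_matrix_def)
  then show ?thesis by (simp add: N_q_def)
qed

lemma S_of_pts: "S t = (\<Sum>B\<in>pts. e_fun (t * of_int (quad_q B div int m)))"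
  unfolding S_def
proof (intro sum.cong refl arg_cong[of _ _ e_fun])
  fix B assume "B \<in> pts"
  then obtain n where "quad_q B = int m * n" using quad_q_pts by blast
  then show "t / m * of_int (quad_q B) = t * of_int (quad_q B div int m)" using m by simp
qed

lemma S_periodic: "S (t + of_int n) = S t"
  unfolding S_of_pts by (simp add: ring_distribs e_fun_add flip: of_int_mult)

lemma continuous_on_S: "continuous_on A S"
  unfolding S_of_pts by (intro continuous_intros)

lemma N_q_integral: "of_nat (N_q (coord_box Y) m B0) = (LINT t:{a..a + 1}|lborel. S t)"
proof -
  have "(LINT t:{a..a + 1}|lborel. S t) = (\<Sum>B\<in>pts. LINT t:{a..a + 1}|lborel. e_fun (t * of_int (quad_q B div int m)))"
    unfolding S_of_pts set_lebesgue_integral_def scaleR_sum_right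
    by (intro Bochner_Integration.integral_sum integrable_indicator_Icc continuous_intros)
  also have "\<dots> = (\<Sum>B\<in>pts. if quad_q B = 0 then 1 else 0)"
    unfolding integral_e_fun_unit_interval
  proof (intro sum.cong refl if_cong)
    fix B assume "B \<in> pts"
    then have "int m dvd quad_q B" by (rule quad_q_pts)
    then show "(quad_q B div int m = 0) = (quad_q B = 0)" using m by (elim dvdE) simp
  qed
  also have "\<dots> = of_nat (card {B \<in> pts. quad_q B = 0})"
    using finite_pts by (simp add: sum.If_cases Int_def)
  finally show ?thesis by (simp add: N_q_eq)
qed

definition E :: real where "E = 9 * R * (1 + ln R)"

text \<open>64 is 2 * 32: gcd(k, r) <= 2 times the constant of \<open>norm_bil_int_le\<close>. It
  also exceeds the 24 of \<open>norm_bil_sum_le\<close>, so M + E bounds the sums as well as their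
  main terms.\<close>

definition M :: "nat \<Rightarrow> real \<Rightarrow> real" where "M r \<beta> = 64 * (W / (m * r)) * wt (W * \<bar>\<beta>\<bar>)"

lemma R_pos: "R > 0" using Q by simp

lemma E_nonneg: "E \<ge> 0" using R_pos by (simp add: E_def)

lemma M_nonneg: "M r \<beta> \<ge> 0" using Y_pos by (simp add: M_def)

lemma mZ: "real m \<le> Z" "4 * Z \<le> R"
  using mY[of 1 4] RY[of 1 4] by (simp_all add: coords_def Z)

lemma norm_zsum_le: "norm (zsum \<theta>) \<le> 3 * Z / m"
  unfolding zsum_def Z(1) using norm_square_sum_le[OF m(1) mZ(1), of "\<lambda>z. of_int (-2) * \<theta> * (of_int z)\<^sup>2"] by simp

end

section \<open>Estimates on one arc\<close>

locale circle_arc = circle +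
  fixes r :: nat and a :: int and \<beta> t :: real
  assumes r: "r > 0" "r \<le> R" and co: "coprime a (int r)"
    and t: "\<beta> = (t - of_int a / r) / m" "\<bar>t - of_int a / r\<bar> \<le> 1 / (real r * real R)"
begin

lemma \<theta>: "t / m = of_int a / real (r * m) + \<beta>"
  using t(1) r m by (simp add: field_simps)

lemma \<beta>: "\<bar>\<beta>\<bar> \<le> 1 / (real r * real R * real m)"
proof -
  have "\<bar>\<beta>\<bar> = \<bar>t - of_int a / r\<bar> / m" using t(1) by simp
  also have "\<dots> \<le> 1 / (real r * real R) / m" using t(2) by (intro divide_right_mono) auto
  finally show ?thesis by simp
qed

lemma arcI:
  assumes "(i, j) \<in> coords" "(k, l) \<in> coords" "\<kappa> \<noteq> 0" "\<bar>\<kappa>\<bar> \<le> 2"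
  shows "rational_arc (Y i j) (Y k l) m r R a \<kappa> \<beta> (t / m)"
  using assms mY RY m r co \<beta> by unfold_locales (auto simp: \<theta>)

lemma norm_bil_le:
  assumes "rational_arc A B m r R a \<kappa> \<beta> (t / m)" "A * B = W"
  shows "norm (bil_sum \<kappa> A B m x0 y0 (t / m)) \<le> M r \<beta> + E"
proof -
  have "24 * (W / (m * r)) * wt (W * \<bar>\<beta>\<bar>) \<le> M r \<beta>"
    unfolding M_def using Y_pos by (intro mult_right_mono) auto
  then show ?thesis
    using rational_arc.norm_bil_sum_le[OF assms(1), of x0 y0] unfolding assms(2) E_def by linarith
qed

lemma norm_S_le: "norm (S t) \<le> (M r \<beta> + E) ^ 4 * (3 * Z / m)"
proof -
  have "norm (S t) \<le> (M r \<beta> + E) * (M r \<beta> + E) * (M r \<beta> + E) * (M r \<beta> + E) * (3 * Z / m)"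
    unfolding S_eq norm_mult[of _ "zsum _"]
    by (intro mult_mono norm_prod4_le norm_bil_le arcI norm_zsum_le prods)
      (use M_nonneg E_nonneg in \<open>auto simp: coords_def intro!: mult_nonneg_nonneg add_nonneg_nonneg\<close>)
  then show ?thesis by (simp add: power4_eq_xxxx)
qed

text \<open>240 = 72 * 10/3 bounds 72 pi, where 72 pi W |\<beta>| is the Lipschitz error in
  \<open>square_sum_approx\<close> for the coefficient -2.\<close>

definition zerr :: real where "zerr = 240 * r * (1 + W * \<bar>\<beta>\<bar>)"

lemma zerr_nonneg: "zerr \<ge> 0" using Y_pos by (simp add: zerr_def)

definition zcoeff :: complex where
  "zcoeff = (\<Sum>c\<in>{0..<int r}. e_fun (of_int ((-2) * a * (B0$1$4 + int m * c)\<^sup>2) / real (r * m)))"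

lemma zsum_approx:
  assumes "r \<le> Q"
  shows "norm (zsum (t / m) - zcoeff * (qseg Z (of_int (-2) * \<beta>) / of_nat (m * r))) \<le> zerr"
proof -
  have "real (m * r) \<le> real (m * Q)" using assms by (intro of_nat_mono mult_left_mono) auto
  then have "real (m * r) \<le> Z" using Q(3) by linarith
  from square_sum_approx[OF m(1) r(1) this, of "-2" a \<beta> "B0$1$4"]
  have "norm (zsum (t / m) - zcoeff * (qseg Z (of_int (-2) * \<beta>) / of_nat (m * r))) \<le> r * (36 * pi * \<bar>of_int (-2) * \<beta>\<bar> * Z\<^sup>2 + 2)"
    unfolding zsum_def zcoeff_def \<theta> Z(1) .
  also have "\<dots> \<le> zerr"
  proof -
    have "36 * pi * \<bar>of_int (-2) * \<beta>\<bar> * Z\<^sup>2 = 72 * pi * (W * \<bar>\<beta>\<bar>)" by (simp add: Z(2) abs_mult)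
    also have "\<dots> \<le> 72 * (10 / 3) * (W * \<bar>\<beta>\<bar>)"
      using Y_pos pi_approx by (intro mult_right_mono mult_left_mono) auto
    finally have le: "36 * pi * \<bar>of_int (-2) * \<beta>\<bar> * Z\<^sup>2 \<le> 72 * (10 / 3) * (W * \<bar>\<beta>\<bar>)" .
    have "real r * (36 * pi * \<bar>of_int (-2) * \<beta>\<bar> * Z\<^sup>2 + 2) \<le> real r * (240 * (W * \<bar>\<beta>\<bar>) + 240)"
      by (rule mult_left_mono) (use le in linarith, simp)
    then show ?thesis by (simp add: zerr_def algebra_simps)
  qed
  finally show ?thesis .
qed

text \<open>First the cost of replacing the four bilinear factors with \<open>zsum\<close> bounded
  trivially, then the cost of replacing \<open>zsum\<close> with the bilinear factors bounded by M +
  E. It also bounds S itself when r and m share a prime.\<close>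

definition Err :: real where
  "Err = 4 * E * (M r \<beta> + E) ^ 3 * (3 * Z / m) + (M r \<beta> + E) ^ 4 * zerr"

lemma prime_dvd_a: "prime p \<Longrightarrow> p dvd r \<Longrightarrow> \<not> int p dvd a"
  using co by (metis coprime_common_divisor int_dvd_int_iff not_prime_unit prime_int_nat_transfer prime_nat_int_transfer of_nat_dvd_iff)

lemma noncoprime_estimate:
  assumes "r \<le> Q" "\<not> coprime m r"
  shows "norm (S t) \<le> Err"
proof -
  define T where "T = M r \<beta> + E"
  have T: "T \<ge> 0" using M_nonneg E_nonneg by (simp add: T_def)
  have ET: "E \<le> T" using M_nonneg by (simp add: T_def)
  have "gcd m r \<noteq> 1" using assms(2) by (simp add: coprime_iff_gcd_eq_1)
  then obtain p where p: "prime p" "p dvd m" "p dvd r" using prime_factor_nat[of "gcd m r"] by auto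
  have op: "odd p" using p(2) m(2) by (meson dvd_trans)
  obtain i j where ij: "(i, j) \<in> coords" "\<not> int p dvd B0 $ i $ j" using nonzero[OF p(1,2)] by auto
  define P1 where "P1 = bil_sum (-1) (Y 1 1) (Y 4 4) m (B0$1$1) (B0$4$4) (t / m)"
  define P2 where "P2 = bil_sum (-1) (Y 2 2) (Y 3 3) m (B0$2$2) (B0$3$3) (t / m)"
  define P3 where "P3 = bil_sum (-2) (Y 1 2) (Y 3 4) m (B0$1$2) (B0$3$4) (t / m)"
  define P4 where "P4 = bil_sum (-2) (Y 1 3) (Y 2 4) m (B0$1$3) (B0$2$4) (t / m)"
  have PT: "norm P1 \<le> T" "norm P2 \<le> T" "norm P3 \<le> T" "norm P4 \<le> T"
    unfolding P1_def P2_def P3_def P4_def T_def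
    by (rule norm_bil_le[OF arcI prods(1)] norm_bil_le[OF arcI prods(2)] norm_bil_le[OF arcI prods(3)] norm_bil_le[OF arcI prods(4)], auto simp: coords_def)+
  have left: "norm (bil_sum \<kappa> A B m x0 y0 (t / m)) \<le> E" if "rational_arc A B m r R a \<kappa> \<beta> (t / m)" "\<not> int p dvd x0" for A B \<kappa> x0 y0
    unfolding E_def using rational_arc.norm_bil_sum_noncoprime_le[OF that(1) p(1,3,2) op that(2)] by simp
  have right: "norm (bil_sum \<kappa> A B m x0 y0 (t / m)) \<le> E" if "rational_arc A B m r R a \<kappa> \<beta> (t / m)" "\<not> int p dvd y0" for A B \<kappa> x0 y0
    using left[OF rational_arc.swap[OF that(1)] that(2)] by (subst bil_sum_commute)
  have S: "S t = P1 * P2 * P3 * P4 * zsum (t / m)" by (simp add: S_eq P1_def P2_def P3_def P4_def)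
  \<comment> \<open>Nine coordinates reduce to five cases, since the second member of a pair can be
    exchanged with the first by the symmetry of \<open>bil_sum\<close>.\<close>
  consider "(i, j) = (1, 4)" | "norm P1 \<le> E" | "norm P2 \<le> E" | "norm P3 \<le> E" | "norm P4 \<le> E"
  proof -
    have a: "rational_arc (Y 1 1) (Y 4 4) m r R a (-1) \<beta> (t / m)" "rational_arc (Y 2 2) (Y 3 3) m r R a (-1) \<beta> (t / m)"
      "rational_arc (Y 1 2) (Y 3 4) m r R a (-2) \<beta> (t / m)" "rational_arc (Y 1 3) (Y 2 4) m r R a (-2) \<beta> (t / m)"
      by (rule arcI; simp add: coords_def)+
    show ?thesis
      using ij that left[OF a(1)] right[OF a(1)] left[OF a(2)] right[OF a(2)] left[OF a(3)] right[OF a(3)] left[OF a(4)] right[OF a(4)]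
      unfolding P1_def P2_def P3_def P4_def coords_def by auto
  qed
  then have "norm (S t) \<le> E * T ^ 3 * (3 * Z / m) \<or> norm (S t) \<le> T ^ 4 * zerr"
  proof cases
    case 1
    then have "\<not> int p dvd B0 $ 1 $ 4" using ij by simp
    \<comment> \<open>A shift of z multiplies the terms by a root of unity with numerator 2 (-2) a
      z0. The prime p is odd and divides neither a nor this coordinate, so the root is
      nontrivial.\<close>
    then have "\<not> int p dvd 2 * (-2) * a * (B0 $ 1 $ 4)"
    proof -
      have pp: "prime (int p)" using p(1) by simp
      have "\<not> int p dvd 4"
      proof
        assume "int p dvd 4"
        then have "p dvd 4" by presburger
        then have "p dvd 2 ^ 2" by simp
        then have "p dvd 2" using p(1) prime_dvd_power by blast
        then have "p = 2" using p(1) by (simp add: primes_dvd_imp_eq two_is_prime_nat)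
        then show False using op by simp
      qed
      then show ?thesis using prime_dvd_a[OF p(1,3)] \<open>\<not> int p dvd B0 $ 1 $ 4\<close> pp by (simp add: prime_dvd_mult_iff)
    qed
    from gauss_sum_noncoprime[OF m(1) r(1) p(1,3,2) this] have "zcoeff = 0" unfolding zcoeff_def by simp
    then have "norm (zsum (t / m)) \<le> zerr" using zsum_approx[OF assms(1)] by simp
    then have "norm (S t) \<le> T * T * T * T * zerr"
      unfolding S norm_mult[of _ "zsum _"] using T by (intro mult_mono norm_prod4_le PT) auto
    then show ?thesis by (simp add: power4_eq_xxxx)
  next
    case 2
    have "norm (S t) \<le> E * T * T * T * (3 * Z / m)"
      unfolding S norm_mult[of _ "zsum _"] using T E_nonneg by (intro mult_mono norm_prod4_le PT 2 norm_zsum_le) auto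
    then show ?thesis by (simp add: power3_eq_cube mult_ac)
  next
    case 3
    have "norm (S t) \<le> T * E * T * T * (3 * Z / m)"
      unfolding S norm_mult[of _ "zsum _"] using T E_nonneg by (intro mult_mono norm_prod4_le PT 3 norm_zsum_le) auto
    then show ?thesis by (simp add: power3_eq_cube mult_ac)
  next
    case 4
    have "norm (S t) \<le> T * T * E * T * (3 * Z / m)"
      unfolding S norm_mult[of _ "zsum _"] using T E_nonneg by (intro mult_mono norm_prod4_le PT 4 norm_zsum_le) auto
    then show ?thesis by (simp add: power3_eq_cube mult_ac)
  next
    case 5
    have "norm (S t) \<le> T * T * T * E * (3 * Z / m)"
      unfolding S norm_mult[of _ "zsum _"] using T E_nonneg by (intro mult_mono norm_prod4_le PT 5 norm_zsum_le) auto
    then show ?thesis by (simp add: power3_eq_cube mult_ac)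
  qed
  moreover have "0 \<le> E * T ^ 3 * (3 * Z / m)" "0 \<le> T ^ 4 * zerr" using T E_nonneg Y_pos zerr_nonneg by simp_all
  moreover have "Err = 4 * (E * T ^ 3 * (3 * Z / m)) + T ^ 4 * zerr" by (simp add: Err_def T_def)
  ultimately show ?thesis by argo
qed

text \<open>Four factors gcd(k, r)/(m^2 r) and one factor 1/(mr) multiply to gcd(2, r)^2/(m^9 r^5).
  The difference of products is telescoped: first the bilinear factors are replaced, then the
  quadratic sum.\<close>

lemma coprime_estimate:
  assumes "r \<le> Q" "coprime m r" and a: "a = b * int m"
  shows "norm (S t - of_int (gcd 2 (int r)) ^ 2 / (of_nat m ^ 9 * of_nat r ^ 5) * gauss_sum (-2) b r * box_int Y \<beta>) \<le> Err"
proof -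
  define T where "T = M r \<beta> + E"
  have T: "T \<ge> 0" using M_nonneg E_nonneg by (simp add: T_def)
  have MT: "M r \<beta> \<le> T" using E_nonneg by (simp add: T_def)
  define P1 where "P1 = bil_sum (-1) (Y 1 1) (Y 4 4) m (B0$1$1) (B0$4$4) (t / m)"
  define P2 where "P2 = bil_sum (-1) (Y 2 2) (Y 3 3) m (B0$2$2) (B0$3$3) (t / m)"
  define P3 where "P3 = bil_sum (-2) (Y 1 2) (Y 3 4) m (B0$1$2) (B0$3$4) (t / m)"
  define P4 where "P4 = bil_sum (-2) (Y 1 3) (Y 2 4) m (B0$1$3) (B0$2$4) (t / m)"
  define c where "c = (\<lambda>k. of_int (gcd k (int r)) / (of_nat m ^ 2 * of_nat r) :: complex)"
  define M1 where "M1 = c (-1) * bil_int (Y 1 1) (Y 4 4) (of_int (-1) * \<beta>)"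
  define M2 where "M2 = c (-1) * bil_int (Y 2 2) (Y 3 3) (of_int (-1) * \<beta>)"
  define M3 where "M3 = c (-2) * bil_int (Y 1 2) (Y 3 4) (of_int (-2) * \<beta>)"
  define M4 where "M4 = c (-2) * bil_int (Y 1 3) (Y 2 4) (of_int (-2) * \<beta>)"
  define G0 where "G0 = gauss_sum (-2) b r * (qseg Z (of_int (-2) * \<beta>) / of_nat (m * r))"
  have S: "S t = P1 * P2 * P3 * P4 * zsum (t / m)" by (simp add: S_eq P1_def P2_def P3_def P4_def)
  have arcs: "rational_arc (Y 1 1) (Y 4 4) m r R a (-1) \<beta> (t / m)" "rational_arc (Y 2 2) (Y 3 3) m r R a (-1) \<beta> (t / m)"
      "rational_arc (Y 1 2) (Y 3 4) m r R a (-2) \<beta> (t / m)" "rational_arc (Y 1 3) (Y 2 4) m r R a (-2) \<beta> (t / m)"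
      by (rule arcI; simp add: coords_def)+
  have PT: "norm P1 \<le> T" "norm P2 \<le> T" "norm P3 \<le> T" "norm P4 \<le> T"
    unfolding P1_def P2_def P3_def P4_def T_def
    by (intro norm_bil_le arcs prods)+
  have \<theta>b: "of_int b / real r + \<beta> = t / m" unfolding \<theta> a using m r by simp
  have PM: "norm (P1 - M1) \<le> E" "norm (P2 - M2) \<le> E" "norm (P3 - M3) \<le> E" "norm (P4 - M4) \<le> E"
    unfolding P1_def P2_def P3_def P4_def M1_def M2_def M3_def M4_def c_def E_def \<theta>b[symmetric]
    using rational_arc.bil_sum_approx[OF arcs(1) assms(2) a] rational_arc.bil_sum_approx[OF arcs(2) assms(2) a]
      rational_arc.bil_sum_approx[OF arcs(3) assms(2) a] rational_arc.bil_sum_approx[OF arcs(4) assms(2) a] by simp_all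
  have cb: "norm (c k * bil_int A B (of_int k * \<beta>)) \<le> T"
    if "A > 0" "B > 0" "A * B = W" "k = -1 \<or> k = -2" for k A B
  proof -
    have "norm (bil_int A B (of_int k * \<beta>)) \<le> 32 * W * wt (W * \<bar>\<beta>\<bar>)"
      using that by (intro norm_bil_int_le') (auto simp: abs_mult)
    moreover have "norm (c k) \<le> 2 / (m * r)"
    proof -
      have g: "of_int (gcd k (int r)) \<le> (2::real)"
      proof -
        have "gcd k (int r) \<le> 2" using that(4) gcd_le1_int[of 2 "int r"] by auto
        then show ?thesis by linarith
      qed
      have "real m * real r * 1 \<le> real m * real r * real m" using m by (intro mult_left_mono) auto
      then have "real m * real r \<le> (real m)\<^sup>2 * real r" by (simp add: power2_eq_square mult_ac)
      then show ?thesis unfolding c_def using g m r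
        by (auto simp: norm_divide norm_mult norm_power intro!: frac_le)
    qed
    ultimately have "norm (c k * bil_int A B (of_int k * \<beta>)) \<le> 2 / (m * r) * (32 * W * wt (W * \<bar>\<beta>\<bar>))"
      unfolding norm_mult by (intro mult_mono) auto
    also have "\<dots> = M r \<beta>" by (simp add: M_def)
    finally show ?thesis using MT by linarith
  qed
  have MTs: "norm M1 \<le> T" "norm M2 \<le> T" "norm M3 \<le> T" "norm M4 \<le> T"
    unfolding M1_def M2_def M3_def M4_def by (intro cb; use Y_pos prods in simp)+
  have zc: "zcoeff = gauss_sum (-2) b r"
    unfolding zcoeff_def using gauss_sum_shift[OF m(1) r(1), of "-2" b "B0$1$4"] assms(2) by (simp add: a)
  have G: "norm (zsum (t / m) - G0) \<le> zerr" unfolding G0_def zc[symmetric] by (rule zsum_approx[OF assms(1)])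
  have main: "of_int (gcd 2 (int r)) ^ 2 / (of_nat m ^ 9 * of_nat r ^ 5) * gauss_sum (-2) b r * box_int Y \<beta> = M1 * M2 * M3 * M4 * G0"
  proof -
    have "c (-1) * c (-1) * c (-2) * c (-2) / of_nat (m * r) = of_int (gcd 2 (int r)) ^ 2 / (of_nat m ^ 9 * of_nat r ^ 5)"
      using m r by (simp add: c_def field_simps eval_nat_numeral)
    moreover have "M1 * M2 * M3 * M4 * G0 = (c (-1) * c (-1) * c (-2) * c (-2) / of_nat (m * r)) * (gauss_sum (-2) b r * box_int Y \<beta>)"
      unfolding M1_def M2_def M3_def M4_def G0_def box_int_def Z(1)[symmetric] by (simp add: mult_ac)
    ultimately show ?thesis by (simp only: mult.assoc)
  qed
  have "S t - M1 * M2 * M3 * M4 * G0 = (P1 * P2 * P3 * P4 - M1 * M2 * M3 * M4) * zsum (t / m) + M1 * M2 * M3 * M4 * (zsum (t / m) - G0)"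
    unfolding S by (simp add: algebra_simps)
  also have "norm \<dots> \<le> (4 * E * T ^ 3) * (3 * Z / m) + (T * T * T * T) * zerr"
    using T E_nonneg
    by (intro norm_triangle_mono; unfold norm_mult[of "_ - _" "zsum _"] norm_mult[of _ "_ - _"])
      (intro mult_mono norm_prod4_diff_le norm_prod4_le PT MTs PM norm_zsum_le G; simp)+
  also have "\<dots> = Err" by (simp add: Err_def T_def power4_eq_xxxx)
  finally show ?thesis unfolding main .
qed

text \<open>The powers of M + E are separated by convexity. The parts with M decay: M^3 and M^4 r (1
  + u) are both at most a multiple of \<open>kern\<close> divided by r^3. The parts with E^4 are
  bounded uniformly, using |\<beta>| <= 1/(rRm) for the growth of \<open>zerr\<close>.\<close>

lemma Err_le:
  defines "D \<equiv> 64 * W / m"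
  shows "Err \<le> (48 * E * (Z / m) * D ^ 3 + 1920 * D ^ 4) / real r ^ 3 * kern (W * \<beta>)
     + E ^ 4 * (48 * Z / m + 1920 * (real r + W / (real R * real m)))"
proof -
  define u where "u = W * \<bar>\<beta>\<bar>"
  have u: "u \<ge> 0" using Y_pos by (simp add: u_def)
  have ku: "kern (W * \<beta>) = kern u" using Y_pos by (simp add: kern_def u_def abs_mult)
  have D: "D \<ge> 0" using Y_pos by (simp add: D_def)
  have Mu: "M r \<beta> = D / r * wt u" by (simp add: M_def D_def u_def)
  have M3: "M r \<beta> ^ 3 \<le> D ^ 3 / real r ^ 3 * kern u"
    unfolding Mu power_mult_distrib power_divide using D u by (intro mult_left_mono wt_pow4) auto
  have M4: "M r \<beta> ^ 4 * (real r * (1 + u)) = D ^ 4 / real r ^ 3 * kern u"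
  proof -
    have "M r \<beta> ^ 4 * (real r * (1 + u)) = D ^ 4 / real r ^ 4 * real r * (wt u ^ 4 * (1 + u))"
      unfolding Mu power_mult_distrib power_divide by (simp add: mult_ac)
    also have "D ^ 4 / real r ^ 4 * real r = D ^ 4 / real r ^ 3" using r by (simp add: eval_nat_numeral)
    finally show ?thesis by (simp only: wt_pow4(1)[OF u])
  qed
  have ru: "real r * (1 + u) \<le> real r + W / (real R * real m)"
  proof -
    have "u \<le> W * (1 / (real r * real R * real m))" unfolding u_def using \<beta> Y_pos by (intro mult_left_mono) auto
    then have "real r * u \<le> real r * (W * (1 / (real r * real R * real m)))" by (intro mult_left_mono) auto
    also have "\<dots> = W / (real R * real m)" using r by simp
    finally show ?thesis by (simp add: algebra_simps)
  qed
  have "Err \<le> 4 * E * (4 * (M r \<beta> ^ 3 + E ^ 3)) * (3 * Z / m) + (8 * (M r \<beta> ^ 4 + E ^ 4)) * (240 * (real r * (1 + u)))"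
  proof -
    have "zerr = 240 * (real r * (1 + u))" by (simp add: zerr_def u_def)
    moreover have "(M r \<beta> + E) ^ 4 * zerr \<le> (8 * (M r \<beta> ^ 4 + E ^ 4)) * zerr"
      by (rule mult_right_mono[OF fourth_power_sum_le zerr_nonneg])
    moreover have "4 * E * (M r \<beta> + E) ^ 3 * (3 * Z / m) \<le> 4 * E * (4 * (M r \<beta> ^ 3 + E ^ 3)) * (3 * Z / m)"
      using E_nonneg M_nonneg Y_pos by (intro mult_right_mono mult_left_mono cube_sum_le) auto
    ultimately show ?thesis unfolding Err_def by simp
  qed
  also have "\<dots> = 48 * E * (Z / m) * M r \<beta> ^ 3 + 1920 * (M r \<beta> ^ 4 * (real r * (1 + u))) + E ^ 4 * (48 * Z / m + 1920 * (real r * (1 + u)))"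
    by (simp add: algebra_simps power4_eq_xxxx power3_eq_cube)
  also have "\<dots> \<le> 48 * E * (Z / m) * (D ^ 3 / real r ^ 3 * kern u) + 1920 * (D ^ 4 / real r ^ 3 * kern u) + E ^ 4 * (48 * Z / m + 1920 * (real r + W / (real R * real m)))"
    unfolding M4 using E_nonneg Y_pos M3 ru by (intro add_mono mult_left_mono) auto
  also have "\<dots> = (48 * E * (Z / m) * D ^ 3 + 1920 * D ^ 4) / real r ^ 3 * kern (W * \<beta>)
     + E ^ 4 * (48 * Z / m + 1920 * (real r + W / (real R * real m)))"
    by (simp add: ku add_divide_distrib algebra_simps)
  finally show ?thesis .
qed

end

section \<open>Sums over denominators and separation of fractions\<close>

lemma sum_inverse_square_le: "(\<Sum>r=1..n. 1 / real r ^ 2) \<le> 2"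
proof -
  have "(\<Sum>r=1..n. 1 / real r ^ 2) \<le> 2 - 1 / real n" if "n \<ge> 1" for n
    using that
  proof (induction n rule: dec_induct)
    case (step n)
    have "1 / real (Suc n) ^ 2 \<le> 1 / (real n * real (Suc n))"
      using step by (intro divide_left_mono) (auto simp: power2_eq_square)
    also have "\<dots> = 1 / real n - 1 / real (Suc n)" using step by (simp add: field_simps)
    finally show ?case using step by simp
  qed simp
  then show ?thesis
  proof (cases "n \<ge> 1")
    case True
    have "0 \<le> 1 / real n" by simp
    then show ?thesis using \<open>n \<ge> 1 \<Longrightarrow> _\<close>[OF True] by linarith
  qed simp
qed

text \<open>Telescoping again: 2/(n + 1)^3 <= 1/n^2 - 1/(n + 1)^2, applied to finite partial
  sums.\<close>

lemma norm_infsum_C_q_tail_le: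
  assumes "Q \<ge> 1" "S \<subseteq> {Q<..}"
  shows "norm (infsum C_q S) \<le> 1 / real Q ^ 2"
proof -
  have fin: "(\<Sum>r\<in>F. norm (C_q r)) \<le> 1 / real Q ^ 2" if F: "finite F" "F \<subseteq> S" for F
  proof -
    define n where "n = Max (insert (Suc Q) F)"
    have n: "n \<ge> Suc Q" "F \<subseteq> {Suc Q..n}"
      using F assms(2) by (auto simp: n_def)
    have tel: "(\<Sum>r\<in>{Suc Q..n}. 2 / real r ^ 3) \<le> 1 / real Q ^ 2 - 1 / real n ^ 2" if "n \<ge> Q" for n
      using that
    proof (induction n rule: dec_induct)
      case (step n)
      define x where "x = real n"
      have x: "x \<ge> 1" using step assms(1) by (simp add: x_def)
      have "2 * (x ^ 2 * (x + 1) ^ 2) \<le> (2 * x + 1) * (x + 1) ^ 3"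
        using x by (simp add: power2_eq_square power3_eq_cube algebra_simps)
      then have "2 / (x + 1) ^ 3 \<le> (2 * x + 1) / (x ^ 2 * (x + 1) ^ 2)"
        using x by (simp add: divide_simps mult.commute)
      also have "\<dots> = 1 / x ^ 2 - 1 / (x + 1) ^ 2"
      proof -
        have "1 / x ^ 2 - 1 / (x + 1) ^ 2 = ((x + 1) ^ 2 - x ^ 2) / (x ^ 2 * (x + 1) ^ 2)"
          using x by (subst diff_frac_eq) auto
        then show ?thesis by (simp add: power2_sum)
      qed
      finally have "2 / real (Suc n) ^ 3 \<le> 1 / real n ^ 2 - 1 / real (Suc n) ^ 2"
        by (simp add: x_def add.commute)
      then show ?case using step by simp
    qed simp
    have "(\<Sum>r\<in>F. norm (C_q r)) \<le> (\<Sum>r\<in>{Suc Q..n}. 2 / real r ^ 3)"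
      using n by (intro order_trans[OF sum_mono[OF norm_C_q_le] sum_mono2]) auto
    also have "\<dots> \<le> 1 / real Q ^ 2 - 1 / real n ^ 2" using n by (intro tel) simp
    also have "\<dots> \<le> 1 / real Q ^ 2" by simp
    finally show ?thesis .
  qed
  have "norm (infsum C_q S) \<le> infsum (\<lambda>r. norm (C_q r)) S"
    by (rule norm_infsum_bound[OF C_q_abs_summable])
  also have "\<dots> \<le> 1 / real Q ^ 2"
    by (rule infsum_le_finite_sums[OF C_q_abs_summable fin])
  finally show ?thesis .
qed

lemma fractions_separated:
  fixes a b :: int and r s :: nat
  assumes "coprime a (int r)" "coprime b (int s)" "r > 0" "s > 0" "real_of_int a / r \<noteq> real_of_int b / s"
  shows "1 / (real r * real s) \<le> \<bar>real_of_int a / r - real_of_int b / s\<bar>"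
proof -
  have eq: "real_of_int a / r - real_of_int b / s = of_int (a * int s - b * int r) / (real r * real s)"
    using assms by (simp add: field_simps)
  then have "a * int s - b * int r \<noteq> 0" using assms(5) by (metis diff_eq_diff_less_eq div_0 eq_iff_diff_eq_0 of_int_0)
  then have "1 \<le> \<bar>real_of_int (a * int s - b * int r)\<bar>" by linarith
  then show ?thesis unfolding eq using assms by (simp add: abs_divide divide_right_mono)
qed

lemma fraction_eq_coprime:
  fixes a b :: int and r s :: nat
  assumes "coprime a (int r)" "coprime b (int s)" "r > 0" "s > 0" "real_of_int a / r = real_of_int b / s"
  shows "r = s \<and> a = b"
proof -
  have "real_of_int (a * int s) = real_of_int (b * int r)" using assms by (simp add: field_simps)
  then have e: "a * int s = b * int r" by (simp only: of_int_eq_iff)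
  then have "int r dvd a * int s" "int s dvd b * int r" by (simp_all, metis dvd_triv_right)
  then have "int r dvd int s" "int s dvd int r"
    using assms by (simp_all add: coprime_commute coprime_dvd_mult_right_iff)
  then have "r = s" by (simp add: dvd_antisym)
  then show ?thesis using e assms by simp
qed

section \<open>Dissection of the unit interval into arcs\<close>

context circle
begin

text \<open>The numerators run through \<open>{1..r}\<close>, not \<open>{0..<r}\<close>, so that every arc lies inside the
  interval \<open>[1/R, 1 + 1/R]\<close> of integration.\<close>

definition arcs :: "(nat \<times> int) set" where
  "arcs = {(r, a). 1 \<le> r \<and> r \<le> Q \<and> 1 \<le> a \<and> a \<le> int r \<and> coprime a (int r)}"

definition arc :: "nat \<Rightarrow> int \<Rightarrow> real set" where
  "arc r a = {of_int a / r - 1 / (real r * real R)..of_int a / r + 1 / (real r * real R)}"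

lemma finite_arcs: "finite arcs"
  by (rule finite_subset[of _ "{1..Q} \<times> {1..int Q}"]) (auto simp: arcs_def)

text \<open>Distinct fractions with denominators r and s are at least 1/(rs) apart, while the
  half-widths add up to (r + s)/(rsR) with r + s <= 2Q < R.\<close>

lemma arcs_disjoint:
  assumes "(r, a) \<in> arcs" "(s, b) \<in> arcs" "t \<in> arc r a" "t \<in> arc s b"
  shows "(r, a) = (s, b)"
proof (rule ccontr)
  assume ne: "(r, a) \<noteq> (s, b)"
  have rs: "r > 0" "s > 0" "r \<le> Q" "s \<le> Q" "coprime a (int r)" "coprime b (int s)" using assms by (auto simp: arcs_def)
  have "real_of_int a / r \<noteq> real_of_int b / s" using ne fraction_eq_coprime[OF rs(5,6,1,2)] by auto
  then have "1 / (real r * real s) \<le> \<bar>real_of_int a / r - real_of_int b / s\<bar>" by (rule fractions_separated[OF rs(5,6,1,2)])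
  also have "\<dots> \<le> 1 / (real r * real R) + 1 / (real s * real R)" using assms(3,4) unfolding arc_def by auto
  also have "\<dots> = (real s + real r) / (real r * real s * real R)" using rs R_pos by (simp add: field_simps)
  also have "\<dots> < real R / (real r * real s * real R)" using rs Q R_pos by (intro divide_strict_right_mono) auto
  also have "\<dots> = 1 / (real r * real s)" using R_pos by simp
  finally show False by simp
qed

text \<open>At the lower end the smallest fraction 1/r minus the half-width 1/(rR) is at least 1/R
  because r + 1 <= R.\<close>

lemma arc_subset:
  assumes "(r, a) \<in> arcs" shows "arc r a \<subseteq> {1 / R..1 + 1 / R}"
proof -
  have r: "r > 0" "r \<le> Q" "1 \<le> a" "a \<le> int r" "coprime a (int r)" using assms by (auto simp: arcs_def)
  have R: "real R \<ge> 1" "real R > 0" using R_pos by auto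
  have "1 / real R \<le> 1 / r - 1 / (real r * real R)"
  proof -
    have "real r + 1 \<le> real R" using r Q by linarith
    then show ?thesis using r R by (simp add: field_simps)
  qed
  also have "1 / real r \<le> of_int a / r" using r by (intro divide_right_mono) auto
  finally have 1: "1 / real R \<le> of_int a / r - 1 / (real r * real R)" by simp
  have "of_int a / r \<le> (1::real)" using r by (simp add: field_simps)
  moreover have "1 / (real r * real R) \<le> 1 / real R" using r R by (simp add: field_simps)
  ultimately have 2: "of_int a / r + 1 / (real r * real R) \<le> 1 + 1 / real R" by linarith
  show ?thesis using 1 2 unfolding arc_def by auto
qed

definition minv :: "nat \<Rightarrow> int" where
  "minv r = (SOME v. int r dvd v * int m - 1)"

lemma minv: assumes "coprime m r" shows "int r dvd minv r * int m - 1"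
proof -
  obtain u v where "u * int m + v * int r = 1"
    using bezout_int[of "int m" "int r"] assms by (auto simp: coprime_iff_gcd_eq_1)
  then have "u * int m - 1 = int r * (- v)" by (simp add: algebra_simps)
  then have "int r dvd u * int m - 1" by (metis dvd_triv_left)
  then show ?thesis unfolding minv_def by (rule someI)
qed

text \<open>The value 0 for r not coprime to m encodes that such arcs have no main term. With b = a
  times \<open>minv r\<close> the numerator a is congruent to bm modulo r, the form required by
  \<open>coprime_estimate\<close>.\<close>

definition coeff :: "nat \<Rightarrow> int \<Rightarrow> complex" where
  "coeff r a = (if coprime m r then of_int (gcd 2 (int r)) ^ 2 / (of_nat m ^ 9 * of_nat r ^ 5) * gauss_sum (-2) (a * minv r) r else 0)"

lemma sum_coeff:
  assumes r: "r > 0" "coprime m r"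
  shows "(\<Sum>a\<in>{a\<in>{1..int r}. coprime a (int r)}. coeff r a) = C_q r / of_nat m ^ 9"
proof -
  have v: "int r dvd minv r * int m - 1" by (rule minv[OF r(2)])
  have vm: "(x * minv r * int m) mod int r = x mod int r" for x
  proof -
    have "int r dvd x * (minv r * int m - 1)" using v by (rule dvd_mult)
    then show ?thesis by (simp add: mod_eq_dvd_iff algebra_simps)
  qed
  have cov: "coprime (minv r) (int r)"
  proof -
    obtain w where "minv r * int m - 1 = int r * w" using v by (elim dvdE)
    then have w: "minv r * int m - int r * w = 1" by simp
    have "gcd (minv r) (int r) dvd minv r * int m - int r * w" by (intro dvd_diff dvd_mult2) auto
    then show ?thesis unfolding w by (simp add: coprime_iff_gcd_eq_1)
  qed
  have com: "coprime (int m) (int r)" using r(2) by simp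
  have "(\<Sum>a\<in>{a\<in>{1..int r}. coprime a (int r)}. gauss_sum (-2) (a * minv r) r) = (\<Sum>b\<in>units_mod r. gauss_sum (-2) b r)"
  \<comment> \<open>Multiplication by the inverse of m permutes the units. Numerators lie in {1..r}
    and units in {0..<r}, so the residue 0 is sent back to r; among units this occurs only for r =
    1.\<close>
  proof (rule sum.reindex_bij_witness[where j = "\<lambda>a. (a * minv r) mod int r"
        and i = "\<lambda>b. if (b * int m) mod int r = 0 then int r else (b * int m) mod int r"], goal_cases)
    case (1 a)
    have e1: "((a * minv r) mod int r * int m) mod int r = a mod int r"
      by (simp add: mod_mult_left_eq vm)
    have e2: "(if a mod int r = 0 then int r else a mod int r) = a"
    proof (cases "a = int r")
      case False
      then have "a mod int r = a" using 1 by simp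
      then show ?thesis using 1 by auto
    qed simp
    show ?case unfolding e1 by (rule e2)
  next
    case (2 a)
    then show ?case using r cov by (simp add: units_mod_def)
  next
    case (3 b)
    have "(if (b * int m) mod int r = 0 then int r else (b * int m) mod int r) mod int r = (b * int m) mod int r" by simp
    then have "((if (b * int m) mod int r = 0 then int r else (b * int m) mod int r) * minv r) mod int r
       = (b * int m * minv r) mod int r"
      by (metis mod_mult_left_eq)
    also have "\<dots> = b" using vm[of b] 3 by (simp add: mult_ac units_mod_def)
    finally show ?case .
  next
    case (4 b)
    then have cb: "coprime (b * int m) (int r)" using com by (simp add: units_mod_def)
    define x where "x = (b * int m) mod int r"
    have x: "x \<ge> 0" "x < int r" using r by (simp_all add: x_def)
    have cx: "coprime x (int r)" using cb r unfolding x_def by (simp only: coprime_mod_left_iff)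
    show ?case
    proof (cases "x = 0")
      case True
      then have "int r = 1" using cx r by simp
      then show ?thesis unfolding x_def[symmetric] using True by simp
    next
      case False
      then show ?thesis unfolding x_def[symmetric] using x cx by simp
    qed
  next
    case (5 a)
    show ?case using gauss_sum_mod[OF r(1), of "-2" "a * minv r"] by simp
  qed
  then have g: "(\<Sum>a\<in>{a\<in>{1..int r}. coprime a (int r)}. gauss_sum (-2) (a * minv r) r) = gauss_total r"
    by (simp only: gauss_total_def)
  have "(\<Sum>a\<in>{a\<in>{1..int r}. coprime a (int r)}. coeff r a)
     = of_int (gcd 2 (int r)) ^ 2 / (of_nat m ^ 9 * of_nat r ^ 5) * gauss_total r"
    using r(2) unfolding coeff_def g[symmetric] sum_distrib_left by (simp only: if_True)
  also have "\<dots> = C_q r / of_nat m ^ 9" unfolding C_q_eq[OF r(1)] by simp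
  finally show ?thesis .
qed

definition D :: real where "D = 64 * W / m"

definition err_kern :: real where "err_kern = 48 * E * (Z / m) * D ^ 3 + 1920 * D ^ 4"

definition err_const :: "nat \<Rightarrow> real" where "err_const r = E ^ 4 * (48 * Z / m + 1920 * (real r + W / (real R * real m)))"

definition err_fun :: "nat \<Rightarrow> int \<Rightarrow> real \<Rightarrow> real" where
  "err_fun r a t = err_kern / real r ^ 3 * kern (W * ((t - of_int a / r) / m)) + err_const r"

lemma D_nonneg: "D \<ge> 0" and err_kern_nonneg: "err_kern \<ge> 0" and err_const_nonneg: "err_const r \<ge> 0"
  using Y_pos E_nonneg by (simp_all add: D_def err_kern_def err_const_def)

lemma err_fun_nonneg: "err_fun r a t \<ge> 0"
  using err_kern_nonneg err_const_nonneg by (simp add: err_fun_def)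

definition main :: "nat \<Rightarrow> int \<Rightarrow> real \<Rightarrow> complex" where
  "main r a t = coeff r a * box_int Y ((t - of_int a / r) / m)"

lemma arc_abs: "t \<in> arc r a \<longleftrightarrow> \<bar>t - of_int a / r\<bar> \<le> 1 / (real r * real R)"
  unfolding arc_def by auto

text \<open>If \<open>r\<close> is coprime to \<open>m\<close>, the periodicity of \<open>S\<close> allows to replace \<open>a\<close> by a numerator
  \<open>bm \<equiv> a\<close> modulo \<open>r\<close>; then \<open>a/(rm) = b/r\<close> and the residues modulo \<open>m\<close> contribute no phase.\<close>

lemma arc_estimate:
  assumes ra: "(r, a) \<in> arcs" and t: "t \<in> arc r a"
  shows "norm (S t - main r a t) \<le> err_fun r a t"
proof -
  have rQ: "r > 0" "r \<le> Q" "coprime a (int r)" using ra by (auto simp: arcs_def)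
  have rR: "r \<le> R" using rQ Q by simp
  define \<beta> where "\<beta> = (t - of_int a / r) / m"
  show ?thesis
  proof (cases "coprime m r")
    case False
    interpret circle_arc Y W Z m R Q B0 r a \<beta> t
      using rQ rR t by unfold_locales (auto simp: \<beta>_def arc_abs)
    have "norm (S t) \<le> Err" by (rule noncoprime_estimate[OF rQ(2) False])
    then show ?thesis using Err_le False by (simp add: main_def coeff_def err_fun_def err_kern_def err_const_def D_def \<beta>_def)
  next
    case True
    define b where "b = a * minv r"
    obtain n where n: "minv r * int m - 1 = int r * n" using minv[OF True] by (elim dvdE)
    have "b * int m = a * (minv r * int m)" by (simp add: b_def)
    also have "minv r * int m = 1 + int r * n" using n by linarith
    finally have bm: "b * int m = a + int r * (a * n)" by (simp add: algebra_simps)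
    define t' where "t' = t + of_int (a * n)"
    have frac: "of_int (b * int m) / real r = of_int a / real r + of_int (a * n)"
      unfolding bm using rQ by (simp add: field_simps)
    have dt: "t' - of_int (b * int m) / r = t - of_int a / r" unfolding frac t'_def by simp
    have "gcd (int r) ((a * n) * int r + a) = gcd (int r) a" by (rule gcd_add_mult)
    then have cob: "coprime (b * int m) (int r)" unfolding bm using rQ(3)
      by (simp add: coprime_iff_gcd_eq_1 gcd.commute add.commute mult.commute)
    interpret circle_arc Y W Z m R Q B0 r "b * int m" \<beta> t'
    proof unfold_locales
      show "\<beta> = (t' - of_int (b * int m) / r) / m" unfolding dt \<beta>_def ..
      show "\<bar>t' - of_int (b * int m) / r\<bar> \<le> 1 / (real r * real R)" unfolding dt using t by (simp only: arc_abs)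
    qed (use rQ rR cob in simp_all)
    have "norm (S t' - of_int (gcd 2 (int r)) ^ 2 / (of_nat m ^ 9 * of_nat r ^ 5) * gauss_sum (-2) b r * box_int Y \<beta>) \<le> Err"
      by (rule coprime_estimate[OF rQ(2) True refl])
    moreover have "S t' = S t" unfolding t'_def by (rule S_periodic)
    ultimately show ?thesis using Err_le True by (simp add: main_def coeff_def err_fun_def err_kern_def err_const_def D_def \<beta>_def b_def)
  qed
qed

definition minor :: real where "minor = (D / Q + E) ^ 4 * (3 * Z / m)"

text \<open>Dirichlet's theorem gives h/r with r <= R. If r were at most Q, then t in [1/R, 1 + 1/R]
  would force 1 <= h <= r and t would lie on an arc. So r > Q, and the arc bound for S holds with
  D/Q in place of D/r and \<open>wt\<close> at most 1.\<close>

lemma minor_estimate: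
  assumes t: "t \<in> {1 / R..1 + 1 / R}" and no: "\<And>r a. (r, a) \<in> arcs \<Longrightarrow> t \<notin> arc r a"
  shows "norm (S t) \<le> minor"
proof -
  obtain h k where hk: "coprime h k" "0 < k" "k \<le> int R" "\<bar>of_int k * t - of_int h\<bar> < 1 / R"
    using Dirichlet_approx_coprime[of R t] R_pos by auto
  define r where "r = nat k"
  have r: "r > 0" "r \<le> R" "coprime h (int r)" "k = int r" using hk by (auto simp: r_def)
  have "t - of_int h / r = (of_int k * t - of_int h) / r" using r by (simp add: field_simps)
  then have "\<bar>t - of_int h / r\<bar> = \<bar>of_int k * t - of_int h\<bar> / r" by (simp add: abs_divide)
  also have "\<dots> < 1 / R / r" using hk(4) r by (intro divide_strict_right_mono) auto
  finally have lt: "\<bar>t - of_int h / r\<bar> < 1 / (real r * real R)" by (simp add: mult.commute)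
  have "r > Q"
  proof (rule ccontr)
    assume "\<not> r > Q"
    then have rQ: "r \<le> Q" by simp
    have R: "real R > 0" using R_pos by simp
    have rr: "1 / (real r * real R) \<le> 1 / real R" using r R by (simp add: field_simps)
    have "h \<ge> 1"
    proof (rule ccontr)
      assume "\<not> h \<ge> 1"
      then have "of_int h / real r \<le> 0" using r by (simp add: divide_nonpos_pos)
      then have "t < 1 / real R" using lt rr by linarith
      then show False using t by simp
    qed
    moreover have "h \<le> int r"
    proof (rule ccontr)
      assume "\<not> h \<le> int r"
      then have "real r + 1 \<le> real_of_int h" by linarith
      then have "(real r + 1) / real r \<le> of_int h / real r" by (intro divide_right_mono) auto
      then have "1 + 1 / real r \<le> of_int h / real r" using r by (simp add: field_simps)
      moreover have "1 / real R \<le> 1 / real r - 1 / (real r * real R)"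
      proof -
        have "real r + 1 \<le> real R" using rQ Q by linarith
        then show ?thesis using r R by (simp add: field_simps)
      qed
      ultimately have "t > 1 + 1 / real R" using lt by linarith
      then show False using t by simp
    qed
    ultimately have "(r, h) \<in> arcs" using r rQ by (auto simp: arcs_def)
    then show False using no[of r h] lt by (simp add: arc_abs)
  qed
  define \<beta> where "\<beta> = (t - of_int h / r) / m"
  interpret circle_arc Y W Z m R Q B0 r h \<beta> t
    using r lt by unfold_locales (auto simp: \<beta>_def)
  have u: "0 \<le> W * \<bar>\<beta>\<bar>" using Y_pos by simp
  have "M r \<beta> = D / r * wt (W * \<bar>\<beta>\<bar>)" by (simp add: M_def D_def)
  also have "\<dots> \<le> D / r * 1" using D_nonneg wt_le_1[OF u] by (intro mult_left_mono) auto
  also have "\<dots> \<le> D / Q" using \<open>r > Q\<close> Q D_nonneg by (simp add: divide_left_mono)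
  finally have "(M r \<beta> + E) ^ 4 * (3 * Z / m) \<le> minor"
    unfolding minor_def using M_nonneg E_nonneg Y_pos by (intro mult_right_mono power_mono add_right_mono) auto
  then show ?thesis using norm_S_le by linarith
qed

text \<open>Disjointness leaves one term of each sum on an arc and none off the arcs. Adding
  \<open>minor\<close> to the arc errors gives a bound that can be integrated without a case
  distinction.\<close>

lemma pointwise:
  assumes t: "t \<in> {1 / R..1 + 1 / R}"
  shows "norm (S t - (\<Sum>(r, a)\<in>arcs. indicator (arc r a) t *\<^sub>R main r a t))
     \<le> minor + (\<Sum>(r, a)\<in>arcs. indicator (arc r a) t * err_fun r a t)"
proof (cases "\<exists>(r, a)\<in>arcs. t \<in> arc r a")
  case True
  then obtain r a where ra: "(r, a) \<in> arcs" "t \<in> arc r a" by auto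
  have z: "indicator (arc s b) t = (0::real)" if "(s, b) \<in> arcs" "(s, b) \<noteq> (r, a)" for s b
    using arcs_disjoint[OF ra(1) that(1) ra(2)] that(2) by (auto simp: indicator_def)
  have 1: "(\<Sum>(s, b)\<in>arcs. indicator (arc s b) t *\<^sub>R main s b t) = main r a t"
  proof -
    have "(\<Sum>(s, b)\<in>arcs - {(r, a)}. indicator (arc s b) t *\<^sub>R main s b t) = 0"
      by (rule sum.neutral) (clarsimp, metis z prod.inject)
    then show ?thesis using ra(2) by (subst sum.remove[OF finite_arcs ra(1)]) simp
  qed
  have 2: "(\<Sum>(s, b)\<in>arcs. indicator (arc s b) t * err_fun s b t) = err_fun r a t"
  proof -
    have "(\<Sum>(s, b)\<in>arcs - {(r, a)}. indicator (arc s b) t * err_fun s b t) = 0"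
      by (rule sum.neutral) (clarsimp, metis z prod.inject)
    then show ?thesis using ra(2) by (subst sum.remove[OF finite_arcs ra(1)]) simp
  qed
  have "minor \<ge> 0" using D_nonneg E_nonneg Y_pos by (simp add: minor_def)
  then show ?thesis unfolding 1 2 using arc_estimate[OF ra] by linarith
next
  case False
  have 1: "(\<Sum>(s, b)\<in>arcs. indicator (arc s b) t *\<^sub>R main s b t) = 0"
    using False by (intro sum.neutral) (auto simp: indicator_def)
  have "(\<Sum>(s, b)\<in>arcs. indicator (arc s b) t * err_fun s b t) \<ge> 0"
    by (intro sum_nonneg) (auto simp: err_fun_nonneg)
  moreover have "norm (S t) \<le> minor" using False by (intro minor_estimate[OF t]) auto
  ultimately show ?thesis unfolding 1 by simp
qed

section \<open>Integration over the arcs\<close>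

lemma integrable_shifted:
  assumes "integrable lborel (f :: real \<Rightarrow> 'a::{banach, second_countable_topology})"
  shows "integrable lborel (\<lambda>t. f ((t - c) / m))"
proof -
  have "integrable lborel (\<lambda>t. f (- c / m + (1 / m) * t))"
    using m by (intro lborel_integrable_real_affine assms) auto
  moreover have "- c / m + (1 / m) * t = (t - c) / m" for t by (simp add: diff_divide_distrib)
  ultimately show ?thesis by simp
qed

text \<open>The substitution t = c + m \<beta> yields the factor m that lowers the m^9 of
  \<open>coeff\<close> to the m^8 of the main term.\<close>

lemma integral_shifted:
  shows "(LINT t|lborel. f ((t - c) / m)) = m *\<^sub>R (LINT \<beta>|lborel. (f \<beta> :: 'a::{banach, second_countable_topology}))"
proof -
  have "(LINT \<beta>|lborel. f \<beta>) = \<bar>1 / real m\<bar> *\<^sub>R (LINT t|lborel. f (- c / m + (1 / m) * t))"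
    using m by (intro lborel_integral_real_affine) auto
  moreover have "- c / m + (1 / m) * t = (t - c) / m" for t by (simp add: diff_divide_distrib)
  ultimately show ?thesis using m by simp
qed

definition eta :: "nat \<Rightarrow> real" where "eta r = 1 / (real r * real R * real m)"

lemma arc_scaled: "r > 0 \<Longrightarrow> t \<in> arc r a \<longleftrightarrow> (t - of_int a / r) / m \<in> {- eta r..eta r}"
proof -
  assume r: "r > 0"
  have "(t - of_int a / r) / m \<in> {- eta r..eta r} \<longleftrightarrow> \<bar>(t - of_int a / r) / m\<bar> \<le> eta r"
    unfolding atLeastAtMost_iff by (simp only: abs_le_iff) linarith
  also have "\<bar>(t - of_int a / r) / m\<bar> = \<bar>t - of_int a / r\<bar> / m" by simp
  also have "\<bar>t - of_int a / r\<bar> / m \<le> eta r \<longleftrightarrow> \<bar>t - of_int a / r\<bar> \<le> 1 / (real r * real R)"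
    unfolding eta_def using m r R_pos by (simp add: field_simps)
  finally show ?thesis by (simp add: arc_abs)
qed

lemma integral_main:
  assumes "(r, a) \<in> arcs"
  shows "(LINT t:{1 / R..1 + 1 / R}|lborel. indicator (arc r a) t *\<^sub>R main r a t)
     = coeff r a * (of_nat m * (LINT \<beta>:{- eta r..eta r}|lborel. box_int Y \<beta>))"
    and "integrable lborel (\<lambda>t. indicator (arc r a) t *\<^sub>R main r a t)"
proof -
  have r: "r > 0" using assms by (auto simp: arcs_def)
  define f where "f = (\<lambda>\<beta>. indicator {- eta r..eta r} \<beta> *\<^sub>R box_int Y \<beta>)"
  have e: "indicator (arc r a) t *\<^sub>R main r a t = coeff r a * f ((t - of_int a / r) / m)" for t
    using arc_scaled[OF r, of t a] by (auto simp: f_def main_def indicator_def)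
  have f: "integrable lborel f" unfolding f_def by (rule integrable_mult_indicator[OF _ integrable_box_int]) simp
  show "integrable lborel (\<lambda>t. indicator (arc r a) t *\<^sub>R main r a t)"
    unfolding e by (intro integrable_mult_right integrable_shifted f)
  have "(LINT t:{1 / R..1 + 1 / R}|lborel. indicator (arc r a) t *\<^sub>R main r a t) = (LINT t|lborel. indicator (arc r a) t *\<^sub>R main r a t)"
    unfolding set_lebesgue_integral_def
    by (intro Bochner_Integration.integral_cong refl) (use arc_subset[OF assms] in \<open>auto simp: indicator_def\<close>)
  also have "\<dots> = coeff r a * (of_nat m * (LINT \<beta>|lborel. f \<beta>))"
    unfolding e by (simp add: integral_shifted scaleR_conv_of_real)
  finally show "(LINT t:{1 / R..1 + 1 / R}|lborel. indicator (arc r a) t *\<^sub>R main r a t)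
     = coeff r a * (of_nat m * (LINT \<beta>:{- eta r..eta r}|lborel. box_int Y \<beta>))"
    by (simp add: f_def set_lebesgue_integral_def)
qed

text \<open>The decaying part of the error is integrated over the whole line, the constant part over
  the length 2/(rR) of the arc.\<close>

lemma integral_err:
  assumes "(r, a) \<in> arcs"
  shows "(LINT t|lborel. indicator (arc r a) t * err_fun r a t) \<le> err_kern / real r ^ 3 * (2 * m / W) + err_const r * (2 / (real r * real R))"
    and "integrable lborel (\<lambda>t. indicator (arc r a) t * err_fun r a t)"
proof -
  have r: "r > 0" using assms by (auto simp: arcs_def)
  define g where "g = (\<lambda>\<beta>. kern (W * \<beta>))"
  have g: "integrable lborel g" unfolding g_def by (rule integrable_kern[OF Y_pos(10)])
  define h where "h = (\<lambda>t. err_kern / real r ^ 3 * g ((t - of_int a / r) / m) + err_const r * indicator (arc r a) t)"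
  have le0: "0 \<le> 1 / (real r * real R)" by simp
  have ia: "integrable lborel (indicator (arc r a) :: real \<Rightarrow> real)" unfolding arc_def by (simp add: integrable_indicator_iff emeasure_lborel_Icc_eq)
  have hi: "integrable lborel h" unfolding h_def
    by (intro Bochner_Integration.integrable_add integrable_mult_right integrable_shifted g ia)
  have hle: "indicator (arc r a) t * err_fun r a t \<le> h t" for t
    using err_kern_nonneg by (auto simp: h_def g_def err_fun_def indicator_def)
  have meas: "(\<lambda>t. indicator (arc r a) t * err_fun r a t) \<in> borel_measurable lborel"
    unfolding arc_def err_fun_def by measurable
  show i: "integrable lborel (\<lambda>t. indicator (arc r a) t * err_fun r a t)"
  proof (rule Bochner_Integration.integrable_bound[OF hi meas], rule AE_I2)
    fix t show "norm (indicator (arc r a) t * err_fun r a t) \<le> norm (h t)"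
      using hle[of t] err_fun_nonneg[of r a t] by (auto simp: abs_mult indicator_def)
  qed
  have "(LINT t|lborel. indicator (arc r a) t * err_fun r a t) \<le> (LINT t|lborel. h t)"
    by (rule integral_mono[OF i hi hle])
  also have "\<dots> = err_kern / real r ^ 3 * (LINT t|lborel. g ((t - of_int a / r) / m)) + err_const r * (LINT t|lborel. indicator (arc r a) t)"
    unfolding h_def using integrable_shifted[OF g] ia by (subst Bochner_Integration.integral_add) auto
  also have "(LINT t|lborel. indicator (arc r a) t) = 2 / (real r * real R)"
    unfolding arc_def using le0 by simp
  also have "(LINT t|lborel. g ((t - of_int a / r) / m)) = m * (LINT \<beta>|lborel. g \<beta>)" by (simp add: integral_shifted)
  also have "err_kern / real r ^ 3 * (m * (LINT \<beta>|lborel. g \<beta>)) \<le> err_kern / real r ^ 3 * (m * (2 / W))"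
    unfolding g_def using err_kern_nonneg integral_kern[OF Y_pos(10)] by (intro mult_left_mono) auto
  finally show "(LINT t|lborel. indicator (arc r a) t * err_fun r a t) \<le> err_kern / real r ^ 3 * (2 * m / W) + err_const r * (2 / (real r * real R))"
    by (simp add: mult_ac)
qed

lemma sum_arcs: "(\<Sum>(r, a)\<in>arcs. f r a) = (\<Sum>r=1..Q. \<Sum>a\<in>{a\<in>{1..int r}. coprime a (int r)}. f r a)"
proof -
  have "arcs = Sigma {1..Q} (\<lambda>r. {a\<in>{1..int r}. coprime a (int r)})" by (auto simp: arcs_def)
  moreover have "finite {a\<in>{1..int r}. coprime a (int r)}" for r by (rule finite_subset[of _ "{1..int r}"]) auto
  ultimately show ?thesis by (simp only:) (subst sum.Sigma, simp_all)
qed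

definition total_err :: real where
  "total_err = err_kern * (4 * m / W) + E ^ 4 * (48 * Z / m * Q + 1920 * (real Q ^ 2 + Q * W / (real R * real m))) * (2 / R)"

lemma integral_estimate:
  "norm (of_nat (N_q (coord_box Y) m B0) - (\<Sum>(r, a)\<in>arcs. coeff r a * (of_nat m * (LINT \<beta>:{- eta r..eta r}|lborel. box_int Y \<beta>)))) \<le> minor + total_err"
proof -
  define T where "T = {1 / real R..1 / real R + 1}"
  have T: "T = {1 / R..1 + 1 / R}" by (simp add: T_def add.commute)
  define F where "F = (\<lambda>t. \<Sum>(r, a)\<in>arcs. indicator (arc r a) t *\<^sub>R main r a t)"
  define G where "G = (\<lambda>t. \<Sum>(r, a)\<in>arcs. indicator (arc r a) t * err_fun r a t)"
  have Fi: "integrable lborel (\<lambda>t. indicator T t *\<^sub>R (indicator (arc r a) t *\<^sub>R main r a t))" if "(r, a) \<in> arcs" for r a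
    by (rule integrable_mult_indicator[OF _ integral_main(2)[OF that]]) (simp add: T_def)
  have Si: "integrable lborel (\<lambda>t. indicator T t *\<^sub>R S t)"
    unfolding T_def by (intro integrable_indicator_Icc continuous_on_S)
  have Fs: "indicator T t *\<^sub>R F t = (\<Sum>(r, a)\<in>arcs. indicator T t *\<^sub>R (indicator (arc r a) t *\<^sub>R main r a t))" for t
    unfolding F_def by (simp add: scaleR_sum_right case_prod_unfold)
  have FI: "integrable lborel (\<lambda>t. indicator T t *\<^sub>R F t)"
    unfolding Fs using Fi by (intro Bochner_Integration.integrable_sum) auto
  have GI: "integrable lborel G"
    unfolding G_def using integral_err(2) by (intro Bochner_Integration.integrable_sum) auto
  have mi: "integrable lborel (\<lambda>t. indicator T t * minor)"
    unfolding T_def by (simp add: integrable_indicator_iff emeasure_lborel_Icc_eq)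
  have Fint: "(LINT t:T|lborel. F t) = (\<Sum>(r, a)\<in>arcs. coeff r a * (of_nat m * (LINT \<beta>:{- eta r..eta r}|lborel. box_int Y \<beta>)))"
  proof -
    have "(LINT t:T|lborel. F t) = (\<Sum>(r, a)\<in>arcs. LINT t|lborel. indicator T t *\<^sub>R (indicator (arc r a) t *\<^sub>R main r a t))"
      unfolding set_lebesgue_integral_def Fs using Fi by (subst Bochner_Integration.integral_sum) (auto simp: case_prod_unfold)
    also have "\<dots> = (\<Sum>(r, a)\<in>arcs. coeff r a * (of_nat m * (LINT \<beta>:{- eta r..eta r}|lborel. box_int Y \<beta>)))"
      using integral_main(1) unfolding T set_lebesgue_integral_def by (intro sum.cong) auto
    finally show ?thesis .
  qed
  have "of_nat (N_q (coord_box Y) m B0) - (LINT t:T|lborel. F t) = (LINT t|lborel. indicator T t *\<^sub>R S t - indicator T t *\<^sub>R F t)"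
    unfolding N_q_integral[of "1 / R"] T_def[symmetric] set_lebesgue_integral_def
    by (rule Bochner_Integration.integral_diff[OF Si FI, symmetric])
  also have "norm \<dots> \<le> (LINT t|lborel. indicator T t * minor + G t)"
  proof (rule Bochner_Integration.integral_norm_bound_integral)
    show "integrable lborel (\<lambda>t. indicator T t *\<^sub>R S t - indicator T t *\<^sub>R F t)"
      by (rule Bochner_Integration.integrable_diff[OF Si FI])
    show "integrable lborel (\<lambda>t. indicator T t * minor + G t)"
      by (rule Bochner_Integration.integrable_add[OF mi GI])
    fix t
    have "G t \<ge> 0" unfolding G_def by (intro sum_nonneg) (auto simp: err_fun_nonneg)
    then show "norm (indicator T t *\<^sub>R S t - indicator T t *\<^sub>R F t) \<le> indicator T t * minor + G t"
      using pointwise[of t] unfolding T F_def G_def by (cases "t \<in> {1 / R..1 + 1 / R}") auto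
  qed
  also have "\<dots> = minor + (LINT t|lborel. G t)"
    using mi GI by (subst Bochner_Integration.integral_add) (auto simp: T_def)
  also have "(LINT t|lborel. G t) = (\<Sum>(r, a)\<in>arcs. LINT t|lborel. indicator (arc r a) t * err_fun r a t)"
    unfolding G_def using integral_err(2) by (subst Bochner_Integration.integral_sum) (auto simp: case_prod_unfold)
  also have "\<dots> \<le> (\<Sum>(r, a)\<in>arcs. err_kern / real r ^ 3 * (2 * m / W) + err_const r * (2 / (real r * real R)))"
  proof (rule sum_mono, clarify)
    fix r a assume "(r, a) \<in> arcs"
    then show "(LINT t|lborel. indicator (arc r a) t * err_fun r a t) \<le> err_kern / real r ^ 3 * (2 * m / W) + err_const r * (2 / (real r * real R))"
      by (rule integral_err(1))
  qed
  also have "\<dots> \<le> total_err"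
  proof -
    define c where "c = (\<lambda>r. err_kern / real r ^ 3 * (2 * m / W) + err_const r * (2 / (real r * real R)))"
    have c0: "c r \<ge> 0" for r unfolding c_def using err_kern_nonneg err_const_nonneg Y_pos by simp
    have "(\<Sum>(r, a)\<in>arcs. c r) = (\<Sum>r=1..Q. \<Sum>a\<in>{a\<in>{1..int r}. coprime a (int r)}. c r)" by (rule sum_arcs)
    \<comment> \<open>At most r numerators belong to r: the decaying part then sums like 1/r^2, and
      in the constant part r cancels against the arc length.\<close>
    also have "\<dots> \<le> (\<Sum>r=1..Q. real r * c r)"
    proof (rule sum_mono)
      fix r
      have "card {a\<in>{1..int r}. coprime a (int r)} \<le> card {1..int r}" by (intro card_mono) auto
      then have "real (card {a\<in>{1..int r}. coprime a (int r)}) \<le> real r" by simp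
      then have "real (card {a\<in>{1..int r}. coprime a (int r)}) * c r \<le> real r * c r" by (rule mult_right_mono[OF _ c0])
      then show "(\<Sum>a\<in>{a\<in>{1..int r}. coprime a (int r)}. c r) \<le> real r * c r" by simp
    qed
    also have "\<dots> \<le> (\<Sum>r=1..Q. err_kern * (2 * m / W) * (1 / real r ^ 2) + err_const Q * (2 / R))"
    proof (rule sum_mono)
      fix r assume r: "r \<in> {1..Q}"
      have "err_const r \<le> err_const Q"
        unfolding err_const_def using r E_nonneg by (intro mult_left_mono add_left_mono add_right_mono) auto
      then have "err_const r * (2 / R) \<le> err_const Q * (2 / R)" by (rule mult_right_mono) simp
      moreover have "real r * c r = err_kern * (2 * m / W) * (1 / real r ^ 2) + err_const r * (2 / R)"
        using r R_pos Y_pos by (simp add: c_def field_simps eval_nat_numeral)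
      ultimately show "real r * c r \<le> err_kern * (2 * m / W) * (1 / real r ^ 2) + err_const Q * (2 / R)" by simp
    qed
    also have "\<dots> = err_kern * (2 * m / W) * (\<Sum>r=1..Q. 1 / real r ^ 2) + Q * (err_const Q * (2 / R))"
      by (simp add: sum.distrib sum_distrib_left)
    also have "\<dots> \<le> err_kern * (2 * m / W) * 2 + Q * (err_const Q * (2 / R))"
      using err_kern_nonneg Y_pos by (intro add_right_mono mult_left_mono sum_inverse_square_le) auto
    also have "\<dots> = total_err"
      by (simp add: total_err_def err_const_def power2_eq_square algebra_simps)
    finally show ?thesis by (simp add: c_def)
  qed
  finally show ?thesis unfolding Fint by simp
qed

section \<open>Completion of the singular series and the singular integral\<close>

definition tail_err :: real where
  "tail_err = (8 * KI * (R * m / W ^ 2) + 2 * KI / (W * real Q ^ 2)) / real m ^ 8"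

text \<open>The first part of \<open>tail_err\<close> pays for extending the integrals over
  |\<beta>| <= \<open>eta r\<close> to the whole line, the second for adding the terms with r >
  Q.\<close>

lemma main_term_estimate:
  "norm ((\<Sum>(r, a)\<in>arcs. coeff r a * (of_nat m * (LINT \<beta>:{- eta r..eta r}|lborel. box_int Y \<beta>)))
     - infsum C_q {r. r > 0 \<and> coprime m r} / of_nat m ^ 8 * sing_integral (coord_box Y)) \<le> tail_err"
proof -
  define J where "J = sing_integral (coord_box Y)"
  define I where "I = (\<lambda>r. LINT \<beta>:{- eta r..eta r}|lborel. box_int Y \<beta>)"
  define A where "A = {r\<in>{1..Q}. coprime m r}"
  have "(\<Sum>(r, a)\<in>arcs. coeff r a * (of_nat m * I r)) = (\<Sum>r=1..Q. (\<Sum>a\<in>{a\<in>{1..int r}. coprime a (int r)}. coeff r a) * (of_nat m * I r))"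
    unfolding sum_arcs by (simp add: sum_distrib_right)
  also have "\<dots> = (\<Sum>r\<in>A. C_q r / of_nat m ^ 9 * (of_nat m * I r))"
  proof (rule sum.mono_neutral_cong_right)
    show "\<forall>r\<in>{1..Q} - A. (\<Sum>a\<in>{a\<in>{1..int r}. coprime a (int r)}. coeff r a) * (of_nat m * I r) = 0"
      by (auto simp: A_def coeff_def)
    show "\<And>r. r \<in> A \<Longrightarrow> (\<Sum>a\<in>{a\<in>{1..int r}. coprime a (int r)}. coeff r a) * (of_nat m * I r) = C_q r / of_nat m ^ 9 * (of_nat m * I r)"
      by (subst sum_coeff) (auto simp: A_def)
  qed (auto simp: A_def)
  also have "\<dots> = (\<Sum>r\<in>A. C_q r * I r) / of_nat m ^ 8"
  proof -
    have "C_q r / of_nat m ^ 9 * (of_nat m * I r) = C_q r * I r / of_nat m ^ 8" for r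
    proof -
      have "(of_nat m :: complex) ^ 9 = of_nat m ^ 8 * of_nat m" by (simp flip: power_Suc2)
      then show ?thesis using m by simp
    qed
    then show ?thesis by (simp only: sum_divide_distrib)
  qed
  finally have 1: "(\<Sum>(r, a)\<in>arcs. coeff r a * (of_nat m * I r)) = (\<Sum>r\<in>A. C_q r * I r) / of_nat m ^ 8" .
  have split: "infsum C_q {r. r > 0 \<and> coprime m r} = (\<Sum>r\<in>A. C_q r) + infsum C_q {r. r > Q \<and> coprime m r}"
  proof -
    define B where "B = {r. r > Q \<and> coprime m r}"
    have eq: "{r. r > 0 \<and> coprime m r} = A \<union> B" by (auto simp: A_def B_def)
    have "A \<inter> B = {}" by (auto simp: A_def B_def)
    then have "infsum C_q (A \<union> B) = infsum C_q A + infsum C_q B"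
      by (rule infsum_Un_disjoint[OF C_q_summable C_q_summable])
    moreover have "finite A" by (simp add: A_def)
    ultimately show ?thesis unfolding eq B_def by simp
  qed
  have W: "W > 0" by (rule Y_pos(10))
  have b1: "norm (C_q r * (I r - J)) \<le> 4 * KI * (R * m / W ^ 2) * (1 / real r ^ 2)" if r: "r \<in> A" for r
  proof -
    have r0: "r > 0" using r by (auto simp: A_def)
    have eta: "eta r > 0" using r0 R_pos m by (simp add: eta_def)
    have "norm (I r - J) \<le> KI * (2 / (W * (1 + W * eta r)))"
      using sing_integral_truncate[of "eta r"] eta unfolding J_def I_def by (simp add: norm_minus_commute)
    \<comment> \<open>Dropping the summand 1 makes the truncation error grow like r, which the decay
      1/r^3 of \<open>C_q\<close> turns into the summable 1/r^2.\<close>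
    also have "\<dots> \<le> KI * (2 / (W * (W * eta r)))"
      using KI_pos W eta by (intro mult_left_mono divide_left_mono mult_pos_pos add_pos_pos) auto
    also have "\<dots> = 2 * KI * (R * m / W ^ 2) * r"
      using r0 R_pos m W by (simp add: eta_def field_simps power2_eq_square)
    finally have "norm (C_q r * (I r - J)) \<le> 2 / real r ^ 3 * (2 * KI * (R * m / W ^ 2) * r)"
      unfolding norm_mult by (intro mult_mono norm_C_q_le) auto
    also have "\<dots> = 4 * KI * (R * m / W ^ 2) * (1 / real r ^ 2)"
    proof -
      have "2 / real r ^ 3 * real r = 2 * (1 / real r ^ 2)" using r0 by (simp add: eval_nat_numeral)
      then have "2 / real r ^ 3 * real r * (2 * KI * (R * m / W ^ 2)) = 2 * (1 / real r ^ 2) * (2 * KI * (R * m / W ^ 2))"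
        by (simp only:)
      then show ?thesis by (simp add: mult_ac)
    qed
    finally show ?thesis .
  qed
  have "norm (\<Sum>r\<in>A. C_q r * (I r - J)) \<le> (\<Sum>r\<in>A. 4 * KI * (R * m / W ^ 2) * (1 / real r ^ 2))"
    by (rule sum_norm_le[OF b1])
  also have "\<dots> \<le> (\<Sum>r=1..Q. 4 * KI * (R * m / W ^ 2) * (1 / real r ^ 2))"
    using KI_pos by (intro sum_mono2) (auto simp: A_def)
  also have "\<dots> = 4 * KI * (R * m / W ^ 2) * (\<Sum>r=1..Q. 1 / real r ^ 2)" by (simp add: sum_distrib_left)
  also have "\<dots> \<le> 4 * KI * (R * m / W ^ 2) * 2" using KI_pos by (intro mult_left_mono sum_inverse_square_le) auto
  finally have 2: "norm (\<Sum>r\<in>A. C_q r * (I r - J)) \<le> 8 * KI * (R * m / W ^ 2)" by simp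
  have "norm (infsum C_q {r. r > Q \<and> coprime m r} * J) \<le> 1 / real Q ^ 2 * (KI * (2 / W))"
    unfolding norm_mult J_def using Q by (intro mult_mono norm_infsum_C_q_tail_le norm_sing_integral_le) auto
  then have 3: "norm (infsum C_q {r. r > Q \<and> coprime m r} * J) \<le> 2 * KI / (W * real Q ^ 2)" by (simp add: mult_ac)
  have "(\<Sum>r\<in>A. C_q r * I r) / of_nat m ^ 8 - infsum C_q {r. r > 0 \<and> coprime m r} / of_nat m ^ 8 * J
     = ((\<Sum>r\<in>A. C_q r * (I r - J)) - infsum C_q {r. r > Q \<and> coprime m r} * J) / of_nat m ^ 8"
  proof -
    have "(\<Sum>r\<in>A. C_q r * (I r - J)) = (\<Sum>r\<in>A. C_q r * I r) - (\<Sum>r\<in>A. C_q r) * J"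
      by (simp only: right_diff_distrib sum_subtractf sum_distrib_right)
    then show ?thesis unfolding split by (simp add: diff_divide_distrib add_divide_distrib distrib_right)
  qed
  also have "norm \<dots> \<le> (8 * KI * (R * m / W ^ 2) + 2 * KI / (W * real Q ^ 2)) / real m ^ 8"
    unfolding norm_divide norm_power norm_of_nat
    by (intro divide_right_mono order_trans[OF norm_triangle_ineq4] add_mono 2 3) auto
  finally show ?thesis unfolding tail_err_def using 1 by (simp only: I_def J_def)
qed

theorem circle_method:
  "norm (of_nat (N_q (coord_box Y) m B0)
     - 1 / of_nat m ^ 8 * (\<Prod>p\<in>prime_factors m. inverse (sing_series_at p)) * sing_series * sing_integral (coord_box Y))
   \<le> minor + total_err + tail_err"
proof -
  have "1 / of_nat m ^ 8 * (\<Prod>p\<in>prime_factors m. inverse (sing_series_at p)) * sing_series * sing_integral (coord_box Y)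
     = infsum C_q {r. r > 0 \<and> coprime m r} / of_nat m ^ 8 * sing_integral (coord_box Y)"
    unfolding sing_series_coprime_part[OF m(1), symmetric] by simp
  then show ?thesis
    using integral_estimate main_term_estimate
    by (metis (no_types, lifting) norm_diff_triangle_le)
qed

end

section \<open>Collecting the error terms\<close>

text \<open>0.98 and 1.02 are 1 - 2\<delta> and 1 + 2\<delta> at the extreme \<delta> = 0.01, so the
  threshold is uniform in \<delta>. After X >= 3, the conditions secure m <= Y, 2Q < R, mQ <= Z and
  a logarithm below X^0.001; X^0.6 + 1 bounds Q from above.\<close>

lemma eventually_large:
  fixes c1 c2 c3 :: real
  assumes c: "c1 > 0" "c2 > 0" "c3 > 0"
  shows "\<forall>\<^sub>F X in at_top. X \<ge> 3 \<and> c3 * X powr (1/3) \<le> inverse c1 * X powr 0.98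
     \<and> 2 * (X powr 0.6 + 1) < (4 * c1 + 1) * X \<and> c3 * X powr (1/3) * (X powr 0.6 + 1) \<le> c2 * X
     \<and> 1 + ln ((4 * c1 + 2) * X powr 1.02) \<le> X powr 0.001"
proof (intro eventually_conj)
  show "\<forall>\<^sub>F X in at_top. X \<ge> (3::real)" by (rule eventually_ge_at_top)
  show "\<forall>\<^sub>F X in at_top. c3 * X powr (1/3) \<le> inverse c1 * X powr 0.98" using c by real_asymp
  show "\<forall>\<^sub>F X in at_top. 2 * (X powr 0.6 + 1) < (4 * c1 + 1) * X" using c by real_asymp
  show "\<forall>\<^sub>F X in at_top. c3 * X powr (1/3) * (X powr 0.6 + 1) \<le> c2 * X" using c by real_asymp
  show "\<forall>\<^sub>F X in at_top. 1 + ln ((4 * c1 + 2) * X powr 1.02) \<le> X powr 0.001" using c by real_asymp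
qed

text \<open>A calculus of sizes: constants and exponents are multiplied and added separately, so
  that each error term ends in a numerical comparison of its exponent with 6.85.\<close>

definition bnd :: "real \<Rightarrow> real \<Rightarrow> real \<Rightarrow> real \<Rightarrow> bool" where
  "bnd H x k a \<longleftrightarrow> 0 \<le> x \<and> x \<le> k * H powr a"

lemma bnd_mult: "bnd H x k a \<Longrightarrow> bnd H y l b \<Longrightarrow> bnd H (x * y) (k * l) (a + b)"
proof -
  assume "bnd H x k a" "bnd H y l b"
  then have "0 \<le> x * y" "x * y \<le> (k * H powr a) * (l * H powr b)"
    unfolding bnd_def by (auto intro!: mult_mono order_trans[of 0 x])
  then show ?thesis by (simp add: bnd_def powr_add mult_ac)
qed

lemma bnd_power: "H \<ge> 1 \<Longrightarrow> bnd H x k a \<Longrightarrow> bnd H (x ^ n) (k ^ n) (n * a)"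
proof (induction n)
  case (Suc n)
  from bnd_mult[OF Suc.prems(2) Suc.IH[OF Suc.prems]] show ?case by (simp add: algebra_simps)
qed (simp add: bnd_def)

lemma bnd_const: "H \<ge> 1 \<Longrightarrow> c \<ge> 0 \<Longrightarrow> bnd H c c 0"
  by (simp add: bnd_def)

lemma bnd_target: "H \<ge> 1 \<Longrightarrow> bnd H x k a \<Longrightarrow> 0 \<le> k \<Longrightarrow> a \<le> 6.85 \<Longrightarrow> x \<le> k * H powr 6.85"
proof -
  assume "H \<ge> 1" "bnd H x k a" "0 \<le> k" "a \<le> 6.85"
  then have "k * H powr a \<le> k * H powr 6.85" by (intro mult_left_mono powr_mono)
  then show ?thesis using \<open>bnd H x k a\<close> by (simp add: bnd_def)
qed

lemma (in circle) error_eq: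
  "total_err = 48 * 4 * 64 ^ 3 * E * Z ^ 5 / real m ^ 3 + 1920 * 4 * 64 ^ 4 * Z ^ 6 / real m ^ 3
     + E ^ 4 * (48 * Z / m * Q + 1920 * (real Q ^ 2 + Q * W / (real R * real m))) * (2 / R)"
  "tail_err = 2 ^ 24 * Z ^ 5 * R / real m ^ 7 + 2 ^ 22 * Z ^ 7 / real Q ^ 2 / real m ^ 8"
proof -
  have mp: "real m > 0" using m by simp
  have Zp: "Z > 0" by (rule Y_pos(9))
  have W: "W = Z ^ 2" using Z by simp
  have "err_kern * (4 * m / W) = 48 * 4 * 64 ^ 3 * E * Z ^ 5 / real m ^ 3 + 1920 * 4 * 64 ^ 4 * Z ^ 6 / real m ^ 3"
  proof -
    define \<mu> where "\<mu> = real m"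
    have \<mu>: "\<mu> > 0" using mp by (simp add: \<mu>_def)
    have "48 * E * (Z / \<mu>) * (64 * Z ^ 2 / \<mu>) ^ 3 * (4 * \<mu> / Z ^ 2) = 48 * 4 * 64 ^ 3 * E * Z ^ 5 / \<mu> ^ 3"
      using \<mu> Zp by (simp add: field_simps eval_nat_numeral)
    moreover have "1920 * (64 * Z ^ 2 / \<mu>) ^ 4 * (4 * \<mu> / Z ^ 2) = 1920 * 4 * 64 ^ 4 * Z ^ 6 / \<mu> ^ 3"
      using \<mu> Zp by (simp add: field_simps eval_nat_numeral)
    ultimately show ?thesis unfolding err_kern_def D_def unfolding W \<mu>_def by (simp only: distrib_right of_nat_mult of_nat_numeral)
  qed
  then show "total_err = 48 * 4 * 64 ^ 3 * E * Z ^ 5 / real m ^ 3 + 1920 * 4 * 64 ^ 4 * Z ^ 6 / real m ^ 3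
     + E ^ 4 * (48 * Z / m * Q + 1920 * (real Q ^ 2 + Q * W / (real R * real m))) * (2 / R)"
    unfolding total_err_def by (simp only:)
  have 1: "8 * KI * (R * m / W ^ 2) = 2 ^ 24 * Z ^ 5 * R * m"
    unfolding KI_def unfolding W using Zp by (simp add: field_simps eval_nat_numeral)
  have 2: "2 * KI / (W * real Q ^ 2) = 2 ^ 22 * Z ^ 7 / real Q ^ 2"
    unfolding KI_def unfolding W using Zp Q by (simp add: field_simps eval_nat_numeral)
  have 3: "2 ^ 24 * Z ^ 5 * R * m / real m ^ 8 = 2 ^ 24 * Z ^ 5 * R / real m ^ 7"
    using mp by (simp add: field_simps eval_nat_numeral)
  show "tail_err = 2 ^ 24 * Z ^ 5 * R / real m ^ 7 + 2 ^ 22 * Z ^ 7 / real Q ^ 2 / real m ^ 8"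
    unfolding tail_err_def 1 2 add_divide_distrib 3 ..
qed

text \<open>One summand for each of the nine error monomials in \<open>final_bound\<close>;
  \<open>e\<close> is the constant of the error E.\<close>

definition final_const :: "real \<Rightarrow> real \<Rightarrow> real \<Rightarrow> real" where
  "final_const c1 c2 c3 = (let e = 9 * (4 * c1 + 2) in
     24 * 64 ^ 4 * c2 ^ 9 * c3 powr 0.5 + 24 * e ^ 4 * c2 * c3 powr 4.5
     + 48 * 4 * 64 ^ 3 * e * c2 ^ 5 * c3 powr 2.5 + 1920 * 4 * 64 ^ 4 * c2 ^ 6 * c3 powr 2.5
     + 2 * 48 * e ^ 4 * c2 * 2 * c3 powr 5.5 + 2 * 1920 * e ^ 4 * 2 ^ 2 * c3 powr 5.5
     + 2 * 1920 * e ^ 4 * 2 * c2 ^ 2 * c3 powr 5.5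
     + 2 ^ 24 * c2 ^ 5 * (4 * c1 + 2) + 2 ^ 22 * c2 ^ 7)"

text \<open>Sizes are measured in H, later X^(1 + 2\<delta>). After multiplication by m^5.5 each
  surplus factor m counts as H^(1/3). The critical exponents are 1.001 + 5 + 2.5/3 and 6 + 2.5/3,
  both below 6.85.\<close>

lemma (in circle) final_bound:
  fixes c1 c2 c3 X H :: real
  assumes c: "c1 > 0" "c2 > 0" "c3 > 0" and X: "X \<ge> 1" "X \<le> H"
    and ZX: "Z = c2 * X" and mX: "real m \<le> c3 * X powr (1/3)"
    and RH: "H \<le> R" "real R \<le> (4 * c1 + 2) * H" and QX: "X powr 0.6 \<le> Q" "real Q \<le> 2 * X powr 0.6"
    and lnR: "1 + ln (real R) \<le> X powr 0.001"
  shows "(minor + total_err + tail_err) * real m powr 5.5 \<le> final_const c1 c2 c3 * H powr 6.85"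
proof -
  define e where "e = 9 * (4 * c1 + 2)"
  define \<mu> where "\<mu> = real m"
  define g where "g = \<mu> powr 5.5"
  have \<mu>: "\<mu> \<ge> 1" using m by (simp add: \<mu>_def)
  have H: "H \<ge> 1" using X by simp
  have XH: "X powr a \<le> H powr a" if "a \<ge> 0" for a using X that by (intro powr_mono2) auto
  have Qp: "real Q > 0" using Q by simp
  have Rp: "real R > 0" using R_pos by simp
  have bZ: "bnd H Z c2 1" using X c H by (simp add: bnd_def ZX)
  have bR: "bnd H R (4 * c1 + 2) 1" using RH H by (simp add: bnd_def)
  have bR': "bnd H (1 / R) 1 (-1)" using RH H Rp by (simp add: bnd_def powr_minus field_simps)
  have bE: "bnd H E e 1.001"
  proof -
    have "1 + ln (real R) \<le> H powr 0.001" using lnR XH[of "0.001"] by simp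
    moreover have "0 \<le> 1 + ln (real R)" using Rp by simp
    ultimately have "bnd H (1 + ln R) 1 0.001" by (simp add: bnd_def)
    from bnd_mult[OF bnd_mult[OF bnd_const[OF H, of 9] bR] this]
    show ?thesis by (simp add: E_def e_def)
  qed
  have bQ: "bnd H Q 2 0.6" using QX XH[of "0.6"] by (simp add: bnd_def)
  have bmu: "bnd H (\<mu> powr a) (c3 powr a) (a / 3)" if "a \<ge> 0" for a
  proof -
    have "\<mu> powr a \<le> (c3 * X powr (1/3)) powr a" using that mX \<mu> by (intro powr_mono2) (auto simp: \<mu>_def)
    also have "\<dots> = c3 powr a * X powr (a / 3)" using c X by (simp add: powr_mult powr_powr)
    also have "\<dots> \<le> c3 powr a * H powr (a / 3)" using that by (intro mult_left_mono XH) auto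
    finally show ?thesis by (simp add: bnd_def)
  qed
  have gdiv: "g / \<mu> ^ n = \<mu> powr (5.5 - n)" for n using \<mu> by (simp add: g_def powr_diff powr_realpow)
  have g0: "g > 0" using \<mu> by (simp add: g_def)
  have bg: "bnd H g (c3 powr 5.5) (5.5 / 3)" unfolding g_def by (rule bmu) simp
  \<comment> \<open>Z and the lower bound for Q are powers of X, so the quotient is formed in X,
    with exponent 9 - 4 * 0.6 = 6.6, before X is replaced by H.\<close>
  have bZQ: "bnd H (Z ^ 9 / real Q ^ 4) (c2 ^ 9) 6.6"
  proof -
    have "X powr 2.4 = (X powr 0.6) ^ 4" using X by (simp add: powr_powr flip: powr_numeral)
    also have "\<dots> \<le> real Q ^ 4" using QX by (intro power_mono) auto
    finally have "Z ^ 9 / real Q ^ 4 \<le> Z ^ 9 / X powr 2.4"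
      using X Y_pos(9) Qp by (intro divide_left_mono mult_pos_pos) auto
    also have "\<dots> = c2 ^ 9 * (X powr 9 / X powr 2.4)" using X by (simp add: ZX power_mult_distrib)
    also have "X powr 9 / X powr 2.4 = X powr 6.6" by (simp flip: powr_diff)
    also have "c2 ^ 9 * X powr 6.6 \<le> c2 ^ 9 * H powr 6.6" using c by (intro mult_left_mono XH) auto
    finally show ?thesis using Y_pos by (simp add: bnd_def)
  qed
  have bZQ7: "bnd H (Z ^ 7 / real Q ^ 2) (c2 ^ 7) 5.8"
  proof -
    have "X powr 1.2 = (X powr 0.6) ^ 2" using X by (simp add: powr_powr flip: powr_numeral)
    also have "\<dots> \<le> real Q ^ 2" using QX by (intro power_mono) auto
    finally have "Z ^ 7 / real Q ^ 2 \<le> Z ^ 7 / X powr 1.2"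
      using X Y_pos(9) Qp by (intro divide_left_mono mult_pos_pos) auto
    also have "\<dots> = c2 ^ 7 * (X powr 7 / X powr 1.2)" using X by (simp add: ZX power_mult_distrib)
    also have "X powr 7 / X powr 1.2 = X powr 5.8" by (simp flip: powr_diff)
    also have "c2 ^ 7 * X powr 5.8 \<le> c2 ^ 7 * H powr 5.8" using c by (intro mult_left_mono XH) auto
    finally show ?thesis using Y_pos by (simp add: bnd_def)
  qed
  have bWR: "bnd H (W / R) (c2 ^ 2) 1"
  proof -
    have "W / R \<le> (c2 * H) ^ 2 / H"
      unfolding Z(2)[symmetric] ZX using X c RH H Y_pos by (intro frac_le power_mono mult_left_mono) auto
    also have "\<dots> = c2 ^ 2 * H powr 1" using H by (simp add: power2_eq_square)
    finally show ?thesis using Y_pos by (simp add: bnd_def)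
  qed
  note b = bnd_mult bnd_power[OF H] bnd_const[OF H]
  have e0: "e > 0" using c by (simp add: e_def)
  have t1: "24 * 64 ^ 4 * (Z ^ 9 / real Q ^ 4) * \<mu> powr 0.5 \<le> 24 * 64 ^ 4 * c2 ^ 9 * c3 powr 0.5 * H powr 6.85"
    by (rule bnd_target[OF H b(1)[OF b(1)[OF b(3) bZQ] bmu]]) (use c in auto)
  have t2: "24 * E ^ 4 * Z * \<mu> powr 4.5 \<le> 24 * e ^ 4 * c2 * c3 powr 4.5 * H powr 6.85"
    by (rule bnd_target[OF H b(1)[OF b(1)[OF b(1)[OF b(3) b(2)[OF bE]] bZ] bmu]]) (use c e0 in auto)
  have t3: "48 * 4 * 64 ^ 3 * E * Z ^ 5 * \<mu> powr 2.5 \<le> 48 * 4 * 64 ^ 3 * e * c2 ^ 5 * c3 powr 2.5 * H powr 6.85"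
    by (rule bnd_target[OF H b(1)[OF b(1)[OF b(1)[OF b(3) bE] b(2)[OF bZ]] bmu]]) (use c e0 in auto)
  have t4: "1920 * 4 * 64 ^ 4 * Z ^ 6 * \<mu> powr 2.5 \<le> 1920 * 4 * 64 ^ 4 * c2 ^ 6 * c3 powr 2.5 * H powr 6.85"
    by (rule bnd_target[OF H b(1)[OF b(1)[OF b(3) b(2)[OF bZ]] bmu]]) (use c e0 in auto)
  have t5: "2 * 48 * E ^ 4 * Z * Q * g * (1 / R) \<le> (2 * 48 * e ^ 4 * c2 * 2 * c3 powr 5.5) * 1 * H powr 6.85"
    by (rule bnd_target[OF H b(1)[OF b(1)[OF b(1)[OF b(1)[OF b(1)[OF b(3) b(2)[OF bE]] bZ] bQ] bg] bR']]) (use c e0 in auto)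
  have t6: "2 * 1920 * E ^ 4 * Q ^ 2 * g * (1 / R) \<le> (2 * 1920 * e ^ 4 * 2 ^ 2 * c3 powr 5.5) * 1 * H powr 6.85"
    unfolding of_nat_power
    by (rule bnd_target[OF H b(1)[OF b(1)[OF b(1)[OF b(1)[OF b(3) b(2)[OF bE]] b(2)[OF bQ]] bg] bR']]) (use c e0 in auto)
  have t7: "2 * 1920 * E ^ 4 * Q * (W / R) * g * (1 / R) \<le> (2 * 1920 * e ^ 4 * 2 * c2 ^ 2 * c3 powr 5.5) * 1 * H powr 6.85"
    by (rule bnd_target[OF H b(1)[OF b(1)[OF b(1)[OF b(1)[OF b(1)[OF b(3) b(2)[OF bE]] bQ] bWR] bg] bR']]) (use c e0 in auto)
  have t8: "2 ^ 24 * Z ^ 5 * R \<le> 2 ^ 24 * c2 ^ 5 * (4 * c1 + 2) * H powr 6.85"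
    by (rule bnd_target[OF H b(1)[OF b(1)[OF b(3) b(2)[OF bZ]] bR]]) (use c e0 in auto)
  have t9: "2 ^ 22 * (Z ^ 7 / real Q ^ 2) \<le> 2 ^ 22 * c2 ^ 7 * H powr 6.85"
    by (rule bnd_target[OF H b(1)[OF b(3) bZQ7]]) (use c e0 in auto)
  have minor: "minor * g \<le> 24 * 64 ^ 4 * (Z ^ 9 / real Q ^ 4) * \<mu> powr 0.5 + 24 * E ^ 4 * Z * \<mu> powr 4.5"
  proof -
    have "minor \<le> 8 * ((D / Q) ^ 4 + E ^ 4) * (3 * Z / m)"
      unfolding minor_def using Y_pos by (intro mult_right_mono fourth_power_sum_le) auto
    also have "\<dots> = 24 * 64 ^ 4 * (Z ^ 9 / real Q ^ 4) / \<mu> ^ 5 + 24 * E ^ 4 * Z / \<mu> ^ 1"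
      unfolding D_def unfolding Z(2)[symmetric] \<mu>_def[symmetric] using \<mu> Qp
      by (simp add: field_simps eval_nat_numeral)
    finally have "minor * g \<le> (24 * 64 ^ 4 * (Z ^ 9 / real Q ^ 4) / \<mu> ^ 5 + 24 * E ^ 4 * Z / \<mu> ^ 1) * g"
      using g0 by (intro mult_right_mono) auto
    also have "\<dots> = 24 * 64 ^ 4 * (Z ^ 9 / real Q ^ 4) * (g / \<mu> ^ 5) + 24 * E ^ 4 * Z * (g / \<mu> ^ 1)"
      by (simp only: distrib_right times_divide_eq_left times_divide_eq_right)
    finally show ?thesis unfolding gdiv by simp
  qed
  have total: "total_err * g \<le> 48 * 4 * 64 ^ 3 * E * Z ^ 5 * \<mu> powr 2.5 + 1920 * 4 * 64 ^ 4 * Z ^ 6 * \<mu> powr 2.5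
     + (2 * 48 * E ^ 4 * Z * Q * g * (1 / R) + 2 * 1920 * E ^ 4 * Q ^ 2 * g * (1 / R) + 2 * 1920 * E ^ 4 * Q * (W / R) * g * (1 / R))"
  proof -
    have 1: "(48 * 4 * 64 ^ 3 * E * Z ^ 5 / \<mu> ^ 3 + 1920 * 4 * 64 ^ 4 * Z ^ 6 / \<mu> ^ 3) * g
        = 48 * 4 * 64 ^ 3 * E * Z ^ 5 * \<mu> powr 2.5 + 1920 * 4 * 64 ^ 4 * Z ^ 6 * \<mu> powr 2.5"
    proof -
      have "(48 * 4 * 64 ^ 3 * E * Z ^ 5 / \<mu> ^ 3 + 1920 * 4 * 64 ^ 4 * Z ^ 6 / \<mu> ^ 3) * g
        = 48 * 4 * 64 ^ 3 * E * Z ^ 5 * (g / \<mu> ^ 3) + 1920 * 4 * 64 ^ 4 * Z ^ 6 * (g / \<mu> ^ 3)"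
        by (simp only: distrib_right times_divide_eq_left times_divide_eq_right)
      then show ?thesis unfolding gdiv by simp
    qed
    have "48 * Z / \<mu> * Q + 1920 * (real Q ^ 2 + Q * W / (real R * \<mu>)) \<le> 48 * Z * Q + 1920 * (real Q ^ 2 + Q * (W / R))"
    proof -
      have "Z / \<mu> \<le> Z / 1" using \<mu> Y_pos by (intro divide_left_mono) auto
      then have "48 * (Z / \<mu> * Q) \<le> 48 * (Z * Q)" by (intro mult_left_mono mult_right_mono) auto
      moreover have "Q * W / (real R * \<mu>) \<le> Q * W / (real R * 1)"
        using \<mu> Y_pos Rp by (intro divide_left_mono mult_left_mono mult_pos_pos) auto
      ultimately show ?thesis by simp
    qed
    then have "E ^ 4 * (48 * Z / \<mu> * Q + 1920 * (real Q ^ 2 + Q * W / (real R * \<mu>))) * (2 / R) * g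
       \<le> E ^ 4 * (48 * Z * Q + 1920 * (real Q ^ 2 + Q * (W / R))) * (2 / R) * g"
      using g0 by (intro mult_right_mono mult_left_mono) auto
    also have "\<dots> = 2 * 48 * E ^ 4 * Z * Q * g * (1 / R) + 2 * 1920 * E ^ 4 * Q ^ 2 * g * (1 / R) + 2 * 1920 * E ^ 4 * Q * (W / R) * g * (1 / R)"
      by (simp add: algebra_simps)
    finally show ?thesis
      using 1 unfolding error_eq(1) \<mu>_def[symmetric] by (simp only: distrib_right[of _ _ g])
  qed
  have tail: "tail_err * g \<le> 2 ^ 24 * Z ^ 5 * R + 2 ^ 22 * (Z ^ 7 / real Q ^ 2)"
  proof -
    \<comment> \<open>From n = 6 on the remaining power of m is negative and can be
      discarded.\<close>
    have le1: "g / \<mu> ^ n \<le> 1" if "n \<ge> 6" for n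
      unfolding gdiv using \<mu> that powr_mono[of "5.5 - n" 0 \<mu>] by simp
    have "tail_err * g = 2 ^ 24 * Z ^ 5 * R * (g / \<mu> ^ 7) + 2 ^ 22 * (Z ^ 7 / real Q ^ 2) * (g / \<mu> ^ 8)"
      unfolding error_eq(2) \<mu>_def[symmetric] by (simp only: distrib_right times_divide_eq_left times_divide_eq_right)
    also have "\<dots> \<le> 2 ^ 24 * Z ^ 5 * R * 1 + 2 ^ 22 * (Z ^ 7 / real Q ^ 2) * 1"
      using Y_pos by (intro add_mono mult_left_mono le1) auto
    finally show ?thesis by simp
  qed
  have "(minor + total_err + tail_err) * g = minor * g + total_err * g + tail_err * g" by (simp add: distrib_right)
  also have "\<dots> \<le> final_const c1 c2 c3 * H powr 6.85"
    using minor total tail t1 t2 t3 t4 t5 t6 t7 t8 t9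
    unfolding final_const_def Let_def e_def[symmetric] distrib_right mult_1_right by linarith
  finally show ?thesis unfolding g_def \<mu>_def .
qed

theorem theorem4p2:
  fixes c1 c2 c3 :: real
  assumes "c1 > 0" and "c2 > 0" and "c3 > 0"
  shows "(\<exists>C X0 :: real. \<forall>(\<delta> :: real) (X :: real) (Y :: 4 \<Rightarrow> 4 \<Rightarrow> real) (m :: nat) (B0 :: int ^ 4 ^ 4).
           0 < \<delta> \<longrightarrow> \<delta> < 0.01 \<longrightarrow> X \<ge> X0 \<longrightarrow>
           (\<forall>(i, j) \<in> coords. inverse c1 * X powr (1 - 2 * \<delta>) \<le> Y i j
                              \<and> Y i j \<le> c1 * X powr (1 + 2 * \<delta>)) \<longrightarrow>
           Y 1 4 = c2 * X \<longrightarrow>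
           Y 1 1 * Y 4 4 = c2\<^sup>2 * X\<^sup>2 \<longrightarrow>
           Y 2 2 * Y 3 3 = c2\<^sup>2 * X\<^sup>2 \<longrightarrow>
           Y 1 2 * Y 3 4 = c2\<^sup>2 * X\<^sup>2 \<longrightarrow>
           Y 1 3 * Y 2 4 = c2\<^sup>2 * X\<^sup>2 \<longrightarrow>
           m > 0 \<longrightarrow> odd m \<longrightarrow> squarefree m \<longrightarrow> real m \<le> c3 * X powr (1 / 3) \<longrightarrow>
           B0 \<in> V \<longrightarrow> int m dvd quad_q B0 \<longrightarrow>
           (\<forall>p. prime p \<longrightarrow> p dvd m \<longrightarrow> (\<exists>(i, j) \<in> coords. \<not> int p dvd B0 $ i $ j)) \<longrightarrow>
           cmod (of_nat (N_q (coord_box Y) m B0)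
                 - 1 / of_nat m ^ 8 * (\<Prod>p \<in> prime_factors m. inverse (sing_series_at p))
                   * sing_series * sing_integral (coord_box Y))
             \<le> C * (X powr (6.85 * (1 + 2 * \<delta>)) / real m powr 5.5 * ln X))
         \<and> summable (\<lambda>r. cmod (C_q (Suc r)))
         \<and> (\<forall>p. prime p \<longrightarrow> summable (\<lambda>l. cmod (C_q (p ^ l))))
         \<and> sing_series \<in> \<real> \<and> 0 < Re sing_series
         \<and> (\<forall>p. prime p \<longrightarrow> sing_series_at p \<in> \<real> \<and> 0 < Re (sing_series_at p))"
proof (intro conjI allI impI)
  show "summable (\<lambda>r. cmod (C_q (Suc r)))" using summable_norm_C_q by (subst summable_Suc_iff)
  show "sing_series \<in> \<real>" "0 < Re sing_series" by (rule sing_series_props)+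
next
  fix p :: nat assume p: "prime p"
  show "summable (\<lambda>l. cmod (C_q (p ^ l)))" by (rule summable_C_q_prime_powers[OF p])
  show "sing_series_at p \<in> \<real>" "0 < Re (sing_series_at p)" by (rule sing_series_at_props[OF p])+
next
  obtain X0 where X0: "\<And>X. X \<ge> X0 \<Longrightarrow> X \<ge> 3 \<and> c3 * X powr (1/3) \<le> inverse c1 * X powr 0.98
     \<and> 2 * (X powr 0.6 + 1) < (4 * c1 + 1) * X \<and> c3 * X powr (1/3) * (X powr 0.6 + 1) \<le> c2 * X
     \<and> 1 + ln ((4 * c1 + 2) * X powr 1.02) \<le> X powr 0.001"
    using eventually_large[OF assms] unfolding eventually_at_top_linorder by blast
  show "\<exists>C X0 :: real. \<forall>(\<delta> :: real) (X :: real) (Y :: 4 \<Rightarrow> 4 \<Rightarrow> real) (m :: nat) (B0 :: int ^ 4 ^ 4).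
           0 < \<delta> \<longrightarrow> \<delta> < 0.01 \<longrightarrow> X \<ge> X0 \<longrightarrow>
           (\<forall>(i, j) \<in> coords. inverse c1 * X powr (1 - 2 * \<delta>) \<le> Y i j
                              \<and> Y i j \<le> c1 * X powr (1 + 2 * \<delta>)) \<longrightarrow>
           Y 1 4 = c2 * X \<longrightarrow>
           Y 1 1 * Y 4 4 = c2\<^sup>2 * X\<^sup>2 \<longrightarrow>
           Y 2 2 * Y 3 3 = c2\<^sup>2 * X\<^sup>2 \<longrightarrow>
           Y 1 2 * Y 3 4 = c2\<^sup>2 * X\<^sup>2 \<longrightarrow>
           Y 1 3 * Y 2 4 = c2\<^sup>2 * X\<^sup>2 \<longrightarrow>
           m > 0 \<longrightarrow> odd m \<longrightarrow> squarefree m \<longrightarrow> real m \<le> c3 * X powr (1 / 3) \<longrightarrow>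
           B0 \<in> V \<longrightarrow> int m dvd quad_q B0 \<longrightarrow>
           (\<forall>p. prime p \<longrightarrow> p dvd m \<longrightarrow> (\<exists>(i, j) \<in> coords. \<not> int p dvd B0 $ i $ j)) \<longrightarrow>
           cmod (of_nat (N_q (coord_box Y) m B0)
                 - 1 / of_nat m ^ 8 * (\<Prod>p \<in> prime_factors m. inverse (sing_series_at p))
                   * sing_series * sing_integral (coord_box Y))
             \<le> C * (X powr (6.85 * (1 + 2 * \<delta>)) / real m powr 5.5 * ln X)"
  \<comment> \<open>Both witnesses depend only on c1, c2 and c3, where c3 is the constant implicit
    in m << X^(1/3).\<close>
  proof (rule exI[of _ "final_const c1 c2 c3"], rule exI[of _ X0], intro allI impI, goal_cases)
    case (1 \<delta> X Y m B0)
    note hyps = 1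
    define H where "H = X powr (1 + 2 * \<delta>)"
    \<comment> \<open>4 c1 H covers four times every side, and the additional H gives R >= H.
      Rounding up costs at most another H, whence 4 c1 + 2.\<close>
    define R where "R = nat \<lceil>(4 * c1 + 1) * H\<rceil>"
    define Q where "Q = nat \<lceil>X powr 0.6\<rceil>"
    have X: "X \<ge> 3" "c3 * X powr (1/3) \<le> inverse c1 * X powr 0.98" "2 * (X powr 0.6 + 1) < (4 * c1 + 1) * X"
      "c3 * X powr (1/3) * (X powr 0.6 + 1) \<le> c2 * X" "1 + ln ((4 * c1 + 2) * X powr 1.02) \<le> X powr 0.001"
      using X0[OF hyps(3)] by auto
    have XH: "X \<le> H" using X hyps(1) powr_mono[of 1 "1 + 2 * \<delta>" X] by (simp add: H_def)
    have H1: "H \<ge> 1" using XH X by simp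
    have R: "(4 * c1 + 1) * H \<le> R" "real R \<le> (4 * c1 + 2) * H"
    proof -
      have "0 \<le> (4 * c1 + 1) * H" using assms H1 by simp
      then show "(4 * c1 + 1) * H \<le> R" "real R \<le> (4 * c1 + 2) * H"
        unfolding R_def using H1 by (simp_all add: algebra_simps) linarith+
    qed
    have X6: "X powr 0.6 \<ge> 1" using X by (intro ge_one_powr_ge_zero) auto
    have Qb: "X powr 0.6 \<le> Q" "real Q \<le> X powr 0.6 + 1" "Q \<ge> 1"
      unfolding Q_def using X6 by (simp_all, linarith+)
    have Yb: "inverse c1 * X powr 0.98 \<le> Y i j" "Y i j \<le> c1 * H" if "(i, j) \<in> coords" for i j
    proof -
      have "inverse c1 * X powr 0.98 \<le> inverse c1 * X powr (1 - 2 * \<delta>)"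
        using assms X hyps(2) by (intro mult_left_mono powr_mono) auto
      then show "inverse c1 * X powr 0.98 \<le> Y i j" "Y i j \<le> c1 * H"
        using hyps(4) that by (auto simp: H_def)
    qed
    have Y0: "0 < Y i j" if "(i, j) \<in> coords" for i j
    proof -
      have "0 < inverse c1 * X powr 0.98" using assms X by simp
      then show ?thesis using Yb(1)[OF that] by linarith
    qed
    interpret circle Y "c2\<^sup>2 * X\<^sup>2" "c2 * X" m R Q B0
    proof
      show "real m \<le> Y i j" if "(i, j) \<in> coords" for i j using Yb(1)[OF that] X(2) hyps(13) by linarith
      show "4 * Y i j \<le> R" if "(i, j) \<in> coords" for i j
      proof -
        have "4 * Y i j \<le> 4 * (c1 * H)" using Yb(2)[OF that] by simp
        also have "\<dots> \<le> (4 * c1 + 1) * H" using H1 by (simp add: algebra_simps)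
        finally show ?thesis using R by linarith
      qed
      show "2 * Q < R"
      proof -
        have "2 * real Q \<le> 2 * (X powr 0.6 + 1)" using Qb by simp
        also have "\<dots> < (4 * c1 + 1) * X" by (rule X(3))
        also have "\<dots> \<le> (4 * c1 + 1) * H" using XH assms by (intro mult_left_mono) auto
        finally show ?thesis using R by linarith
      qed
      show "real (m * Q) \<le> c2 * X"
      proof -
        have "real m * real Q \<le> (c3 * X powr (1/3)) * (X powr 0.6 + 1)"
          using hyps(13) Qb by (intro mult_mono) auto
        then show ?thesis using X(4) by simp
      qed
    qed (use hyps Y0 Qb in \<open>auto simp: power_mult_distrib\<close>)
    have lnR: "1 + ln (real R) \<le> X powr 0.001"
    proof -
      have "real R \<le> (4 * c1 + 2) * X powr 1.02"
      proof -
        have "H \<le> X powr 1.02" unfolding H_def using X hyps(2) by (intro powr_mono) auto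
        then have "(4 * c1 + 2) * H \<le> (4 * c1 + 2) * X powr 1.02" using assms by (intro mult_left_mono) auto
        then show ?thesis using R by linarith
      qed
      then have "ln (real R) \<le> ln ((4 * c1 + 2) * X powr 1.02)"
        using R_pos by (intro ln_mono) auto
      then show ?thesis using X(5) by linarith
    qed
    have "(minor + total_err + tail_err) * real m powr 5.5 \<le> final_const c1 c2 c3 * H powr 6.85"
    proof (rule final_bound[OF assms])
      have "1 * H \<le> (4 * c1 + 1) * H" using assms H1 by (intro mult_right_mono) auto
      then show "H \<le> R" using R by linarith
      show "real Q \<le> 2 * X powr 0.6" using Qb X6 by linarith
    qed (use X XH R Qb lnR hyps(13) in auto)
    also have "H powr 6.85 = X powr (6.85 * (1 + 2 * \<delta>))" using X by (simp add: H_def powr_powr mult.commute)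
    finally have "(minor + total_err + tail_err) * real m powr 5.5 \<le> final_const c1 c2 c3 * X powr (6.85 * (1 + 2 * \<delta>))" .
    then have *: "minor + total_err + tail_err \<le> final_const c1 c2 c3 * (X powr (6.85 * (1 + 2 * \<delta>)) / real m powr 5.5)"
      using hyps(10) by (simp add: field_simps)
    \<comment> \<open>X >= 3 >= e. The bound obtained so far has no logarithm, because 1 + log R was
      absorbed into X^0.001; multiplying by log X only enlarges it.\<close>
    have "1 \<le> ln X"
    proof -
      have "exp 1 \<le> X" using exp_le X(1) by linarith
      then show ?thesis using X(1) by (subst ln_ge_iff) auto
    qed
    moreover have "0 \<le> final_const c1 c2 c3"
      unfolding final_const_def Let_def using assms by (intro add_nonneg_nonneg mult_nonneg_nonneg) auto
    ultimately have "final_const c1 c2 c3 * (X powr (6.85 * (1 + 2 * \<delta>)) / real m powr 5.5) * 1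
       \<le> final_const c1 c2 c3 * (X powr (6.85 * (1 + 2 * \<delta>)) / real m powr 5.5) * ln X"
      by (intro mult_left_mono mult_nonneg_nonneg) auto
    then show ?case using circle_method * by (simp add: mult.assoc)
  qed
qed

end
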